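(* Consider the Lagrangian compressible Euler equations with initial data constant to the left and to the right of some compact interval, and with piecewise constant, non-decreasing entropy $m(x)$ having finitely many jumps. Suppose the initial data are nowhere compressive ($\alpha\ge0$ and $\beta\ge0$ everywhere at $t=0$). Then a global shock-free solution contains an asymptotic vacuum if and only if $$u_0(\infty)-u_0(-\infty)\ge m(-\infty)\,z_0(-\infty)+m(\infty)\,z_0(\infty).$$
   Context: Equations. Fix constants $\gamma>1$, $K>0$, $c_v>0$. The Lagrangian compressible Euler equations for a polytropic ideal gas are $$\tau_t-u_x=0,\quad u_t+p_x=0,\quad (\tfrac12u^2+e)_t+(up)_x=0,$$ for $x\in\mathbb R$, $t\ge0$, with specific volume $\tau>0$, velocity $u$, pressure $p=Ke^{S/c_v}\tau^{-\gamma}$, entropy $S$, and $e=p\tau/(\gamma-1)$. For smooth solutions the third equation is equivalent to $S_t=0$. Set $d=\frac{\gamma+1}{\gamma-1}$, $C_z=(d-1)^{1/(1-d)}$, $C_m=\sqrt{K\gamma}\,C_z^{-d}$, and $m=C_me^{S/2c_v}$ (the entropy variable), $z=C_z\tau^{-(\gamma-1)/2}$. Then the Lagrangian sound speed is $c=\sqrt{-p_\tau}=mz^d$, $p=\frac{m^2z^{1+d}}{d+1}$, $\tau=\frac{z^{1-d}}{d-1}$. Subscript $0$ denotes initial data at $t=0$, and $\pm\infty$ denotes limits as $x\to\pm\infty$. Global shock-free solution (piecewise constant entropy): a solution for all $t\ge0$ with $z>0$, time-independent entropy $m(x)$, with $u,p$ continuous on $\mathbb R\times[0,\infty)$ and $C^2$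 up to the boundary on each closed strip between consecutive jump points of $m$, where the equations hold classically. Compressive: $\alpha=u_x+p_x/c$, $\beta=u_x-p_x/c$ (one-sided values at jumps of $m$); forward compressive iff $\alpha<0$, backward compressive iff $\beta<0$. A forward (resp. backward) characteristic is a continuous curve $x(t)$ with $dx/dt=c$ (resp. $-c$), continued across the jumps of $m$. Asymptotic vacuum: a characteristic having a vertical asymptote, i.e. defined for all large $t$ and converging to a finite $x$-limit as $t\to\infty$. *)

theory Defs
  imports "HOL-Analysis.Analysis"
begin

text \<open>
  A state is given by \<open>\<tau>\<close>, \<open>u\<close> (functions of \<open>(x, t)\<close>) and a time-independent entropy \<open>S\<close>
  (a function of \<open>x\<close>).  Only \<open>t \<ge> 0\<close> is ever looked at.
\<close>

subsection \<open>State variables of a polytropic ideal gas\<close>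

definition d_exp :: "real \<Rightarrow> real" where
  "d_exp \<gamma> = (\<gamma> + 1) / (\<gamma> - 1)"

definition C_z :: "real \<Rightarrow> real" where
  "C_z \<gamma> = (d_exp \<gamma> - 1) powr (1 / (1 - d_exp \<gamma>))"

definition C_m :: "real \<Rightarrow> real \<Rightarrow> real" where
  "C_m \<gamma> K = sqrt (K * \<gamma>) * C_z \<gamma> powr (- d_exp \<gamma>)"

definition pressure ::
  "real \<Rightarrow> real \<Rightarrow> real \<Rightarrow> (real \<times> real \<Rightarrow> real) \<Rightarrow> (real \<Rightarrow> real) \<Rightarrow> real \<times> real \<Rightarrow> real" where
  "pressure \<gamma> K c\<^sub>v \<tau> S q = K * exp (S (fst q) / c\<^sub>v) * \<tau> q powr (- \<gamma>)"

definition internal_energy ::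
  "real \<Rightarrow> real \<Rightarrow> real \<Rightarrow> (real \<times> real \<Rightarrow> real) \<Rightarrow> (real \<Rightarrow> real) \<Rightarrow> real \<times> real \<Rightarrow> real" where
  "internal_energy \<gamma> K c\<^sub>v \<tau> S q = pressure \<gamma> K c\<^sub>v \<tau> S q * \<tau> q / (\<gamma> - 1)"

definition m_var :: "real \<Rightarrow> real \<Rightarrow> real \<Rightarrow> (real \<Rightarrow> real) \<Rightarrow> real \<Rightarrow> real" where
  "m_var \<gamma> K c\<^sub>v S x = C_m \<gamma> K * exp (S x / (2 * c\<^sub>v))"

definition z_var :: "real \<Rightarrow> (real \<times> real \<Rightarrow> real) \<Rightarrow> real \<times> real \<Rightarrow> real" where
  "z_var \<gamma> \<tau> q = C_z \<gamma> * \<tau> q powr (- (\<gamma> - 1) / 2)"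

definition sound_speed ::
  "real \<Rightarrow> real \<Rightarrow> real \<Rightarrow> (real \<times> real \<Rightarrow> real) \<Rightarrow> (real \<Rightarrow> real) \<Rightarrow> real \<times> real \<Rightarrow> real" where
  "sound_speed \<gamma> K c\<^sub>v \<tau> S q = m_var \<gamma> K c\<^sub>v S (fst q) * z_var \<gamma> \<tau> q powr d_exp \<gamma>"

lemma sound_speed_sqrt:
  assumes "\<gamma> > 1" "K > 0" "\<tau> q > 0"
  shows "sound_speed \<gamma> K c\<^sub>v \<tau> S q
           = sqrt (- deriv (\<lambda>v. K * exp (S (fst q) / c\<^sub>v) * v powr (- \<gamma>)) (\<tau> q))"
proof -
  have d: "deriv (\<lambda>v. K * exp (S (fst q) / c\<^sub>v) * v powr (- \<gamma>)) (\<tau> q)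
             = - (K * \<gamma> * exp (S (fst q) / c\<^sub>v) * \<tau> q powr (- \<gamma> - 1))"
    by (rule DERIV_imp_deriv) (use assms in \<open>auto intro!: derivative_eq_intros\<close>)
  have Cz: "C_z \<gamma> > 0"
    using assms by (simp add: C_z_def d_exp_def divide_simps)
  have e: "sqrt (exp (S (fst q) / c\<^sub>v)) = exp (S (fst q) / (2 * c\<^sub>v))"
    by (rule real_sqrt_unique) (auto simp: power2_eq_square simp flip: exp_add)
  have "(\<gamma> - 1) * d_exp \<gamma> = \<gamma> + 1"
    using assms by (simp add: d_exp_def)
  then have x: "- (\<gamma> - 1) / 2 * d_exp \<gamma> = (- \<gamma> - 1) * (1 / 2)"
    by (simp add: field_simps)
  have t: "sqrt (\<tau> q powr (- \<gamma> - 1)) = \<tau> q powr (- (\<gamma> - 1) / 2 * d_exp \<gamma>)"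
    unfolding x by (simp add: powr_half_sqrt[symmetric] powr_powr)
  have "sound_speed \<gamma> K c\<^sub>v \<tau> S q
          = sqrt (K * \<gamma>) * exp (S (fst q) / (2 * c\<^sub>v)) * \<tau> q powr (- (\<gamma> - 1) / 2 * d_exp \<gamma>)"
    using Cz by (simp add: sound_speed_def m_var_def z_var_def C_m_def powr_mult powr_powr powr_minus)
  also have "\<dots> = sqrt (K * \<gamma> * exp (S (fst q) / c\<^sub>v) * \<tau> q powr (- \<gamma> - 1))"
    by (simp add: real_sqrt_mult e t)
  finally show ?thesis by (simp add: d)
qed

subsection \<open>Regularity on closed strips\<close>

text \<open>
  For the closed strips below (convex with nonempty interior), differentiability within the set
  means that the interior partial derivatives extend continuously to the boundary.
\<close>

definition C1_on :: "(real \<times> real) set \<Rightarrow> (real \<times> real \<Rightarrow> real) \<Rightarrow> bool" where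
  "C1_on D f \<longleftrightarrow> (\<exists>f\<^sub>x f\<^sub>t. continuous_on D f\<^sub>x \<and> continuous_on D f\<^sub>t \<and>
     (\<forall>q\<in>D. (f has_derivative (\<lambda>h. f\<^sub>x q * fst h + f\<^sub>t q * snd h)) (at q within D)))"

definition C2_on :: "(real \<times> real) set \<Rightarrow> (real \<times> real \<Rightarrow> real) \<Rightarrow> bool" where
  "C2_on D f \<longleftrightarrow> (\<exists>f\<^sub>x f\<^sub>t. C1_on D f\<^sub>x \<and> C1_on D f\<^sub>t \<and>
     (\<forall>q\<in>D. (f has_derivative (\<lambda>h. f\<^sub>x q * fst h + f\<^sub>t q * snd h)) (at q within D)))"

definition jumps :: "(real \<Rightarrow> real) \<Rightarrow> real set" where
  "jumps m = {x. \<not> isCont m x}"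

text \<open>The value of \<open>m\<close> at a jump itself is left unconstrained.\<close>

definition piecewise_constant :: "(real \<Rightarrow> real) \<Rightarrow> bool" where
  "piecewise_constant m \<longleftrightarrow>
     finite (jumps m) \<and> (\<forall>I\<in>components (- jumps m). m constant_on I)"

subsection \<open>Global shock-free solutions\<close>

text \<open>\<open>w\<^sub>t + f\<^sub>x = 0\<close> at a point, with a one-sided time derivative at \<open>t = 0\<close>.\<close>

definition balance_at ::
  "(real \<times> real \<Rightarrow> real) \<Rightarrow> (real \<times> real \<Rightarrow> real) \<Rightarrow> real \<Rightarrow> real \<Rightarrow> bool" where
  "balance_at w f x t \<longleftrightarrow> (\<exists>w\<^sub>t f\<^sub>x.
     ((\<lambda>s. w (x, s)) has_real_derivative w\<^sub>t) (at t within {0..}) \<and>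
     ((\<lambda>y. f (y, t)) has_real_derivative f\<^sub>x) (at x) \<and> w\<^sub>t + f\<^sub>x = 0)"

text \<open>
  The components \<open>I\<close> of the complement of the jump set are the open intervals between consecutive
  jumps (two of them unbounded), so \<open>closure I \<times> {0..}\<close> are the closed strips.  The equations are
  imposed for \<open>x \<in> I\<close>; by the regularity up to the boundary they then hold for the one-sided
  limits at the jumps as well.  At a jump, \<open>\<tau>\<close> and \<open>S\<close> have no canonical value (only \<open>u\<close> and the
  pressure are continuous there), which is why one-sided limits are used in the definitions that
  follow.
\<close>

definition global_shock_free ::
  "real \<Rightarrow> real \<Rightarrow> real \<Rightarrow> (real \<times> real \<Rightarrow> real) \<Rightarrow> (real \<times> real \<Rightarrow> real) \<Rightarrow> (real \<Rightarrow> real) \<Rightarrow> bool" where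
  "global_shock_free \<gamma> K c\<^sub>v \<tau> u S \<longleftrightarrow>
     (let m = m_var \<gamma> K c\<^sub>v S;
          z = z_var \<gamma> \<tau>;
          p = pressure \<gamma> K c\<^sub>v \<tau> S;
          e = internal_energy \<gamma> K c\<^sub>v \<tau> S
      in piecewise_constant m \<and>
         (\<forall>x. \<forall>t\<ge>0. \<tau> (x, t) > 0 \<and> z (x, t) > 0) \<and>
         continuous_on (UNIV \<times> {0..}) u \<and> continuous_on (UNIV \<times> {0..}) p \<and>
         (\<forall>I\<in>components (- jumps m).
            C2_on (closure I \<times> {0..}) u \<and> C2_on (closure I \<times> {0..}) p \<and>
            (\<forall>x\<in>I. \<forall>t\<ge>0.
               balance_at \<tau> (\<lambda>q. - u q) x t \<and>
               balance_at u p x t \<and>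
               balance_at (\<lambda>q. (u q)\<^sup>2 / 2 + e q) (\<lambda>q. u q * p q) x t)))"

subsection \<open>Compression\<close>

text \<open>
  The argument \<open>F\<close> is \<open>at_left x\<close> or \<open>at_right x\<close>, giving the one-sided value of
  \<open>\<alpha> = u\<^sub>x + p\<^sub>x / c\<close> resp.\ \<open>\<beta> = u\<^sub>x - p\<^sub>x / c\<close> at \<open>(x, t)\<close>; away from jumps the two sides agree.
\<close>

definition alpha ::
  "real \<Rightarrow> real \<Rightarrow> real \<Rightarrow> (real \<times> real \<Rightarrow> real) \<Rightarrow> (real \<times> real \<Rightarrow> real) \<Rightarrow> (real \<Rightarrow> real)
     \<Rightarrow> real filter \<Rightarrow> real \<Rightarrow> real" where
  "alpha \<gamma> K c\<^sub>v \<tau> u S F t =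
     vector_derivative (\<lambda>y. u (y, t)) F
     + vector_derivative (\<lambda>y. pressure \<gamma> K c\<^sub>v \<tau> S (y, t)) F
         / Lim F (\<lambda>y. sound_speed \<gamma> K c\<^sub>v \<tau> S (y, t))"

definition beta ::
  "real \<Rightarrow> real \<Rightarrow> real \<Rightarrow> (real \<times> real \<Rightarrow> real) \<Rightarrow> (real \<times> real \<Rightarrow> real) \<Rightarrow> (real \<Rightarrow> real)
     \<Rightarrow> real filter \<Rightarrow> real \<Rightarrow> real" where
  "beta \<gamma> K c\<^sub>v \<tau> u S F t =
     vector_derivative (\<lambda>y. u (y, t)) F
     - vector_derivative (\<lambda>y. pressure \<gamma> K c\<^sub>v \<tau> S (y, t)) F
         / Lim F (\<lambda>y. sound_speed \<gamma> K c\<^sub>v \<tau> S (y, t))"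

definition nowhere_compressive_initially ::
  "real \<Rightarrow> real \<Rightarrow> real \<Rightarrow> (real \<times> real \<Rightarrow> real) \<Rightarrow> (real \<times> real \<Rightarrow> real) \<Rightarrow> (real \<Rightarrow> real) \<Rightarrow> bool" where
  "nowhere_compressive_initially \<gamma> K c\<^sub>v \<tau> u S \<longleftrightarrow>
     (\<forall>x. \<forall>F\<in>{at_left x, at_right x}.
        alpha \<gamma> K c\<^sub>v \<tau> u S F 0 \<ge> 0 \<and> beta \<gamma> K c\<^sub>v \<tau> u S F 0 \<ge> 0)"

definition constant_outside_compact :: "(real \<Rightarrow> real) \<Rightarrow> bool" where
  "constant_outside_compact f \<longleftrightarrow> (\<exists>a b. a \<le> b \<and> f constant_on {..a} \<and> f constant_on {b..})"

subsection \<open>Characteristics and asymptotic vacuums\<close>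

text \<open>
  At a jump the curve has one-sided slopes.  A forward characteristic crosses from left to right,
  so its slope just before (after) the crossing is the left (right) limit of \<open>c\<close> in \<open>x\<close>; for
  backward ones the sides are exchanged.  Requiring \<open>dx/dt = \<plusminus>c\<close> only off the jumps would also
  admit curves that stop at a jump, which are not characteristics.
\<close>

definition forward_characteristic ::
  "real \<Rightarrow> real \<Rightarrow> real \<Rightarrow> (real \<times> real \<Rightarrow> real) \<Rightarrow> (real \<Rightarrow> real) \<Rightarrow> real \<Rightarrow> (real \<Rightarrow> real) \<Rightarrow> bool" where
  "forward_characteristic \<gamma> K c\<^sub>v \<tau> S t\<^sub>0 X \<longleftrightarrow>
     continuous_on {t\<^sub>0..} X \<and>
     (\<forall>t\<ge>t\<^sub>0. (X has_real_derivative
        Lim (at_right (X t)) (\<lambda>y. sound_speed \<gamma> K c\<^sub>v \<tau> S (y, t))) (at_right t)) \<and>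
     (\<forall>t>t\<^sub>0. (X has_real_derivative
        Lim (at_left (X t)) (\<lambda>y. sound_speed \<gamma> K c\<^sub>v \<tau> S (y, t))) (at_left t))"

definition backward_characteristic ::
  "real \<Rightarrow> real \<Rightarrow> real \<Rightarrow> (real \<times> real \<Rightarrow> real) \<Rightarrow> (real \<Rightarrow> real) \<Rightarrow> real \<Rightarrow> (real \<Rightarrow> real) \<Rightarrow> bool" where
  "backward_characteristic \<gamma> K c\<^sub>v \<tau> S t\<^sub>0 X \<longleftrightarrow>
     continuous_on {t\<^sub>0..} X \<and>
     (\<forall>t\<ge>t\<^sub>0. (X has_real_derivative
        - Lim (at_left (X t)) (\<lambda>y. sound_speed \<gamma> K c\<^sub>v \<tau> S (y, t))) (at_right t)) \<and>
     (\<forall>t>t\<^sub>0. (X has_real_derivative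
        - Lim (at_right (X t)) (\<lambda>y. sound_speed \<gamma> K c\<^sub>v \<tau> S (y, t))) (at_left t))"

definition has_asymptotic_vacuum ::
  "real \<Rightarrow> real \<Rightarrow> real \<Rightarrow> (real \<times> real \<Rightarrow> real) \<Rightarrow> (real \<Rightarrow> real) \<Rightarrow> bool" where
  "has_asymptotic_vacuum \<gamma> K c\<^sub>v \<tau> S \<longleftrightarrow>
     (\<exists>t\<^sub>0\<ge>0. \<exists>X L.
        (forward_characteristic \<gamma> K c\<^sub>v \<tau> S t\<^sub>0 X \<or> backward_characteristic \<gamma> K c\<^sub>v \<tau> S t\<^sub>0 X) \<and>
        (X \<longlongrightarrow> L) at_top)"

end

theory Submission
  imports Defs
begin

text \<open>
  On a strip of constant entropy put \<open>w = m z\<close>; then \<open>s = u + w\<close> is carried by forward and \<open>r = u - w\<close> by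
  backward characteristics, with speed \<open>c = k (s - r)\<^sup>d\<close>, and at a jump of a non-decreasing entropy \<open>w\<close> is
  multiplied by a constant factor at least 1.  Write \<open>s\<^sub>L = u\<^sub>0(-\<infinity>) + m(-\<infinity>) z\<^sub>0(-\<infinity>)\<close> and
  \<open>r\<^sub>R = u\<^sub>0(\<infinity>) - m(\<infinity>) z\<^sub>0(\<infinity>)\<close>; these are the values of \<open>s\<close> on the leftmost and of \<open>r\<close> on the
  rightmost strip at all times, and the claim is that a vacuum occurs iff \<open>s\<^sub>L \<le> r\<^sub>R\<close>.

  If \<open>s\<^sub>L \<le> r\<^sub>R\<close>, follow a backward characteristic from the far right: crossing a jump leftwards increases
  \<open>r\<close>, so if no characteristic is trapped in a strip, the bound \<open>r \<ge> r\<^sub>R\<close> reaches the leftmost strip, where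
  \<open>r < s = s\<^sub>L \<le> r\<^sub>R\<close>, a contradiction.

  Conversely, the absence of shocks propagates the absence of compression strip by strip from left to right.
  If \<open>s\<close> increases in \<open>x\<close> on a strip while \<open>r\<close> drops from \<open>\<rho>\<close> to \<open>\<rho>' < \<rho>\<close> between two points, then values
  of \<open>r\<close> at least \<open>\<rho>\<close> stay ahead of the backward characteristic carrying \<open>\<rho>'\<close>, which therefore sees \<open>s > \<rho>\<close>,
  moves with speed bounded below and collides with them.  Hence \<open>u\<close> increases in \<open>x\<close> and the pressure decreases
  in \<open>t\<close>.  As \<open>u\<close> is bounded, conservation of momentum forces the limit of the pressure as \<open>t \<rightarrow> \<infinity>\<close> to be the
  same at every \<open>x\<close>.  A vacuum makes this limit zero, and then
  \<open>s\<^sub>L - w(x\<^sub>0, t) = u(x\<^sub>0, t) \<le> u(x\<^sub>N, t) = r\<^sub>R + w(x\<^sub>N, t)\<close> yields \<open>s\<^sub>L \<le> r\<^sub>R\<close>.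
\<close>

section \<open>Compactness and scalar differential equations\<close>

text \<open>With \<open>\<theta> = \<plusminus>t\<close> and \<open>q'\<close> a nearby point on the characteristic through \<open>q\<close>, this replaces tracing
  characteristics back to the boundary of \<open>D\<close>.\<close>

lemma compact_min_principle:
  fixes f \<theta> :: "'a::topological_space \<Rightarrow> real"
  assumes D: "compact D" and cf: "continuous_on D f" and ct: "continuous_on D \<theta>"
    and step: "\<And>q \<epsilon>. q \<in> D \<Longrightarrow> f q < m \<Longrightarrow> \<epsilon> > 0 \<Longrightarrow> \<exists>q'\<in>D. f q' - f q < \<epsilon> * (\<theta> q' - \<theta> q)"
    and q: "q \<in> D"
  shows "m \<le> f q"
proof (rule ccontr)
  assume neg: "\<not> m \<le> f q"
  have "bounded (\<theta> ` D)"
    using compact_continuous_image[OF ct D] by (rule compact_imp_bounded)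
  then obtain B where B: "B > 0" "\<And>x. x \<in> D \<Longrightarrow> \<bar>\<theta> x\<bar> \<le> B"
    by (auto simp: bounded_pos)
  \<comment> \<open>\<open>\<theta>\<close> varies by at most \<open>2 B\<close> on
    \<open>D\<close>, so the penalty \<open>\<epsilon> \<theta>\<close> shifts \<open>f\<close> by
    at most half of \<open>m - f q\<close>. The minimiser of \<open>f - \<epsilon> \<theta>\<close>
    thus still has \<open>f < m\<close>, and \<open>step\<close> contradicts its minimality.\<close>
  define \<epsilon> where "\<epsilon> = (m - f q) / (4 * B)"
  have \<epsilon>: "\<epsilon> > 0" using neg B by (simp add: \<epsilon>_def)
  have "continuous_on D (\<lambda>x. f x - \<epsilon> * \<theta> x)"
    by (intro continuous_intros cf ct)
  from continuous_attains_inf[OF D _ this] q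
  obtain q1 where q1: "q1 \<in> D" "\<And>y. y \<in> D \<Longrightarrow> f q1 - \<epsilon> * \<theta> q1 \<le> f y - \<epsilon> * \<theta> y"
    by blast
  have "\<epsilon> * (\<theta> q1 - \<theta> q) \<le> \<epsilon> * (2 * B)"
    using B(2)[OF q1(1)] B(2)[OF q] \<epsilon> by (intro mult_left_mono) auto
  also have "\<dots> = (m - f q) / 2" using B by (simp add: \<epsilon>_def)
  finally have "f q1 < m" using q1(2)[OF q] neg by (simp add: algebra_simps)
  from step[OF q1(1) this \<epsilon>] obtain q' where "q' \<in> D" "f q' - f q1 < \<epsilon> * (\<theta> q' - \<theta> q1)" by blast
  then show False using q1(2)[of q'] by (simp add: algebra_simps)
qed

text \<open>A mean value inequality for derivatives taken within the closed interval, since the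
  solutions are differentiable only up to \<open>t = 0\<close>; \<open>f\<close> is compared with
  the line of slope \<open>m\<close>.\<close>

lemma real_derivative_within_lower_bound:
  fixes f :: "real \<Rightarrow> real"
  assumes ab: "a \<le> b"
    and f: "\<And>t. t \<in> {a..b} \<Longrightarrow> (f has_real_derivative f' t) (at t within {a..b})"
    and m: "\<And>t. a < t \<Longrightarrow> t < b \<Longrightarrow> m \<le> f' t"
  shows "m * (b - a) \<le> f b - f a"
proof -
  have "f a - m * a \<le> f b - m * b"
  proof (rule DERIV_nonneg_imp_increasing_open[OF ab])
    fix x assume x: "a < x" "x < b"
    have "((\<lambda>t. f t - m * t) has_real_derivative f' x - m) (at x within {a..b})"
      using x by (auto intro!: derivative_eq_intros f)
    then show "\<exists>y. ((\<lambda>t. f t - m * t) has_real_derivative y) (at x) \<and> 0 \<le> y"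
      using m[OF x] x by (auto simp: at_within_interior[of x "{a..b}"])
  next
    show "continuous_on {a..b} (\<lambda>t. f t - m * t)"
      by (intro continuous_intros DERIV_continuous_on[OF f])
  qed
  then show ?thesis by (simp add: algebra_simps)
qed

text \<open>Gronwall's argument: the Lipschitz bound lets \<open>(Y - Z)\<^sup>2\<close> grow at
  rate at most \<open>2 L\<close>, which the weight \<open>exp (- 2 L t)\<close> absorbs; so
  \<open>E\<close> is nonincreasing and starts at 0.\<close>

lemma scalar_ode_unique:
  fixes Y Z :: "real \<Rightarrow> real"
  assumes Y: "\<And>t. t \<in> {a..b} \<Longrightarrow> (Y has_real_derivative F (Y t) t) (at t within {a..b})"
    and Z: "\<And>t. t \<in> {a..b} \<Longrightarrow> (Z has_real_derivative F (Z t) t) (at t within {a..b})"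
    and L: "\<And>x y t. t \<in> {a..b} \<Longrightarrow> \<bar>F x t - F y t\<bar> \<le> L * \<bar>x - y\<bar>"
    and init: "Y a = Z a" and t: "t \<in> {a..b}"
  shows "Y t = Z t"
proof -
  define E where "E = (\<lambda>t. exp (- 2 * L * t) * (Y t - Z t)\<^sup>2)"
  define E' where "E' = (\<lambda>t. exp (- 2 * L * t) * (2 * (Y t - Z t) * (F (Y t) t - F (Z t) t) - 2 * L * (Y t - Z t)\<^sup>2))"
  have dE: "(E has_real_derivative E' x) (at x within {a..b})" if "x \<in> {a..b}" for x
    unfolding E_def E'_def
    by (rule derivative_eq_intros Y Z that refl | simp add: algebra_simps)+
  have neg: "E' x \<le> 0" if "x \<in> {a..b}" for x
  proof -
    have "(Y x - Z x) * (F (Y x) x - F (Z x) x) \<le> \<bar>Y x - Z x\<bar> * \<bar>F (Y x) x - F (Z x) x\<bar>"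
      by (metis abs_ge_self abs_mult)
    also have "\<dots> \<le> \<bar>Y x - Z x\<bar> * (L * \<bar>Y x - Z x\<bar>)"
      by (intro mult_left_mono L that) auto
    also have "\<dots> = L * (Y x - Z x)\<^sup>2" by (simp add: power2_eq_square)
    finally have "2 * (Y x - Z x) * (F (Y x) x - F (Z x) x) - 2 * L * (Y x - Z x)\<^sup>2 \<le> 0" by linarith
    then show ?thesis unfolding E'_def by (intro mult_nonneg_nonpos) auto
  qed
  have "a \<le> t" "t \<le> b" using t by auto
  have "0 * (t - a) \<le> - E t - (- E a)"
    using neg \<open>t \<le> b\<close>
    by (intro real_derivative_within_lower_bound[where f = "\<lambda>t. - E t" and f' = "\<lambda>t. - E' t"]
          \<open>a \<le> t\<close> DERIV_minus DERIV_subset[OF dE]) auto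
  then have "E t \<le> E a" by simp
  then have "E t \<le> 0" using init by (simp add: E_def)
  then have "(Y t - Z t)\<^sup>2 \<le> 0" unfolding E_def
    by (simp add: mult_le_0_iff)
  then show ?thesis by simp
qed

lemma scalar_ode_exists_interval:
  fixes F :: "real \<Rightarrow> real \<Rightarrow> real"
  assumes ab: "a \<le> b" and L: "L > 0"
    and cont: "continuous_on (UNIV \<times> {a..b}) (\<lambda>(x, t). F x t)"
    and lip: "\<And>x y t. t \<in> {a..b} \<Longrightarrow> \<bar>F x t - F y t\<bar> \<le> L * \<bar>x - y\<bar>"
  shows "\<exists>Y. Y a = y\<^sub>0 \<and> (\<forall>t\<in>{a..b}. (Y has_real_derivative F (Y t) t) (at t within {a..b}))"
proof -
  \<comment> \<open>The Banach space in use consists of bounded continuous functions on the whole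
    line, so functions on \<open>[a, b]\<close> are extended by freezing their end values.\<close>
  define cl where "cl = (\<lambda>t. max a (min b t))"
  have cl: "cl t \<in> {a..b}" for t using ab by (auto simp: cl_def)
  have cl_id: "t \<in> {a..b} \<Longrightarrow> cl t = t" for t by (auto simp: cl_def)
  \<comment> \<open>The unknown is \<open>h t = exp (- 2 L t) * Y t\<close>; the weight makes the Picard map a contraction on all of \<open>[a, b]\<close>.\<close>
  define G where "G = (\<lambda>(h::real \<Rightarrow>\<^sub>C real) \<sigma>. F (exp (2 * L * \<sigma>) * apply_bcontfun h \<sigma>) \<sigma>)"
  have contG: "continuous_on {a..b} (G h)" for h
    unfolding G_def
    by (rule continuous_on_compose2[OF cont, where f = "\<lambda>\<sigma>. (exp (2 * L * \<sigma>) * apply_bcontfun h \<sigma>, \<sigma>)", simplified])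
       (auto intro!: continuous_intros)
  define \<Psi> where "\<Psi> = (\<lambda>h t. exp (- 2 * L * t) * (y\<^sub>0 + integral {a..t} (G h)))"
  have cont\<Psi>: "continuous_on {a..b} (\<Psi> h)" for h
    unfolding \<Psi>_def
    by (intro continuous_intros indefinite_integral_continuous_1 integrable_continuous_real contG)
  have bc: "(\<lambda>t. \<Psi> h (cl t)) \<in> bcontfun" for h
  proof -
    have "continuous_on UNIV cl" unfolding cl_def by (intro continuous_intros)
    then have 1: "continuous_on UNIV (\<lambda>t. \<Psi> h (cl t))"
      by (rule continuous_on_compose2[OF cont\<Psi>]) (use cl in auto)
    have "bounded (\<Psi> h ` {a..b})"
      using compact_continuous_image[OF cont\<Psi>] by (simp add: compact_imp_bounded)
    then have "bounded (range (\<lambda>t. \<Psi> h (cl t)))"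
      by (rule bounded_subset) (use cl in auto)
    with 1 show ?thesis by (simp add: bcontfun_def)
  qed
  define T where "T = (\<lambda>h. Bcontfun (\<lambda>t. \<Psi> h (cl t)))"
  have T: "apply_bcontfun (T h) t = \<Psi> h (cl t)" for h t
    unfolding T_def using bc by (simp add: Bcontfun_inverse)
  have contr: "dist (T g) (T h) \<le> 1/2 * dist g h" for g h
  proof (rule dist_bound)
    fix t
    define x where "x = cl t"
    have x: "x \<in> {a..b}" using cl by (simp add: x_def)
    define D where "D = dist g h"
    have intG: "G h integrable_on {a..x}" for h
      by (rule integrable_continuous_real, rule continuous_on_subset[OF contG]) (use x in auto)
    \<comment> \<open>The Picard integrands differ by at most \<open>L exp (2 L \<sigma>) D\<close>,
      whose integral is at most \<open>exp (2 L x) D / 2\<close>; the weight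
      \<open>exp (- 2 L x)\<close> leaves the contraction factor 1/2.\<close>
    have hi: "((\<lambda>\<sigma>. L * exp (2 * L * \<sigma>) * D) has_integral (exp (2 * L * x) * D / 2 - exp (2 * L * a) * D / 2)) {a..x}"
      by (rule fundamental_theorem_of_calculus)
         (use x in \<open>auto intro!: derivative_eq_intros simp flip: has_real_derivative_iff_has_vector_derivative\<close>)
    have "norm (integral {a..x} (\<lambda>\<sigma>. G g \<sigma> - G h \<sigma>)) \<le> integral {a..x} (\<lambda>\<sigma>. L * exp (2 * L * \<sigma>) * D)"
    proof (rule integral_norm_bound_integral)
      show "(\<lambda>\<sigma>. G g \<sigma> - G h \<sigma>) integrable_on {a..x}" by (intro integrable_diff intG)
      show "(\<lambda>\<sigma>. L * exp (2 * L * \<sigma>) * D) integrable_on {a..x}" using hi by blast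
      fix \<sigma> assume "\<sigma> \<in> {a..x}"
      then have "\<bar>G g \<sigma> - G h \<sigma>\<bar> \<le> L * \<bar>exp (2 * L * \<sigma>) * g \<sigma> - exp (2 * L * \<sigma>) * h \<sigma>\<bar>"
        unfolding G_def using x by (intro lip) auto
      also have "\<dots> = L * exp (2 * L * \<sigma>) * dist (g \<sigma>) (h \<sigma>)"
        by (simp add: dist_real_def abs_mult flip: right_diff_distrib)
      also have "\<dots> \<le> L * exp (2 * L * \<sigma>) * D"
        unfolding D_def using L by (intro mult_left_mono dist_bounded) auto
      finally show "norm (G g \<sigma> - G h \<sigma>) \<le> L * exp (2 * L * \<sigma>) * D" by simp
    qed
    also have "\<dots> = exp (2 * L * x) * D / 2 - exp (2 * L * a) * D / 2"
      using hi by (rule integral_unique)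
    also have "\<dots> \<le> exp (2 * L * x) * D / 2" by (simp add: D_def)
    finally have *: "\<bar>integral {a..x} (G g) - integral {a..x} (G h)\<bar> \<le> exp (2 * L * x) * D / 2"
      using intG by (simp add: integral_diff)
    have "dist (T g t) (T h t) = exp (- 2 * L * x) * \<bar>integral {a..x} (G g) - integral {a..x} (G h)\<bar>"
      by (simp add: T \<Psi>_def dist_real_def abs_mult x_def flip: right_diff_distrib)
    also have "\<dots> \<le> exp (- 2 * L * x) * (exp (2 * L * x) * D / 2)"
      using * by (intro mult_left_mono) auto
    also have "\<dots> = 1/2 * dist g h" by (simp add: D_def exp_minus)
    finally show "dist (T g t) (T h t) \<le> 1/2 * dist g h" .
  qed
  obtain h where h: "T h = h"
    using banach_fix_type[of "1/2" T] contr by auto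
  define Y where "Y = (\<lambda>t. exp (2 * L * t) * apply_bcontfun h t)"
  have Y: "Y t = y\<^sub>0 + integral {a..t} (G h)" if "t \<in> {a..b}" for t
  proof -
    have "apply_bcontfun h t = \<Psi> h t" using T[of h t] h cl_id[OF that] by simp
    then show ?thesis by (simp add: Y_def \<Psi>_def exp_minus)
  qed
  have "(Y has_real_derivative F (Y t) t) (at t within {a..b})" if t: "t \<in> {a..b}" for t
  proof -
    have "((\<lambda>t. y\<^sub>0 + integral {a..t} (G h)) has_real_derivative 0 + G h t) (at t within {a..b})"
      by (intro DERIV_add DERIV_const integral_has_real_derivative contG t)
    then have "((\<lambda>t. y\<^sub>0 + integral {a..t} (G h)) has_real_derivative F (Y t) t) (at t within {a..b})"
      by (simp add: G_def Y_def)
    then show ?thesis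
      by (rule has_field_derivative_transform_within[OF _ zero_less_one]) (use t Y in auto)
  qed
  moreover have "Y a = y\<^sub>0" using Y[of a] ab by simp
  ultimately show ?thesis by blast
qed

text \<open>The Lipschitz constant may depend on the time horizon. Solutions on the intervals
  \<open>[a, b]\<close> agree on overlaps by uniqueness, and the diagonal \<open>Z t t\<close> glues
  them: near \<open>t\<close> it coincides with \<open>Z (t + 1)\<close>.\<close>

lemma scalar_ode_exists:
  fixes F :: "real \<Rightarrow> real \<Rightarrow> real"
  assumes cont: "continuous_on (UNIV \<times> {a..}) (\<lambda>(x, t). F x t)"
    and lip: "\<And>b. b \<ge> a \<Longrightarrow> \<exists>L>0. \<forall>t\<in>{a..b}. \<forall>x y. \<bar>F x t - F y t\<bar> \<le> L * \<bar>x - y\<bar>"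
  obtains Y where "Y a = y\<^sub>0" "\<And>t. t \<ge> a \<Longrightarrow> (Y has_real_derivative F (Y t) t) (at t within {a..})"
proof -
  have "\<exists>Y. Y a = y\<^sub>0 \<and> (\<forall>t\<in>{a..b}. (Y has_real_derivative F (Y t) t) (at t within {a..b}))" if ab: "a \<le> b" for b
  proof -
    obtain L where "L > 0" "\<forall>t\<in>{a..b}. \<forall>x y. \<bar>F x t - F y t\<bar> \<le> L * \<bar>x - y\<bar>"
      using lip[OF ab] by blast
    then show ?thesis
      by (intro scalar_ode_exists_interval[OF ab, of L] continuous_on_subset[OF cont]) auto
  qed
  then obtain Z where Z0: "\<And>b. a \<le> b \<Longrightarrow> Z b a = y\<^sub>0"
    and Z: "\<And>b t. a \<le> b \<Longrightarrow> t \<in> {a..b} \<Longrightarrow> (Z b has_real_derivative F (Z b t) t) (at t within {a..b})"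
    by metis
  have eq: "Z b t = Z b' t" if "a \<le> t" "t \<le> b" "b \<le> b'" for b b' t
  proof -
    from that have "a \<le> b" by simp
    then obtain L where L: "\<forall>t\<in>{a..b}. \<forall>x y. \<bar>F x t - F y t\<bar> \<le> L * \<bar>x - y\<bar>"
      using lip by blast
    show ?thesis
    proof (rule scalar_ode_unique[where Y = "Z b" and Z = "Z b'" and F = F and a = a and b = b and L = L])
      show "(Z b has_real_derivative F (Z b t) t) (at t within {a..b})" if "t \<in> {a..b}" for t
        using Z that by auto
      show "(Z b' has_real_derivative F (Z b' t) t) (at t within {a..b})" if "t \<in> {a..b}" for t
        using that \<open>b \<le> b'\<close> by (intro DERIV_subset[OF Z[of b' t]]) auto
    qed (use L that Z0 in auto)
  qed
  define Y where "Y = (\<lambda>t. Z t t)"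
  have "(Y has_real_derivative F (Y t) t) (at t within {a..})" if t: "t \<ge> a" for t
  proof -
    have "(Z (t + 1) has_real_derivative F (Z (t + 1) t) t) (at t within {a..t+1})"
      using Z t by auto
    then have "(Y has_real_derivative F (Z (t + 1) t) t) (at t within {a..t+1})"
      by (rule has_field_derivative_transform_within[OF _ zero_less_one]) (use t eq in \<open>auto simp: Y_def\<close>)
    moreover have "at t within {a..} = at t within {a..t+1}"
      by (rule at_within_nhd[of t "{..<t+1}"]) auto
    moreover have "Z (t + 1) t = Y t" using eq[of t t "t+1"] t by (simp add: Y_def)
    ultimately show ?thesis by simp
  qed
  moreover have "Y a = y\<^sub>0" using Z0 by (simp add: Y_def)
  ultimately show thesis using that by blast
qed

section \<open>Riemann invariants on a strip\<close>

text \<open>A direction annihilated by the gradient gives a change of order \<open>o(h)\<close>.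
  Membership of the end point in \<open>D\<close> stays a premise because the ray may leave a strip
  at its boundary. The extra 1 in \<open>n\<close> makes the norm estimate strict.\<close>

lemma derivative_along_ray:
  fixes f :: "real \<times> real \<Rightarrow> real"
  assumes f: "(f has_derivative (\<lambda>h. fx * fst h + ft * snd h)) (at (x, t) within D)"
    and zero: "fx * a + ft * b = 0" and \<epsilon>: "\<epsilon> > 0"
  shows "\<forall>\<^sub>F h in at_right 0. (x + h * a, t + h * b) \<in> D \<longrightarrow> \<bar>f (x + h * a, t + h * b) - f (x, t)\<bar> < \<epsilon> * h"
proof -
  define n where "n = \<bar>a\<bar> + \<bar>b\<bar> + 1"
  have n: "n > 0" by (simp add: n_def)
  with \<epsilon> have "\<epsilon> / n > 0" by simp
  with f obtain \<delta> where \<delta>: "\<delta> > 0" and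
    *: "\<And>y. y \<in> D \<Longrightarrow> norm (y - (x, t)) < \<delta> \<Longrightarrow>
        norm (f y - f (x, t) - (fx * fst (y - (x, t)) + ft * snd (y - (x, t)))) \<le> \<epsilon> / n * norm (y - (x, t))"
    unfolding has_derivative_within_alt by blast
  have "\<bar>f (x + h * a, t + h * b) - f (x, t)\<bar> < \<epsilon> * h"
    if h: "0 < h" "h < \<delta> / n" and D: "(x + h * a, t + h * b) \<in> D" for h
  proof -
    have "norm (h * a, h * b) \<le> \<bar>h * a\<bar> + \<bar>h * b\<bar>"
      using norm_Pair_le[of "h * a" "h * b"] by simp
    also have "\<dots> = h * (n - 1)" using h by (simp add: abs_mult n_def algebra_simps)
    also have "\<dots> < h * n" using h by simp
    finally have nb: "norm (h * a, h * b) < h * n" .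
    also have "h * n < \<delta>" using h n by (simp add: field_simps)
    finally have "\<bar>f (x + h * a, t + h * b) - f (x, t) - (fx * (h * a) + ft * (h * b))\<bar> \<le> \<epsilon> / n * norm (h * a, h * b)"
      using *[OF D] by simp
    also have "fx * (h * a) + ft * (h * b) = h * (fx * a + ft * b)" by (simp add: algebra_simps)
    also have "\<epsilon> / n * norm (h * a, h * b) < \<epsilon> / n * (h * n)"
      using nb \<epsilon> n by (intro mult_strict_left_mono) auto
    also have "\<dots> = \<epsilon> * h" using n by simp
    finally show ?thesis using zero by simp
  qed
  then show ?thesis
    unfolding eventually_at_right_field using \<delta> n
    by (intro exI[of _ "\<delta> / n"]) auto
qed

lemma derivative_along_curve:
  fixes f :: "real \<times> real \<Rightarrow> real"
  assumes f: "(f has_derivative (\<lambda>h. fx * fst h + ft * snd h)) (at (X t, \<Theta> t) within D)"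
    and X: "(X has_real_derivative X') (at t within I)"
    and \<Theta>: "(\<Theta> has_real_derivative \<Theta>') (at t within I)"
    and D: "\<And>\<tau>. \<tau> \<in> I \<Longrightarrow> (X \<tau>, \<Theta> \<tau>) \<in> D"
  shows "((\<lambda>\<tau>. f (X \<tau>, \<Theta> \<tau>)) has_real_derivative (fx * X' + ft * \<Theta>')) (at t within I)"
proof -
  have "((\<lambda>\<tau>. (X \<tau>, \<Theta> \<tau>)) has_derivative (\<lambda>h. (X' * h, \<Theta>' * h))) (at t within I)"
    using X \<Theta> unfolding has_field_derivative_def by (rule has_derivative_Pair)
  then have "((\<lambda>\<tau>. f (X \<tau>, \<Theta> \<tau>)) has_derivative (\<lambda>h. fx * fst (X' * h, \<Theta>' * h) + ft * snd (X' * h, \<Theta>' * h))) (at t within I)"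
    by (rule has_derivative_in_compose) (rule has_derivative_subset[OF f], use D in auto)
  moreover have "(\<lambda>h. fx * fst (X' * h, \<Theta>' * h) + ft * snd (X' * h, \<Theta>' * h)) = (*) (fx * X' + ft * \<Theta>')"
    by (auto simp: algebra_simps)
  ultimately show ?thesis unfolding has_field_derivative_def by simp
qed

lemma eventually_right_obtain:
  assumes "\<forall>\<^sub>F h in at_right (0::real). P h"
  obtains h where "0 < h" "P h"
proof -
  have "\<forall>\<^sub>F h in at_right (0::real). 0 < h \<and> P h"
    using assms by (intro eventually_conj eventually_at_right_less)
  then show thesis using that eventually_happens' trivial_limit_at_right_real by blast
qed

lemma eventually_right_less_add:
  fixes u v a :: real
  assumes "u < v"
  shows "\<forall>\<^sub>F h in at_right 0. u < v + h * a"
proof (rule order_tendstoD(1))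
  show "((\<lambda>h. v + h * a) \<longlongrightarrow> v + 0 * a) (at_right 0)" by (intro tendsto_intros)
qed (use assms in simp)

lemma eventually_right_add_less:
  fixes u v a :: real
  assumes "v < u"
  shows "\<forall>\<^sub>F h in at_right 0. v + h * a < u"
  using eventually_right_less_add[of "-u" "-v" "-a"] assms by (auto elim: eventually_mono)

text \<open>The isentropic system in diagonal form: \<open>s\<close> moves to the right and
  \<open>r\<close> to the left, both with speed \<open>k (s - r)^d\<close>. The condition
  \<open>r < s\<close> excludes vacuum at finite times and keeps the speed positive.
  \<open>J\<close> may be a half line or a compact interval.\<close>

locale riemann_strip =
  fixes J :: "real set" and k d :: real and s r sx st rx rt :: "real \<times> real \<Rightarrow> real"
  assumes k_pos: "0 < k" and d_pos: "0 < d"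
    and s_deriv: "\<And>q. q \<in> J \<times> {0..} \<Longrightarrow>
      (s has_derivative (\<lambda>h. sx q * fst h + st q * snd h)) (at q within J \<times> {0..})"
    and r_deriv: "\<And>q. q \<in> J \<times> {0..} \<Longrightarrow>
      (r has_derivative (\<lambda>h. rx q * fst h + rt q * snd h)) (at q within J \<times> {0..})"
    and cont_sx: "continuous_on (J \<times> {0..}) sx" and cont_rx: "continuous_on (J \<times> {0..}) rx"
    and r_less_s: "\<And>q. q \<in> J \<times> {0..} \<Longrightarrow> r q < s q"
    and s_eq: "\<And>q. q \<in> J \<times> {0..} \<Longrightarrow> st q = - (k * (s q - r q) powr d) * sx q"
    and r_eq: "\<And>q. q \<in> J \<times> {0..} \<Longrightarrow> rt q = (k * (s q - r q) powr d) * rx q"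
begin

section \<open>Steps along characteristics, finite speed of propagation, and monotonicity of
  \<open>s\<close>\<close>

definition c :: "real \<times> real \<Rightarrow> real" where "c q = k * (s q - r q) powr d"

lemma c_pos: "q \<in> J \<times> {0..} \<Longrightarrow> 0 < c q"
  using k_pos r_less_s[of q] by (simp add: c_def)

lemma cont_s: "continuous_on (J \<times> {0..}) s"
  using s_deriv by (rule has_derivative_continuous_on)

lemma cont_r: "continuous_on (J \<times> {0..}) r"
  using r_deriv by (rule has_derivative_continuous_on)

lemma cont_c: "continuous_on (J \<times> {0..}) c"
  unfolding c_def using r_less_s by (intro continuous_intros cont_s cont_r) force+

lemma s_along:
  assumes "(x, t) \<in> J \<times> {0..}" "0 < \<epsilon>"
  shows "\<forall>\<^sub>F h in at_right 0. (x - h * c (x, t), t - h) \<in> J \<times> {0..} \<longrightarrow>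
           \<bar>s (x - h * c (x, t), t - h) - s (x, t)\<bar> < \<epsilon> * h"
  using derivative_along_ray[OF s_deriv[OF assms(1)] _ assms(2), of "- c (x, t)" "-1"] s_eq[OF assms(1)]
  by (simp add: c_def algebra_simps)

text \<open>\<open>\<sigma> = 1\<close> steps into the past and \<open>\<sigma> = -1\<close> into
  the future along the tangent of the backward characteristic; both directions of time are needed
  later.\<close>

lemma r_along:
  assumes "(x, t) \<in> J \<times> {0..}" "0 < \<epsilon>" "\<sigma> \<in> {-1, 1}"
  shows "\<forall>\<^sub>F h in at_right 0. (x + h * (\<sigma> * c (x, t)), t - h * \<sigma>) \<in> J \<times> {0..} \<longrightarrow>
           \<bar>r (x + h * (\<sigma> * c (x, t)), t - h * \<sigma>) - r (x, t)\<bar> < \<epsilon> * h"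
  using derivative_along_ray[OF r_deriv[OF assms(1)] _ assms(2), of "\<sigma> * c (x, t)" "- \<sigma>"] r_eq[OF assms(1)]
  by (simp add: c_def algebra_simps)

text \<open>Nothing bounds the solution as \<open>\<bar>x\<bar> \<rightarrow> \<infinity>\<close>, so finite speed of propagation has to be proved: at the first
  time where the deviation reaches \<open>\<epsilon> (1 + t)\<close>, the speed is still below \<open>C\<close>, and following the characteristic
  backwards inside the cone produces an earlier such time.\<close>

lemma constant_in_cone:
  assumes t1: "0 \<le> t1" and less: "rL < sL" and C: "k * (sL - rL) powr d < C"
    and base: "\<And>x. \<bar>x - x1\<bar> \<le> C * t1 \<Longrightarrow> x \<in> J \<and> s (x, 0) = sL \<and> r (x, 0) = rL"
  shows "s (x1, t1) = sL \<and> r (x1, t1) = rL"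
proof -
  have C0: "0 < C" using C k_pos less by (smt (verit) powr_gt_zero zero_less_mult_iff)
  \<comment> \<open>The backward cone with apex \<open>(x1, t1)\<close> and slope \<open>C\<close>:
    steps into the past with speed at most \<open>C\<close> stay inside it.\<close>
  define \<Omega> where "\<Omega> = {q::real \<times> real. 0 \<le> snd q \<and> snd q \<le> t1 \<and> \<bar>fst q - x1\<bar> \<le> C * (t1 - snd q)}"
  have closed: "closed \<Omega>"
    unfolding \<Omega>_def by (intro closed_Collect_conj closed_Collect_le continuous_intros)
  have bnd: "\<bar>fst q - x1\<bar> \<le> C * t1" if "q \<in> \<Omega>" for q
  proof -
    have "C * (t1 - snd q) \<le> C * t1" using that C0 by (intro mult_left_mono) (auto simp: \<Omega>_def)
    then show ?thesis using that by (auto simp: \<Omega>_def)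
  qed
  have "\<Omega> \<subseteq> {x1 - C * t1..x1 + C * t1} \<times> {0..t1}"
  proof
    fix q assume "q \<in> \<Omega>"
    then show "q \<in> {x1 - C * t1..x1 + C * t1} \<times> {0..t1}"
      using bnd[of q] by (cases q) (auto simp: \<Omega>_def abs_le_iff)
  qed
  then have compact: "compact \<Omega>"
    using closed compact_Times[OF compact_Icc compact_Icc] by (meson bounded_subset compact_eq_bounded_closed)
  have \<Omega>D: "\<Omega> \<subseteq> J \<times> {0..}"
  proof
    fix q assume q: "q \<in> \<Omega>"
    then show "q \<in> J \<times> {0..}" using base[OF bnd[OF q]] by (cases q) (auto simp: \<Omega>_def)
  qed
  define dev where "dev = (\<lambda>q. max \<bar>s q - sL\<bar> \<bar>r q - rL\<bar>)"
  have cont_dev: "continuous_on \<Omega> dev"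
    unfolding dev_def
    by (intro continuous_intros continuous_on_subset[OF cont_s \<Omega>D] continuous_on_subset[OF cont_r \<Omega>D])
  have "((\<lambda>w. k * w powr d) \<longlongrightarrow> k * (sL - rL) powr d) (nhds (sL - rL))"
    using less by (intro tendsto_intros filterlim_ident) auto
  from order_tendstoD(2)[OF this C]
  obtain \<delta> where \<delta>: "\<delta> > 0" "\<And>w. dist w (sL - rL) < \<delta> \<Longrightarrow> k * w powr d < C"
    by (auto simp: eventually_nhds_metric)
  \<comment> \<open>A deviation of at most \<open>\<epsilon> (1 + t)\<close> is then at most
    \<open>\<delta> / 4\<close> in \<open>s\<close> and in \<open>r\<close>, hence at most
    \<open>\<delta> / 2\<close> in \<open>s - r\<close>, so that the speed is below
    \<open>C\<close>.\<close>
  define \<epsilon>0 where "\<epsilon>0 = \<delta> / (4 * (1 + t1))"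
  have \<epsilon>0: "\<epsilon>0 > 0" "\<epsilon>0 * (1 + t1) = \<delta> / 4" using \<delta> t1 by (auto simp: \<epsilon>0_def field_simps add_pos_nonneg)
  have key: "dev q < \<epsilon> * (1 + snd q)" if \<epsilon>: "0 < \<epsilon>" "\<epsilon> \<le> \<epsilon>0" and q: "q \<in> \<Omega>" for \<epsilon> q
  proof (rule ccontr)
    assume bad: "\<not> dev q < \<epsilon> * (1 + snd q)"
    define B where "B = {q \<in> \<Omega>. \<epsilon> * (1 + snd q) \<le> dev q}"
    have "closed B" unfolding B_def
      by (intro continuous_on_closed_Collect_le continuous_intros cont_dev closed)
    then have "compact B" using compact by (metis (no_types, lifting) B_def compact_Int_closed Int_absorb1 mem_Collect_eq subsetI)
    moreover have "q \<in> B" using bad q by (simp add: B_def)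
    then have "B \<noteq> {}" by blast
    ultimately obtain q1 where q1: "q1 \<in> B" "\<And>y. y \<in> B \<Longrightarrow> snd q1 \<le> snd y"
      using continuous_attains_inf[of B snd] continuous_on_snd[OF continuous_on_id] by metis
    obtain x t where q1_eq: "q1 = (x, t)" by force
    have xt: "(x, t) \<in> \<Omega>" "\<epsilon> * (1 + t) \<le> dev (x, t)" using q1 by (auto simp: B_def q1_eq)
    then have xtD: "(x, t) \<in> J \<times> {0..}" using \<Omega>D by blast
    have t: "0 \<le> t" "t \<le> t1" using xt by (auto simp: \<Omega>_def)
    have "t \<noteq> 0"
    proof
      assume "t = 0"
      then have "dev (x, t) = 0" using base[of x] xt by (auto simp: dev_def \<Omega>_def)
      then show False using xt(2) \<epsilon> t by (simp add: \<open>t = 0\<close>)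
    qed
    with t have tpos: "0 < t" by simp
    have cone: "(x + h * a, t - h) \<in> \<Omega>" if "0 < h" "h \<le> t" "\<bar>a\<bar> \<le> C" for h a
    proof -
      have "\<bar>x + h * a - x1\<bar> \<le> \<bar>x - x1\<bar> + h * \<bar>a\<bar>"
        using abs_triangle_ineq[of "x - x1" "h * a"] that by (simp add: abs_mult algebra_simps)
      also have "\<dots> \<le> C * (t1 - t) + h * C"
        using xt that by (intro add_mono mult_left_mono) (auto simp: \<Omega>_def)
      finally show ?thesis using that t by (auto simp: \<Omega>_def algebra_simps)
    qed
    have min: "dev (x + h * a, t - h) < \<epsilon> * (1 + (t - h))" if "0 < h" "h \<le> t" "\<bar>a\<bar> \<le> C" for h a
    proof (rule ccontr)
      assume "\<not> ?thesis"
      then have "(x + h * a, t - h) \<in> B" using cone[OF that] by (auto simp: B_def)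
      then show False using q1(2) that(1) by (force simp: q1_eq)
    qed
    have ev_t: "\<forall>\<^sub>F h in at_right 0. h \<le> t"
      unfolding eventually_at_right_field using tpos by (intro exI[of _ t]) auto
    \<comment> \<open>No earlier point is bad, so continuity along the vertical line from below
      forces equality with the threshold at the first bad point.\<close>
    have le: "dev (x, t) \<le> \<epsilon> * (1 + t)"
    proof (rule tendsto_le[OF trivial_limit_at_right_real])
      show "((\<lambda>h. \<epsilon> * (1 + (t - h))) \<longlongrightarrow> \<epsilon> * (1 + t)) (at_right 0)"
        by (auto intro!: tendsto_eq_intros)
      show "((\<lambda>h. dev (x + h * 0, t - h)) \<longlongrightarrow> dev (x, t)) (at_right 0)"
      proof (rule continuous_on_tendsto_compose[OF cont_dev])
        show "((\<lambda>h. (x + h * 0, t - h)) \<longlongrightarrow> (x, t)) (at_right 0)"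
          by (auto intro!: tendsto_eq_intros)
        show "\<forall>\<^sub>F h in at_right 0. (x + h * 0, t - h) \<in> \<Omega>"
          using ev_t eventually_at_right_less[of 0] by eventually_elim (rule cone, use C0 in auto)
      qed (rule xt)
      show "\<forall>\<^sub>F h in at_right 0. dev (x + h * 0, t - h) \<le> \<epsilon> * (1 + (t - h))"
        using ev_t eventually_at_right_less[of 0]
        by eventually_elim (rule less_imp_le[OF min], use C0 in auto)
    qed
    have "\<epsilon> * (1 + t) \<le> \<epsilon>0 * (1 + t1)" using \<epsilon> t \<epsilon>0 by (intro mult_mono) auto
    then have "dev (x, t) \<le> \<delta> / 4" using le \<epsilon>0 by simp
    then have "\<bar>s (x, t) - sL\<bar> \<le> \<delta> / 4" "\<bar>r (x, t) - rL\<bar> \<le> \<delta> / 4" unfolding dev_def by linarith+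
    then have "dist (s (x, t) - r (x, t)) (sL - rL) \<le> \<delta> / 2" unfolding dist_real_def by linarith
    then have "c (x, t) < C" unfolding c_def using \<delta> by auto
    with c_pos[OF xtD] have cC: "\<bar>c (x, t)\<bar> \<le> C" "\<bar>- c (x, t)\<bar> \<le> C" by auto
    have "dev (x, t) = \<epsilon> * (1 + t)" using le xt by simp
    \<comment> \<open>One of the invariants attains the threshold. Following it into the past for a
      time \<open>h\<close> changes it by less than \<open>\<epsilon> h\<close>, while the threshold
      drops by exactly \<open>\<epsilon> h\<close>; this is an earlier bad point.\<close>
    then consider "\<bar>s (x, t) - sL\<bar> = \<epsilon> * (1 + t)" | "\<bar>r (x, t) - rL\<bar> = \<epsilon> * (1 + t)"
      by (auto simp: dev_def max_def split: if_splits)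
    then show False
    proof cases
      case 1
      obtain h where h: "0 < h" "h \<le> t"
        "(x - h * c (x, t), t - h) \<in> J \<times> {0..} \<longrightarrow> \<bar>s (x - h * c (x, t), t - h) - s (x, t)\<bar> < \<epsilon> * h"
        using eventually_right_obtain[OF eventually_conj[OF ev_t s_along[OF xtD \<epsilon>(1)]]] by metis
      have "(x - h * c (x, t), t - h) \<in> J \<times> {0..}" using cone[OF h(1,2) cC(2)] \<Omega>D by auto
      then have "\<bar>s (x - h * c (x, t), t - h) - sL\<bar> > \<epsilon> * (1 + t) - \<epsilon> * h" using h 1 by linarith
      moreover have "dev (x - h * c (x, t), t - h) < \<epsilon> * (1 + (t - h))" using min[OF h(1,2) cC(2)] by simp
      ultimately show False by (simp add: dev_def algebra_simps)
    next
      case 2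
      have ev_r: "\<forall>\<^sub>F h in at_right 0. (x + h * c (x, t), t - h) \<in> J \<times> {0..} \<longrightarrow>
          \<bar>r (x + h * c (x, t), t - h) - r (x, t)\<bar> < \<epsilon> * h"
        using r_along[OF xtD \<epsilon>(1), of 1] by simp
      obtain h where h: "0 < h" "h \<le> t"
        "(x + h * c (x, t), t - h) \<in> J \<times> {0..} \<longrightarrow> \<bar>r (x + h * c (x, t), t - h) - r (x, t)\<bar> < \<epsilon> * h"
        using eventually_right_obtain[OF eventually_conj[OF ev_t ev_r]] by metis
      have "(x + h * c (x, t), t - h) \<in> J \<times> {0..}" using cone[OF h(1,2) cC(1)] \<Omega>D by auto
      then have "\<bar>r (x + h * c (x, t), t - h) - rL\<bar> > \<epsilon> * (1 + t) - \<epsilon> * h" using h 2 by linarith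
      moreover have "dev (x + h * c (x, t), t - h) < \<epsilon> * (1 + (t - h))" using min[OF h(1,2) cC(1)] by simp
      ultimately show False by (simp add: dev_def algebra_simps)
    qed
  qed
  have top: "(x1, t1) \<in> \<Omega>" using t1 C0 by (simp add: \<Omega>_def)
  have "dev (x1, t1) \<le> 0"
  proof (rule ccontr)
    assume "\<not> ?thesis"
    then have pos: "0 < dev (x1, t1)" by simp
    define \<epsilon> where "\<epsilon> = min \<epsilon>0 (dev (x1, t1) / (1 + t1))"
    have "dev (x1, t1) < \<epsilon> * (1 + t1)"
      using key[of \<epsilon>, OF _ _ top] pos \<epsilon>0 t1 by (simp add: \<epsilon>_def)
    also have "\<dots> \<le> dev (x1, t1) / (1 + t1) * (1 + t1)"
      using t1 by (intro mult_right_mono) (auto simp: \<epsilon>_def)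
    finally show False using t1 by simp
  qed
  then show ?thesis by (auto simp: dev_def)
qed

text \<open>At a point \<open>a\<close> far enough to the left the cone argument keeps the state
  constant up to time \<open>t\<close>. On \<open>[a, b]\<close>, tracing \<open>s\<close> into the
  past along forward characteristics leads to the left side or to the bottom, where it equals
  \<open>sL\<close>.\<close>

lemma incoming_invariant_constant:
  assumes J: "J = {..b}" and less: "rL < sL"
    and base: "\<And>x. x \<le> b \<Longrightarrow> s (x, 0) = sL \<and> r (x, 0) = rL"
    and x: "x \<le> b" and t: "0 \<le> t"
  shows "s (x, t) = sL"
proof -
  define C where "C = k * (sL - rL) powr d + 1"
  have C0: "0 \<le> C" using k_pos by (simp add: C_def)
  \<comment> \<open>A cone of slope \<open>C\<close> with apex over \<open>a\<close> and height at
    most \<open>t\<close> has its base in \<open>{..b}\<close>, where the data are constant.\<close>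
  define a where "a = min x (b - C * t)"
  have far: "s (a, \<tau>) = sL" if \<tau>: "0 \<le> \<tau>" "\<tau> \<le> t" for \<tau>
  proof -
    have "C * \<tau> \<le> C * t" using C0 \<tau> by (intro mult_left_mono) auto
    then have "y \<le> b" if "\<bar>y - a\<bar> \<le> C * \<tau>" for y using that by (auto simp: a_def)
    then show ?thesis using constant_in_cone[of \<tau> rL sL C a] \<tau> less base J by (auto simp: C_def)
  qed
  define D where "D = {a..b} \<times> {0..t}"
  have DJ: "D \<subseteq> J \<times> {0..}" by (auto simp: D_def J)
  have main: "\<sigma> * sL \<le> \<sigma> * s (x, t)" if \<sigma>: "\<sigma> \<in> {-1, 1}" for \<sigma> :: real
  proof (rule compact_min_principle[where D = D and \<theta> = "\<lambda>q. - snd q" and f = "\<lambda>q. \<sigma> * s q"])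
    show "compact D" unfolding D_def by (intro compact_Times compact_Icc)
    show "continuous_on D (\<lambda>q. \<sigma> * s q)" by (intro continuous_intros continuous_on_subset[OF cont_s DJ])
    show "continuous_on D (\<lambda>q. - snd q)" by (intro continuous_intros)
    show "(x, t) \<in> D" using x t by (auto simp: D_def a_def)
    fix q \<epsilon> assume q: "q \<in> D" "\<sigma> * s q < \<sigma> * sL" and \<epsilon>: "0 < (\<epsilon>::real)"
    obtain y \<tau> where q_eq: "q = (y, \<tau>)" by force
    have yt: "a \<le> y" "y \<le> b" "0 \<le> \<tau>" "\<tau> \<le> t" "(y, \<tau>) \<in> J \<times> {0..}" using q by (auto simp: D_def J q_eq)
    have "\<tau> \<noteq> 0" "y \<noteq> a" using q(2) base[of y] far[of \<tau>] yt by (auto simp: q_eq)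
    then have "0 < \<tau>" "a < y" using yt by auto
    then obtain h where h: "0 < h" "0 < \<tau> + h * (-1)" "a < y + h * (- c (y, \<tau>))"
      "(y - h * c (y, \<tau>), \<tau> - h) \<in> J \<times> {0..} \<longrightarrow> \<bar>s (y - h * c (y, \<tau>), \<tau> - h) - s (y, \<tau>)\<bar> < \<epsilon> * h"
      using eventually_right_obtain[OF eventually_conj[OF eventually_right_less_add
            eventually_conj[OF eventually_right_less_add s_along[OF yt(5) \<epsilon>]]]] by metis
    have "0 < h * c (y, \<tau>)" using c_pos[OF yt(5)] h by simp
    then have D': "(y - h * c (y, \<tau>), \<tau> - h) \<in> D" using h yt by (auto simp: D_def)
    then have "\<bar>s (y - h * c (y, \<tau>), \<tau> - h) - s (y, \<tau>)\<bar> < \<epsilon> * h" using DJ h by blast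
    then have "\<sigma> * s (y - h * c (y, \<tau>), \<tau> - h) - \<sigma> * s (y, \<tau>) < \<epsilon> * h" using \<sigma> by auto
    then show "\<exists>q'\<in>D. \<sigma> * s q' - \<sigma> * s q < \<epsilon> * (- snd q' - - snd q)"
      using D' by (intro bexI[of _ "(y - h * c (y, \<tau>), \<tau> - h)"]) (auto simp: q_eq)
  qed
  show ?thesis using main[of 1] main[of "-1"] by simp
qed

text \<open>The minimum principle is applied to \<open>s (y, t) - s (x, t)\<close> as a function of \<open>(x, y, t)\<close>, which avoids
  second derivatives.\<close>

lemma s_mono:
  assumes J: "{a..b} \<subseteq> J"
    and init: "\<And>x y. a \<le> x \<Longrightarrow> x \<le> y \<Longrightarrow> y \<le> b \<Longrightarrow> s (x, 0) \<le> s (y, 0)"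
    and left: "\<And>t t'. 0 \<le> t \<Longrightarrow> t \<le> t' \<Longrightarrow> s (a, t') \<le> s (a, t)"
    and xy: "a \<le> x" "x \<le> y" "y \<le> b" and t: "0 \<le> t"
  shows "s (x, t) \<le> s (y, t)"
proof -
  define D where "D = {q::real \<times> real \<times> real. a \<le> fst q \<and> fst q \<le> fst (snd q) \<and> fst (snd q) \<le> b \<and> 0 \<le> snd (snd q) \<and> snd (snd q) \<le> t}"
  define f where "f = (\<lambda>q::real \<times> real \<times> real. s (snd q) - s (fst q, snd (snd q)))"
  have "closed D"
    unfolding D_def by (intro closed_Collect_conj closed_Collect_le continuous_intros)
  moreover have "D \<subseteq> {a..b} \<times> {a..b} \<times> {0..t}" by (auto simp: D_def)
  ultimately have "compact D"
    using compact_Times[OF compact_Icc compact_Times[OF compact_Icc compact_Icc]]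
    by (meson bounded_subset compact_eq_bounded_closed)
  have contf: "continuous_on D f"
    unfolding f_def
    by (intro continuous_intros continuous_on_compose2[OF cont_s]) (use J in \<open>auto simp: D_def\<close>)
  have "0 \<le> f (x, y, t)"
  proof (rule compact_min_principle[where D = D and \<theta> = "\<lambda>q. - snd (snd q)" and f = f])
    show "continuous_on D (\<lambda>q. - snd (snd q))" by (intro continuous_intros)
    show "(x, y, t) \<in> D" using xy t by (auto simp: D_def)
    fix q \<epsilon> assume q: "q \<in> D" "f q < 0" and \<epsilon>: "0 < (\<epsilon>::real)"
    obtain x y \<tau> where q_eq: "q = (x, y, \<tau>)" by (metis surj_pair)
    have le: "a \<le> x" "x \<le> y" "y \<le> b" "0 \<le> \<tau>" "\<tau> \<le> t" using q by (auto simp: D_def q_eq)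
    have xJ: "(x, \<tau>) \<in> J \<times> {0..}" and yJ: "(y, \<tau>) \<in> J \<times> {0..}" using le J by auto
    have f: "s (y, \<tau>) < s (x, \<tau>)" using q by (simp add: f_def q_eq)
    then have "x \<noteq> y" "\<tau> \<noteq> 0" using init[of x y] le by auto
    then have lt: "x < y" "0 < \<tau>" using le by auto
    have ev_lt: "\<forall>\<^sub>F h in at_right 0. x < y + h * (- c (y, \<tau>)) \<and> 0 < \<tau> + h * (-1)"
      using lt by (intro eventually_conj eventually_right_less_add)
    show "\<exists>q'\<in>D. f q' - f q < \<epsilon> * (- snd (snd q') - - snd (snd q))"
    proof (cases "x = a")
      \<comment> \<open>At the left end \<open>x\<close> cannot be traced further. Only
        \<open>y\<close> moves, and by \<open>left\<close> the value \<open>s (a, _)\<close> is no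
        smaller at the earlier time, so the subtracted term does no harm.\<close>
      case True
      obtain h where h: "0 < h" "x < y + h * (- c (y, \<tau>))" "0 < \<tau> + h * (-1)"
        "(y - h * c (y, \<tau>), \<tau> - h) \<in> J \<times> {0..} \<longrightarrow> \<bar>s (y - h * c (y, \<tau>), \<tau> - h) - s (y, \<tau>)\<bar> < \<epsilon> * h"
        using eventually_right_obtain[OF eventually_conj[OF ev_lt s_along[OF yJ \<epsilon>]]] by metis
      have "0 < h * c (y, \<tau>)" using c_pos[OF yJ] h by simp
      then have D': "(x, y - h * c (y, \<tau>), \<tau> - h) \<in> D" using h le by (auto simp: D_def)
      have "(y - h * c (y, \<tau>), \<tau> - h) \<in> J \<times> {0..}"
        using subsetD[OF J, of "y - h * c (y, \<tau>)"] h le \<open>0 < h * c (y, \<tau>)\<close> by auto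
      then have "\<bar>s (y - h * c (y, \<tau>), \<tau> - h) - s (y, \<tau>)\<bar> < \<epsilon> * h" using h by blast
      moreover have "s (x, \<tau>) \<le> s (x, \<tau> - h)" using left[of "\<tau> - h" \<tau>] h True by simp
      ultimately show ?thesis
        using D' by (intro bexI[of _ "(x, y - h * c (y, \<tau>), \<tau> - h)"]) (auto simp: q_eq f_def)
    next
      case False
      with le have "a < x" by simp
      have ev: "\<forall>\<^sub>F h in at_right 0. a < x + h * (- c (x, \<tau>)) \<and> x + h * (- c (x, \<tau>)) < y + h * (- c (y, \<tau>))"
      proof (intro eventually_conj eventually_right_less_add \<open>a < x\<close>)
        have "\<forall>\<^sub>F h in at_right 0. x < y + h * (- c (y, \<tau>) + c (x, \<tau>))"
          using lt by (intro eventually_right_less_add)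
        then show "\<forall>\<^sub>F h in at_right 0. x + h * (- c (x, \<tau>)) < y + h * (- c (y, \<tau>))"
          by eventually_elim (simp add: algebra_simps)
      qed
      have "0 < \<epsilon> / 2" using \<epsilon> by simp
      obtain h where h: "0 < h" "x < y + h * (- c (y, \<tau>))" "0 < \<tau> + h * (-1)"
        "a < x + h * (- c (x, \<tau>))" "x + h * (- c (x, \<tau>)) < y + h * (- c (y, \<tau>))"
        "(y - h * c (y, \<tau>), \<tau> - h) \<in> J \<times> {0..} \<longrightarrow> \<bar>s (y - h * c (y, \<tau>), \<tau> - h) - s (y, \<tau>)\<bar> < \<epsilon> / 2 * h"
        "(x - h * c (x, \<tau>), \<tau> - h) \<in> J \<times> {0..} \<longrightarrow> \<bar>s (x - h * c (x, \<tau>), \<tau> - h) - s (x, \<tau>)\<bar> < \<epsilon> / 2 * h"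
        using eventually_right_obtain[OF eventually_conj[OF ev_lt eventually_conj[OF ev
              eventually_conj[OF s_along[OF yJ \<open>0 < \<epsilon> / 2\<close>] s_along[OF xJ \<open>0 < \<epsilon> / 2\<close>]]]]] by metis
      have "0 < h * c (y, \<tau>)" "0 < h * c (x, \<tau>)" using c_pos[OF yJ] c_pos[OF xJ] h by auto
      then have D': "(x - h * c (x, \<tau>), y - h * c (y, \<tau>), \<tau> - h) \<in> D" using h le by (auto simp: D_def)
      have "(y - h * c (y, \<tau>), \<tau> - h) \<in> J \<times> {0..}" "(x - h * c (x, \<tau>), \<tau> - h) \<in> J \<times> {0..}"
        using subsetD[OF J, of "y - h * c (y, \<tau>)"] subsetD[OF J, of "x - h * c (x, \<tau>)"] h le
          \<open>0 < h * c (y, \<tau>)\<close> \<open>0 < h * c (x, \<tau>)\<close> by auto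
      then have "\<bar>s (y - h * c (y, \<tau>), \<tau> - h) - s (y, \<tau>)\<bar> < \<epsilon> / 2 * h"
        "\<bar>s (x - h * c (x, \<tau>), \<tau> - h) - s (x, \<tau>)\<bar> < \<epsilon> / 2 * h" using h by blast+
      then have "(s (y - h * c (y, \<tau>), \<tau> - h) - s (x - h * c (x, \<tau>), \<tau> - h)) - (s (y, \<tau>) - s (x, \<tau>)) < \<epsilon> * h"
        unfolding abs_less_iff by (simp add: field_simps)
      then show ?thesis
        using D' by (intro bexI[of _ "(x - h * c (x, \<tau>), y - h * c (y, \<tau>), \<tau> - h)"]) (auto simp: q_eq f_def)
    qed
  qed (use \<open>compact D\<close> contf in auto)
  then show ?thesis by (simp add: f_def)
qed

end

section \<open>Backward characteristics as curves, and monotonicity of \<open>r\<close>\<close>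

lemma nonneg_derivative_of_mono:
  fixes f :: "real \<Rightarrow> real"
  assumes ab: "a < b" and x: "x \<in> {a..b}"
    and f: "(f has_real_derivative D) (at x within {a..b})"
    and mono: "\<And>x y. a \<le> x \<Longrightarrow> x \<le> y \<Longrightarrow> y \<le> b \<Longrightarrow> f x \<le> f y"
  shows "0 \<le> D"
proof (rule ccontr)
  assume "\<not> 0 \<le> D"
  then have D: "D < 0" by simp
  show False
  proof (cases "x < b")
    case True
    obtain \<delta> where \<delta>: "\<delta> > 0" "\<forall>h>0. x + h \<in> {a..b} \<longrightarrow> h < \<delta> \<longrightarrow> f (x + h) < f x"
      using has_real_derivative_neg_dec_right[OF f D] by blast
    define h where "h = min (\<delta> / 2) (b - x)"
    have "h > 0" "h < \<delta>" "x + h \<in> {a..b}" using \<delta> True x by (auto simp: h_def)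
    then show False using \<delta>(2) mono[of x "x + h"] x by force
  next
    case False
    obtain \<delta> where \<delta>: "\<delta> > 0" "\<forall>h>0. x - h \<in> {a..b} \<longrightarrow> h < \<delta> \<longrightarrow> f x < f (x - h)"
      using has_real_derivative_neg_dec_left[OF f D] by blast
    define h where "h = min (\<delta> / 2) (x - a)"
    have "h > 0" "h < \<delta>" "x - h \<in> {a..b}" using \<delta> False x ab by (auto simp: h_def)
    then show False using \<delta>(2) mono[of "x - h" x] x by force
  qed
qed

context riemann_strip
begin

lemma s_x: "x \<in> J \<Longrightarrow> 0 \<le> t \<Longrightarrow> ((\<lambda>y. s (y, t)) has_real_derivative sx (x, t)) (at x within J)"
  using derivative_along_curve[OF s_deriv, of "\<lambda>y. y" x "\<lambda>_. t" 1 J 0]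
  by (auto intro!: derivative_eq_intros)

lemma r_x: "x \<in> J \<Longrightarrow> 0 \<le> t \<Longrightarrow> ((\<lambda>y. r (y, t)) has_real_derivative rx (x, t)) (at x within J)"
  using derivative_along_curve[OF r_deriv, of "\<lambda>y. y" x "\<lambda>_. t" 1 J 0]
  by (auto intro!: derivative_eq_intros)

lemma s_t: "x \<in> J \<Longrightarrow> 0 \<le> t \<Longrightarrow> ((\<lambda>t. s (x, t)) has_real_derivative - c (x, t) * sx (x, t)) (at t within {0..})"
  using derivative_along_curve[OF s_deriv, of "\<lambda>_. x" t "\<lambda>t. t" 0 "{0..}" 1] s_eq[of "(x, t)"]
  by (auto intro!: derivative_eq_intros simp: c_def)

lemma r_t: "x \<in> J \<Longrightarrow> 0 \<le> t \<Longrightarrow> ((\<lambda>t. r (x, t)) has_real_derivative c (x, t) * rx (x, t)) (at t within {0..})"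
  using derivative_along_curve[OF r_deriv, of "\<lambda>_. x" t "\<lambda>t. t" 0 "{0..}" 1] r_eq[of "(x, t)"]
  by (auto intro!: derivative_eq_intros simp: c_def)

text \<open>Because \<open>s - r\<close> stays positive, the \<open>x\<close>-derivative of the
  speed is continuous and hence bounded on the compact rectangle; this provides the Lipschitz
  condition for the characteristic equation.\<close>

lemma c_lipschitz:
  assumes J: "{a..b} \<subseteq> J"
  shows "\<exists>L>0. \<forall>t\<in>{0..T}. \<forall>x\<in>{a..b}. \<forall>y\<in>{a..b}. \<bar>c (x, t) - c (y, t)\<bar> \<le> L * \<bar>x - y\<bar>"
proof -
  define cx where "cx = (\<lambda>q. k * (d * (s q - r q) powr (d - 1) * (sx q - rx q)))"
  define R where "R = {a..b} \<times> {0..T}"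
  have RJ: "R \<subseteq> J \<times> {0..}" using J by (auto simp: R_def)
  have "continuous_on (J \<times> {0..}) cx"
    unfolding cx_def using r_less_s by (intro continuous_intros cont_s cont_r cont_sx cont_rx) force+
  then have "continuous_on R cx" by (rule continuous_on_subset[OF _ RJ])
  then have "bounded (cx ` R)" unfolding R_def
    by (intro compact_imp_bounded compact_continuous_image compact_Times compact_Icc)
  then obtain L where L: "L > 0" "\<And>q. q \<in> R \<Longrightarrow> \<bar>cx q\<bar> \<le> L" by (auto simp: bounded_pos)
  have "\<bar>c (x, t) - c (y, t)\<bar> \<le> L * \<bar>x - y\<bar>" if t: "t \<in> {0..T}" and xy: "x \<in> {a..b}" "y \<in> {a..b}" for t x y
  proof -
    have deriv: "((\<lambda>z. c (z, t)) has_real_derivative cx (z, t)) (at z within {a..b})" if z: "z \<in> {a..b}" for z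
    proof -
      have zJ: "z \<in> J" "0 \<le> t" using z J t by auto
      have pos: "0 < s (z, t) - r (z, t)" using r_less_s[of "(z, t)"] zJ by simp
      have "((\<lambda>z. s (z, t) - r (z, t)) has_real_derivative sx (z, t) - rx (z, t)) (at z within {a..b})"
        by (intro DERIV_diff DERIV_subset[OF s_x[OF zJ] J] DERIV_subset[OF r_x[OF zJ] J])
      from DERIV_cmult[OF DERIV_chain2[OF has_real_derivative_powr[OF pos, of d] this], of k]
      show ?thesis by (simp add: c_def cx_def)
    qed
    have "norm (c (x, t) - c (y, t)) \<le> L * norm (x - y)"
      by (rule field_differentiable_bound[where S = "{a..b}", OF _ deriv])
         (use L t xy in \<open>auto simp: R_def\<close>)
    then show ?thesis by simp
  qed
  with L(1) show ?thesis by blast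
qed

text \<open>Clamping the position to \<open>[a, b]\<close> makes the field globally Lipschitz, so
  the curve exists for all \<open>t \<ge> T\<close>. It moves left from \<open>y \<le> b\<close>, so
  only the clamp at \<open>a\<close> remains visible, and it is a true backward characteristic as
  long as \<open>a \<le> Y t\<close>.\<close>

lemma backward_curve_exists:
  assumes J: "{a..b} \<subseteq> J" and y: "a \<le> y" "y \<le> b" and T: "0 \<le> T"
  obtains Y where "Y T = y"
    "\<And>t. T \<le> t \<Longrightarrow> (Y has_real_derivative - c (max a (Y t), t)) (at t within {T..})"
    "\<And>t t'. T \<le> t \<Longrightarrow> t \<le> t' \<Longrightarrow> Y t' \<le> Y t"
proof -
  define cl where "cl = (\<lambda>x. max a (min b x))"
  have cl: "cl x \<in> {a..b}" for x using y by (auto simp: cl_def)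
  have clJ: "(cl x, t) \<in> J \<times> {0..}" if "T \<le> t" for x t using cl J T that by auto
  have cl_lip: "\<bar>cl x - cl y\<bar> \<le> \<bar>x - y\<bar>" for x y by (auto simp: cl_def)
  have "continuous_on (UNIV \<times> {T..}) (\<lambda>q. - c (cl (fst q), snd q))"
    by (intro continuous_intros continuous_on_compose2[OF cont_c]) (use clJ in \<open>auto simp: cl_def intro!: continuous_intros\<close>)
  then have cont: "continuous_on (UNIV \<times> {T..}) (\<lambda>(x, t). - c (cl x, t))" by (simp add: case_prod_beta')
  have lip: "\<exists>L>0. \<forall>t\<in>{T..T'}. \<forall>x y. \<bar>- c (cl x, t) - - c (cl y, t)\<bar> \<le> L * \<bar>x - y\<bar>" for T'
  proof -
    obtain L where L: "L > 0" "\<forall>t\<in>{0..T'}. \<forall>x\<in>{a..b}. \<forall>y\<in>{a..b}. \<bar>c (x, t) - c (y, t)\<bar> \<le> L * \<bar>x - y\<bar>"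
      using c_lipschitz[OF J] by blast
    have "\<bar>- c (cl x, t) - - c (cl y, t)\<bar> \<le> L * \<bar>x - y\<bar>" if "t \<in> {T..T'}" for x y t
    proof -
      have "\<bar>- c (cl x, t) - - c (cl y, t)\<bar> = \<bar>c (cl x, t) - c (cl y, t)\<bar>" by simp
      also have "\<dots> \<le> L * \<bar>cl x - cl y\<bar>" using L(2) cl that T by simp
      also have "\<dots> \<le> L * \<bar>x - y\<bar>" using L(1) cl_lip by (intro mult_left_mono) auto
      finally show ?thesis .
    qed
    then show ?thesis using L(1) by blast
  qed
  obtain Y where Y0: "Y T = y"
    and Y: "\<And>t. t \<ge> T \<Longrightarrow> (Y has_real_derivative - c (cl (Y t), t)) (at t within {T..})"
    using scalar_ode_exists[OF cont lip, of y] by metis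
  have anti: "Y t' \<le> Y t" if t: "T \<le> t" "t \<le> t'" for t t'
  proof -
    have "0 * (t' - t) \<le> - Y t' - (- Y t)"
    proof (rule real_derivative_within_lower_bound[where f = "\<lambda>t. - Y t", OF t(2)])
      fix \<tau> assume \<tau>: "\<tau> \<in> {t..t'}"
      show "((\<lambda>t. - Y t) has_real_derivative - (- c (cl (Y \<tau>), \<tau>))) (at \<tau> within {t..t'})"
        using t \<tau> by (intro DERIV_minus DERIV_subset[OF Y]) auto
    next
      fix \<tau> assume "t < \<tau>" "\<tau> < t'"
      then show "0 \<le> - (- c (cl (Y \<tau>), \<tau>))" using c_pos[OF clJ[of \<tau> "Y \<tau>"]] t by simp
    qed
    then show ?thesis by simp
  qed
  have "cl (Y t) = max a (Y t)" if "T \<le> t" for t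
    using anti[OF order_refl that] Y0 y by (simp add: cl_def)
  then show thesis using that[of Y] Y0 Y anti by simp
qed

lemma r_constant_on_curve:
  assumes J: "{a..b} \<subseteq> J" and T: "0 \<le> T" "T \<le> t"
    and Y: "\<And>t. T \<le> t \<Longrightarrow> (Y has_real_derivative - c (max a (Y t), t)) (at t within {T..})"
    and range: "\<And>\<tau>. T \<le> \<tau> \<Longrightarrow> \<tau> \<le> t \<Longrightarrow> a \<le> Y \<tau> \<and> Y \<tau> \<le> b"
  shows "r (Y t, t) = r (Y T, T)"
proof -
  have deriv: "((\<lambda>\<tau>. r (Y \<tau>, \<tau>)) has_real_derivative 0) (at \<tau> within {T..t})" if \<tau>: "\<tau> \<in> {T..t}" for \<tau>
  proof -
    have YJ: "(Y \<sigma>, \<sigma>) \<in> J \<times> {0..}" if "\<sigma> \<in> {T..t}" for \<sigma> using range[of \<sigma>] that J T by auto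
    have "((\<lambda>\<tau>. r (Y \<tau>, \<tau>)) has_real_derivative (rx (Y \<tau>, \<tau>) * (- c (max a (Y \<tau>), \<tau>)) + rt (Y \<tau>, \<tau>) * 1)) (at \<tau> within {T..t})"
      by (rule derivative_along_curve[where X = Y and \<Theta> = "\<lambda>\<tau>. \<tau>", OF r_deriv[OF YJ[OF \<tau>]]])
         (use \<tau> YJ in \<open>auto intro!: derivative_eq_intros DERIV_subset[OF Y]\<close>)
    moreover have "max a (Y \<tau>) = Y \<tau>" using range[of \<tau>] \<tau> by simp
    ultimately show ?thesis using r_eq[OF YJ[OF \<tau>]] by (simp add: c_def)
  qed
  have "0 * (t - T) \<le> r (Y t, t) - r (Y T, T)"
    by (rule real_derivative_within_lower_bound[OF T(2) deriv]) auto
  moreover have "0 * (t - T) \<le> - r (Y t, t) - (- r (Y T, T))"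
    by (rule real_derivative_within_lower_bound[OF T(2) DERIV_minus[OF deriv, simplified]]) auto
  ultimately show ?thesis by simp
qed

lemma curve_hits_left_end:
  assumes Y: "\<And>t. T \<le> t \<Longrightarrow> (Y has_real_derivative Y' t) (at t within {T..})"
    and anti: "\<And>t t'. T \<le> t \<Longrightarrow> t \<le> t' \<Longrightarrow> Y t' \<le> Y t"
    and ends: "a \<le> Y T" "Y t \<le> a" "T \<le> (t::real)"
  obtains t' where "T \<le> t'" "t' \<le> t" "Y t' = a" "\<And>\<tau>. T \<le> \<tau> \<Longrightarrow> \<tau> \<le> t' \<Longrightarrow> a \<le> Y \<tau>"
proof -
  have "continuous_on {T..t} Y"
    by (rule continuous_on_subset[OF DERIV_continuous_on[of "{T..}" Y Y']]) (use Y in auto)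
  then obtain t' where "T \<le> t'" "t' \<le> t" "Y t' = a"
    using IVT2'[of Y t a T] ends by auto
  then show thesis using that anti by force
qed

text \<open>With \<open>s\<close> constant on the strip and \<open>r\<close> constant along the
  curve, the speed is constant along it. The bound on \<open>a\<close> ensures that the line has not
  passed the clamp by time \<open>t\<close>.\<close>

lemma straight_backward_curve:
  assumes J: "J = {..b}" and s: "\<And>q. q \<in> J \<times> {0..} \<Longrightarrow> s q = sL" and T: "0 \<le> T" "T \<le> t"
    and Y0: "Y T = b"
    and Y: "\<And>t. T \<le> t \<Longrightarrow> (Y has_real_derivative - c (max a (Y t), t)) (at t within {T..})"
    and anti: "\<And>t t'. T \<le> t \<Longrightarrow> t \<le> t' \<Longrightarrow> Y t' \<le> Y t"
    and a: "a \<le> b - c (b, T) * (t - T)"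
  shows "Y t = b - c (b, T) * (t - T) \<and> r (Y t, t) = r (b, T)"
proof -
  have J': "{a..b} \<subseteq> J" using J by auto
  have cb: "0 < c (b, T)" using T J by (intro c_pos) auto
  have ab: "a \<le> b" using a cb T by (smt (verit) mult_nonneg_nonneg)
  have line: "Y t = b - c (b, T) * (t - T) \<and> r (Y t, t) = r (b, T)" if t: "T \<le> t" "a \<le> Y t" for t
  proof -
    have range: "a \<le> Y \<tau> \<and> Y \<tau> \<le> b" if "T \<le> \<tau>" "\<tau> \<le> t" for \<tau>
      using anti[of T \<tau>] anti[of \<tau> t] that t Y0 by auto
    have r: "r (Y \<tau>, \<tau>) = r (b, T)" if "T \<le> \<tau>" "\<tau> \<le> t" for \<tau>
      using r_constant_on_curve[OF J' T(1) that(1) Y] range that Y0 by auto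
    have Y': "(Y has_real_derivative - c (b, T)) (at \<tau> within {T..t})" if \<tau>: "\<tau> \<in> {T..t}" for \<tau>
    proof -
      have "max a (Y \<tau>) = Y \<tau>" using range[of \<tau>] \<tau> by simp
      moreover have "s (Y \<tau>, \<tau>) = s (b, T)" using s[of "(Y \<tau>, \<tau>)"] s[of "(b, T)"] range[of \<tau>] \<tau> T J by auto
      ultimately have "c (max a (Y \<tau>), \<tau>) = c (b, T)" using r[of \<tau>] \<tau> by (simp add: c_def)
      then show ?thesis using DERIV_subset[OF Y[of \<tau>], of "{T..t}"] \<tau> by auto
    qed
    have "- c (b, T) * (t - T) \<le> Y t - Y T"
      by (rule real_derivative_within_lower_bound[OF t(1) Y']) auto
    moreover have "c (b, T) * (t - T) \<le> - Y t - (- Y T)"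
      by (rule real_derivative_within_lower_bound[OF t(1) DERIV_minus[OF Y', simplified]]) auto
    ultimately show ?thesis using r[OF t(1) order_refl] Y0 by simp
  qed
  \<comment> \<open>Otherwise the curve reaches \<open>a\<close> at some \<open>t' < t\<close>, when
    the straight line is still strictly to the right of \<open>a\<close>.\<close>
  have "a \<le> Y t"
  proof (rule ccontr)
    assume neg: "\<not> a \<le> Y t"
    obtain t' where t': "T \<le> t'" "t' \<le> t" "Y t' = a"
      using curve_hits_left_end[OF Y anti, of a t] neg Y0 ab T by auto
    then have "t' \<noteq> t" using neg by auto
    then have "c (b, T) * (t' - T) < c (b, T) * (t - T)" using t' cb by simp
    then show False using line[of t'] t' a by simp
  qed
  then show ?thesis using line T by blast
qed

text \<open>Backward characteristics are straight here; two of them carrying decreasing values would meet.\<close>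

lemma outgoing_invariant_mono_left_strip:
  assumes J: "J = {..b}" and s: "\<And>q. q \<in> J \<times> {0..} \<Longrightarrow> s q = sL" and t: "0 \<le> t1" "t1 \<le> t2"
  shows "r (b, t1) \<le> r (b, t2)"
proof (rule ccontr)
  assume neg: "\<not> r (b, t1) \<le> r (b, t2)"
  define c1 where "c1 = c (b, t1)"
  define c2 where "c2 = c (b, t2)"
  have bJ: "(b, t1) \<in> J \<times> {0..}" "(b, t2) \<in> J \<times> {0..}" using t J by auto
  have "s (b, t1) - r (b, t1) < s (b, t2) - r (b, t2)" using s bJ neg by simp
  then have c12: "c1 < c2" "0 < c1"
    using r_less_s[OF bJ(1)] k_pos d_pos c_pos[OF bJ(1)]
    by (auto simp: c1_def c2_def c_def[abs_def] intro!: powr_less_mono2)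
  \<comment> \<open>The later characteristic carries the smaller \<open>r\<close> and is therefore
    faster. \<open>T\<close> is the time and \<open>a\<close> the place where the two lines meet;
    there \<open>r\<close> would take both values.\<close>
  define T where "T = (c2 * t2 - c1 * t1) / (c2 - c1)"
  define a where "a = b - c2 * (T - t2)"
  have meet: "c2 * (T - t2) = c1 * (T - t1)"
    using c12 by (simp add: T_def field_simps)
  have "(c2 - c1) * t2 \<le> c2 * t2 - c1 * t1" using c12 t by (simp add: algebra_simps)
  then have Tt: "t2 \<le> T" using c12 by (simp add: T_def field_simps)
  have a: "a \<le> b" using Tt c12 by (simp add: a_def)
  have J': "{a..b} \<subseteq> J" using J by auto
  obtain Y1 where Y1: "Y1 t1 = b" "\<And>t. t1 \<le> t \<Longrightarrow> (Y1 has_real_derivative - c (max a (Y1 t), t)) (at t within {t1..})"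
    "\<And>t t'. t1 \<le> t \<Longrightarrow> t \<le> t' \<Longrightarrow> Y1 t' \<le> Y1 t"
    using backward_curve_exists[OF J' a order_refl t(1)] by metis
  have "0 \<le> t2" using t by simp
  obtain Y2 where Y2: "Y2 t2 = b" "\<And>t. t2 \<le> t \<Longrightarrow> (Y2 has_real_derivative - c (max a (Y2 t), t)) (at t within {t2..})"
    "\<And>t t'. t2 \<le> t \<Longrightarrow> t \<le> t' \<Longrightarrow> Y2 t' \<le> Y2 t"
    using backward_curve_exists[OF J' a order_refl \<open>0 \<le> t2\<close>] by metis
  have "Y1 T = b - c1 * (T - t1) \<and> r (Y1 T, T) = r (b, t1)"
  proof -
    have "t1 \<le> T" "a \<le> b - c (b, t1) * (T - t1)" using Tt t meet by (auto simp: c1_def a_def)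
    then show ?thesis using straight_backward_curve[OF J s t(1) _ Y1] unfolding c1_def by blast
  qed
  moreover have "Y2 T = b - c2 * (T - t2) \<and> r (Y2 T, T) = r (b, t2)"
    using straight_backward_curve[OF J s \<open>0 \<le> t2\<close> Tt Y2] unfolding c2_def a_def by blast
  ultimately have "r (b, t1) = r (b, t2)" using meet by metis
  then show False using neg by simp
qed

text \<open>No monotonicity of \<open>r\<close> at \<open>t = 0\<close> is assumed: a decrease of \<open>r\<close> would lead to a collision of
  characteristics, since \<open>s\<close> increases.\<close>

lemma r_mono:
  assumes J: "{a..b} \<subseteq> J"
    and s_mono: "\<And>x y t. a \<le> x \<Longrightarrow> x \<le> y \<Longrightarrow> y \<le> b \<Longrightarrow> 0 \<le> t \<Longrightarrow> s (x, t) \<le> s (y, t)"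
    and left: "\<And>t t'. 0 \<le> t \<Longrightarrow> t \<le> t' \<Longrightarrow> r (a, t) \<le> r (a, t')"
    and xy: "a \<le> x" "x \<le> y" "y \<le> b" and T: "0 \<le> T"
  shows "r (x, T) \<le> r (y, T)"
proof (rule ccontr)
  assume neg: "\<not> r (x, T) \<le> r (y, T)"
  define \<rho> where "\<rho> = r (x, T)"
  define \<rho>' where "\<rho>' = r (y, T)"
  have \<rho>: "\<rho>' < \<rho>" using neg by (simp add: \<rho>_def \<rho>'_def)
  have ay: "a \<le> y" using xy by simp
  obtain Y where Y0: "Y T = y"
    and Y: "\<And>t. T \<le> t \<Longrightarrow> (Y has_real_derivative - c (max a (Y t), t)) (at t within {T..})"
    and anti: "\<And>t t'. T \<le> t \<Longrightarrow> t \<le> t' \<Longrightarrow> Y t' \<le> Y t"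
    using backward_curve_exists[OF J ay xy(3) T] by metis
  have contY: "continuous_on {T..} Y"
    by (rule DERIV_continuous_on[where D = "\<lambda>t. - c (max a (Y t), t)"]) (use Y in auto)
  have range: "a \<le> Y \<tau> \<and> Y \<tau> \<le> b" if "a \<le> Y t" "T \<le> \<tau>" "\<tau> \<le> t" for t \<tau>
    using anti[of T \<tau>] anti[of \<tau> t] that Y0 xy by auto
  have rY: "r (Y t, t) = \<rho>'" if "a \<le> Y t" "T \<le> t" for t
    using r_constant_on_curve[OF J T that(2) Y] range that Y0 by (auto simp: \<rho>'_def)
  \<comment> \<open>As long as \<open>Y\<close> has not passed \<open>a\<close>, a value of
    \<open>r\<close> at least \<open>\<rho>\<close> survives to its left. Otherwise
    \<open>M < \<rho>\<close> bounds \<open>r\<close> wherever a backward characteristic can leave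
    the region left of \<open>Y\<close> in forward time: on the top by the choice of
    \<open>z1\<close>, at \<open>a\<close> by \<open>left\<close>, on \<open>Y\<close> by
    \<open>\<rho>'\<close>. This would give \<open>r (x, T) \<le> M\<close>.\<close>
  have ahead: "\<exists>z\<in>{a..Y t1}. \<rho> \<le> r (z, t1)" if t1: "T \<le> t1" "a \<le> Y t1" for t1
  proof (rule ccontr)
    assume "\<not> ?thesis"
    then have less: "\<And>z. z \<in> {a..Y t1} \<Longrightarrow> r (z, t1) < \<rho>" by force
    have "{a..Y t1} \<subseteq> J" using J range[OF t1(2) t1(1) order_refl] by auto
    then have "continuous_on {a..Y t1} (\<lambda>z. r (z, t1))"
      using t1 T by (intro continuous_on_compose2[OF cont_r] continuous_intros) auto
    then obtain z1 where z1: "z1 \<in> {a..Y t1}" "\<And>z. z \<in> {a..Y t1} \<Longrightarrow> r (z, t1) \<le> r (z1, t1)"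
      using continuous_attains_sup[of "{a..Y t1}" "\<lambda>z. r (z, t1)"] t1 by auto
    define M where "M = max (r (z1, t1)) \<rho>'"
    have M: "M < \<rho>" using less z1 \<rho> by (simp add: M_def)
    define D where "D = {q \<in> {a..b} \<times> {T..t1}. fst q \<le> Y (snd q)}"
    have "closed D" unfolding D_def
      by (intro continuous_on_closed_Collect_le continuous_intros closed_Times closed_atLeastAtMost
            continuous_on_compose2[OF contY]) auto
    moreover have "D \<subseteq> {a..b} \<times> {T..t1}" by (auto simp: D_def)
    ultimately have "compact D"
      using compact_Times[OF compact_Icc compact_Icc] by (meson bounded_subset compact_eq_bounded_closed)
    have DJ: "D \<subseteq> J \<times> {0..}" using J T by (auto simp: D_def)
    have "- M \<le> - r (x, T)"
    proof (rule compact_min_principle[where D = D and \<theta> = snd and f = "\<lambda>q. - r q"])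
      show "continuous_on D (\<lambda>q. - r q)" by (intro continuous_intros continuous_on_subset[OF cont_r DJ])
      show "continuous_on D snd" by (intro continuous_intros)
      show "(x, T) \<in> D" using xy t1 Y0 by (simp add: D_def)
      fix q \<epsilon> assume q: "q \<in> D" "- r q < - M" and \<epsilon>: "0 < (\<epsilon>::real)"
      obtain z t where q_eq: "q = (z, t)" by force
      have zt: "a \<le> z" "z \<le> b" "T \<le> t" "t \<le> t1" "z \<le> Y t" "(z, t) \<in> J \<times> {0..}"
        using q subsetD[OF DJ q(1)] unfolding D_def q_eq by auto
      have r: "M < r (z, t)" using q by (simp add: q_eq)
      have "t \<noteq> t1" using r z1(2)[of z] zt by (auto simp: M_def)
      moreover have "z \<noteq> a" using r left[of t t1] z1(2)[of a] zt t1 T by (auto simp: M_def)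
      moreover have "z \<noteq> Y t" using r rY[of t] zt by (auto simp: M_def)
      ultimately have lt: "t < t1" "a < z" "z < Y t" using zt by auto
      have "((\<lambda>h. Y (t + h * 1) - h * (- c (z, t))) \<longlongrightarrow> Y t - 0 * (- c (z, t))) (at_right 0)"
      proof (intro tendsto_intros continuous_on_tendsto_compose[OF contY])
        show "\<forall>\<^sub>F h in at_right 0. t + h * 1 \<in> {T..}"
          using eventually_at_right_less[of "0::real"] by eventually_elim (use zt in auto)
        show "((\<lambda>h. t + h * 1) \<longlongrightarrow> t) (at_right 0)" by (auto intro!: tendsto_eq_intros)
      qed (use zt in auto)
      then have evY: "\<forall>\<^sub>F h in at_right 0. z < Y (t + h * 1) - h * (- c (z, t))"
        by (rule order_tendstoD) (use lt in auto)
      obtain h where h: "0 < h" "z < Y (t + h * 1) - h * (- c (z, t))" "a < z + h * (- c (z, t))" "t + h * 1 < t1"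
        "(z + h * (-1 * c (z, t)), t - h * -1) \<in> J \<times> {0..} \<longrightarrow> \<bar>r (z + h * (-1 * c (z, t)), t - h * -1) - r (z, t)\<bar> < \<epsilon> * h"
        using eventually_right_obtain[OF eventually_conj[OF evY eventually_conj[OF
              eventually_right_less_add[OF lt(2)] eventually_conj[OF eventually_right_add_less[OF lt(1)]
              r_along[OF zt(6) \<epsilon>, of "-1"]]]]] by (metis insertI1)
      have "0 < h * c (z, t)" using c_pos[OF zt(6)] h by simp
      then have D': "(z - h * c (z, t), t + h) \<in> D" using h zt by (auto simp: D_def)
      then have "\<bar>r (z - h * c (z, t), t + h) - r (z, t)\<bar> < \<epsilon> * h" using h DJ by auto
      then show "\<exists>q'\<in>D. - r q' - - r q < \<epsilon> * (snd q' - snd q)"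
        using D' by (intro bexI[of _ "(z - h * c (z, t), t + h)"]) (auto simp: q_eq)
    qed (use \<open>compact D\<close> in auto)
    then show False using M by (simp add: \<rho>_def)
  qed
  \<comment> \<open>At the surviving point \<open>\<rho> \<le> r < s\<close>, and \<open>s\<close>
    increases in \<open>x\<close>, so \<open>s > \<rho>\<close> on \<open>Y\<close> while
    \<open>r = \<rho>'\<close> there. Thus \<open>\<rho> - \<rho>'\<close> bounds the gap from below
    and \<open>\<eta>\<close> the speed.\<close>
  define \<eta> where "\<eta> = k * (\<rho> - \<rho>') powr d"
  have \<eta>: "0 < \<eta>" using \<rho> k_pos by (simp add: \<eta>_def)
  have speed: "\<eta> \<le> c (Y t, t)" if t: "T \<le> t" "a \<le> Y t" for t
  proof -
    obtain z where z: "z \<in> {a..Y t}" "\<rho> \<le> r (z, t)" using ahead[OF t] by blast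
    have Yb: "Y t \<le> b" using range[OF t(2) t(1)] by simp
    then have "(z, t) \<in> J \<times> {0..}" using z t T J by auto
    then have "\<rho> < s (z, t)" using r_less_s z by force
    also have "\<dots> \<le> s (Y t, t)" using z Yb t T by (intro s_mono) auto
    finally have "\<rho> - \<rho>' \<le> s (Y t, t) - r (Y t, t)" using rY t by simp
    then show ?thesis unfolding \<eta>_def c_def using \<rho> k_pos d_pos
      by (intro mult_left_mono powr_mono2) auto
  qed
  \<comment> \<open>The time to cover the distance \<open>y - a\<close> at speed
    \<open>\<eta>\<close>, plus 1 to overshoot.\<close>
  define t2 where "t2 = T + (y - a) / \<eta> + 1"
  have t2: "T \<le> t2" using \<eta> ay by (simp add: t2_def)
  have "Y t2 \<le> a"
  proof (rule ccontr)
    assume "\<not> Y t2 \<le> a"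
    then have ge: "a \<le> Y t2" by simp
    have "\<eta> * (t2 - T) \<le> - Y t2 - (- Y T)"
    proof (rule real_derivative_within_lower_bound[where f = "\<lambda>t. - Y t", OF t2])
      show "((\<lambda>t. - Y t) has_real_derivative - (- c (max a (Y t), t))) (at t within {T..t2})" if "t \<in> {T..t2}" for t
        using that by (intro DERIV_minus DERIV_subset[OF Y]) auto
      show "\<eta> \<le> - (- c (max a (Y t), t))" if "T < t" "t < t2" for t
        using range[OF ge, of t] speed[of t] that by (simp add: max_def)
    qed
    moreover have "\<eta> * (t2 - T) = y - a + \<eta>" using \<eta> by (simp add: t2_def field_simps)
    ultimately show False using ge Y0 \<eta> by simp
  qed
  \<comment> \<open>On arrival the interval \<open>{a..Y t'}\<close> is the single point
    \<open>a\<close>, where \<open>r\<close> would be both equal to \<open>\<rho>'\<close> and at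
    least \<open>\<rho>\<close>.\<close>
  then obtain t' where t': "T \<le> t'" "Y t' = a"
    using curve_hits_left_end[OF Y anti, of a t2] Y0 ay t2 by metis
  then show False using ahead[of t'] rY[of t'] \<rho> by auto
qed

lemma s_antimono_time:
  assumes J: "{a..b} \<subseteq> J" and ab: "a < b" and x: "x \<in> {a..b}" and t: "0 \<le> t" "t \<le> t'"
    and mono: "\<And>x y t. a \<le> x \<Longrightarrow> x \<le> y \<Longrightarrow> y \<le> b \<Longrightarrow> 0 \<le> t \<Longrightarrow> s (x, t) \<le> s (y, t)"
  shows "s (x, t') \<le> s (x, t)"
proof -
  have xJ: "x \<in> J" using x J by auto
  have "0 * (t' - t) \<le> - s (x, t') - (- s (x, t))"
  proof (rule real_derivative_within_lower_bound[where f = "\<lambda>t. - s (x, t)", OF t(2)])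
    show "((\<lambda>t. - s (x, t)) has_real_derivative - (- c (x, \<tau>) * sx (x, \<tau>))) (at \<tau> within {t..t'})" if "\<tau> \<in> {t..t'}" for \<tau>
      using that t xJ by (intro DERIV_minus DERIV_subset[OF s_t]) auto
    fix \<tau> assume "t < \<tau>" "\<tau> < t'"
    then have \<tau>: "0 \<le> \<tau>" using t by simp
    have "0 \<le> sx (x, \<tau>)"
      by (rule nonneg_derivative_of_mono[OF ab x DERIV_subset[OF s_x[OF xJ \<tau>] J]]) (use mono \<tau> in auto)
    then show "0 \<le> - (- c (x, \<tau>) * sx (x, \<tau>))" using c_pos[of "(x, \<tau>)"] xJ \<tau> by simp
  qed
  then show ?thesis by simp
qed

lemma r_mono_time:
  assumes J: "{a..b} \<subseteq> J" and ab: "a < b" and x: "x \<in> {a..b}" and t: "0 \<le> t" "t \<le> t'"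
    and mono: "\<And>x y t. a \<le> x \<Longrightarrow> x \<le> y \<Longrightarrow> y \<le> b \<Longrightarrow> 0 \<le> t \<Longrightarrow> r (x, t) \<le> r (y, t)"
  shows "r (x, t) \<le> r (x, t')"
proof -
  have xJ: "x \<in> J" using x J by auto
  have "0 * (t' - t) \<le> r (x, t') - r (x, t)"
  proof (rule real_derivative_within_lower_bound[where f = "\<lambda>t. r (x, t)", OF t(2)])
    show "((\<lambda>t. r (x, t)) has_real_derivative (c (x, \<tau>) * rx (x, \<tau>))) (at \<tau> within {t..t'})" if "\<tau> \<in> {t..t'}" for \<tau>
      using that t xJ by (intro DERIV_subset[OF r_t]) auto
    fix \<tau> assume "t < \<tau>" "\<tau> < t'"
    then have \<tau>: "0 \<le> \<tau>" using t by simp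
    have "0 \<le> rx (x, \<tau>)"
      by (rule nonneg_derivative_of_mono[OF ab x DERIV_subset[OF r_x[OF xJ \<tau>] J]]) (use mono \<tau> in auto)
    then show "0 \<le> c (x, \<tau>) * rx (x, \<tau>)" using c_pos[of "(x, \<tau>)"] xJ \<tau> by simp
  qed
  then show ?thesis by simp
qed

text \<open>The backward characteristic \<open>Y\<close> from \<open>(b, T)\<close> either stays in
  the strip forever or reaches \<open>a\<close> at some \<open>T1\<close>. In the second case
  whatever arrives at \<open>a\<close> from then on has travelled to the right of \<open>Y\<close>
  or on it, hence comes from \<open>x = b\<close> at a time at least \<open>T\<close>.\<close>

lemma trapped_curve_or_outflow_bound:
  assumes J: "{a..b} \<subseteq> J" and ab: "a \<le> b" and T: "0 \<le> T"
    and right: "\<And>t. T \<le> t \<Longrightarrow> \<rho> \<le> r (b, t)"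
  shows "(\<exists>Y. Y T = b \<and> (\<forall>t\<ge>T. a < Y t \<and> Y t \<le> b \<and> (Y has_real_derivative - c (Y t, t)) (at t within {T..}))) \<or>
         (\<exists>T1\<ge>T. \<forall>t\<ge>T1. \<rho> \<le> r (a, t))"
proof -
  obtain Y where Y0: "Y T = b"
    and Y: "\<And>t. T \<le> t \<Longrightarrow> (Y has_real_derivative - c (max a (Y t), t)) (at t within {T..})"
    and anti: "\<And>t t'. T \<le> t \<Longrightarrow> t \<le> t' \<Longrightarrow> Y t' \<le> Y t"
    using backward_curve_exists[OF J ab order_refl T] by metis
  have contY: "continuous_on {T..} Y"
    by (rule DERIV_continuous_on[where D = "\<lambda>t. - c (max a (Y t), t)"]) (use Y in auto)
  show ?thesis
  proof (cases "\<forall>t\<ge>T. a < Y t")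
    case True
    then have "\<forall>t\<ge>T. a < Y t \<and> Y t \<le> b \<and> (Y has_real_derivative - c (Y t, t)) (at t within {T..})"
      using Y Y0 anti[OF order_refl] by (metis less_eq_real_def max.absorb2)
    then show ?thesis using Y0 by blast
  next
    case False
    then obtain t1 where "T \<le> t1" "Y t1 \<le> a" by force
    then obtain T1 where T1: "T \<le> T1" "Y T1 = a"
      using curve_hits_left_end[OF Y anti, of a t1] Y0 ab by metis
    have "\<rho> \<le> r (a, t)" if t: "T1 \<le> t" for t
    proof -
      \<comment> \<open>The region between \<open>Y\<close> and \<open>b\<close> up to time
        \<open>t\<close>. Traced into the past, \<open>r\<close> leaves it through
        \<open>x = b\<close> or meets \<open>Y\<close>, which carries \<open>r (b, T)\<close>; the
        bottom edge is the single point \<open>(b, T)\<close>.\<close>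
      define D where "D = {q \<in> {a..b} \<times> {T..t}. Y (snd q) \<le> fst q}"
      have "closed D" unfolding D_def
        by (intro continuous_on_closed_Collect_le continuous_intros closed_Times closed_atLeastAtMost
              continuous_on_compose2[OF contY]) auto
      moreover have "D \<subseteq> {a..b} \<times> {T..t}" by (auto simp: D_def)
      ultimately have "compact D"
        using compact_Times[OF compact_Icc compact_Icc] by (meson bounded_subset compact_eq_bounded_closed)
      have DJ: "D \<subseteq> J \<times> {0..}" using J T by (auto simp: D_def)
      show ?thesis
      proof (rule compact_min_principle[where D = D and \<theta> = "\<lambda>q. - snd q" and f = r])
        show "continuous_on D r" by (intro continuous_on_subset[OF cont_r DJ])
        show "continuous_on D (\<lambda>q. - snd q)" by (intro continuous_intros)
        show "(a, t) \<in> D" using ab t T1 anti[of T1 t] by (simp add: D_def)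
        fix q \<epsilon> assume q: "q \<in> D" "r q < \<rho>" and \<epsilon>: "0 < (\<epsilon>::real)"
        obtain z \<tau> where q_eq: "q = (z, \<tau>)" by force
        have zt: "a \<le> z" "z \<le> b" "T \<le> \<tau>" "\<tau> \<le> t" "Y \<tau> \<le> z" "(z, \<tau>) \<in> J \<times> {0..}"
          using q subsetD[OF DJ q(1)] unfolding D_def q_eq by auto
        have r: "r (z, \<tau>) < \<rho>" using q by (simp add: q_eq)
        then have "z \<noteq> b" using right[of \<tau>] zt by auto
        moreover have "\<tau> \<noteq> T" using \<open>z \<noteq> b\<close> zt Y0 by auto
        moreover have "z \<noteq> Y \<tau>"
        proof
          assume z: "z = Y \<tau>"
          have "a \<le> Y \<sigma> \<and> Y \<sigma> \<le> b" if "T \<le> \<sigma>" "\<sigma> \<le> \<tau>" for \<sigma>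
            using anti[of T \<sigma>] anti[of \<sigma> \<tau>] that z zt Y0 by auto
          then have "r (Y \<tau>, \<tau>) = r (Y T, T)"
            using r_constant_on_curve[OF J T zt(3) Y] by blast
          then show False using right[of T] r z Y0 by simp
        qed
        ultimately have lt: "T < \<tau>" "z < b" "Y \<tau> < z" using zt by auto
        have "((\<lambda>h. Y (\<tau> + h * (-1)) - h * c (z, \<tau>)) \<longlongrightarrow> Y \<tau> - 0 * c (z, \<tau>)) (at_right 0)"
        proof (intro tendsto_intros continuous_on_tendsto_compose[OF contY])
          show "\<forall>\<^sub>F h in at_right 0. \<tau> + h * (-1) \<in> {T..}"
            using eventually_right_less_add[OF lt(1), of "-1"] by eventually_elim auto
          show "((\<lambda>h. \<tau> + h * (-1)) \<longlongrightarrow> \<tau>) (at_right 0)" by (auto intro!: tendsto_eq_intros)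
        qed (use zt in auto)
        then have evY: "\<forall>\<^sub>F h in at_right 0. Y (\<tau> + h * (-1)) - h * c (z, \<tau>) < z"
          by (rule order_tendstoD) (use lt in auto)
        obtain h where h: "0 < h" "Y (\<tau> + h * (-1)) - h * c (z, \<tau>) < z" "z + h * c (z, \<tau>) < b" "T < \<tau> + h * (-1)"
          "(z + h * (1 * c (z, \<tau>)), \<tau> - h * 1) \<in> J \<times> {0..} \<longrightarrow> \<bar>r (z + h * (1 * c (z, \<tau>)), \<tau> - h * 1) - r (z, \<tau>)\<bar> < \<epsilon> * h"
          using eventually_right_obtain[OF eventually_conj[OF evY eventually_conj[OF
                eventually_right_add_less[OF lt(2)] eventually_conj[OF eventually_right_less_add[OF lt(1)]
                r_along[OF zt(6) \<epsilon>, of 1]]]]] by (metis insertI1 insertI2)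
        have "0 < h * c (z, \<tau>)" using c_pos[OF zt(6)] h by simp
        then have D': "(z + h * c (z, \<tau>), \<tau> - h) \<in> D" using h zt by (auto simp: D_def)
        then have "\<bar>r (z + h * c (z, \<tau>), \<tau> - h) - r (z, \<tau>)\<bar> < \<epsilon> * h" using h DJ by auto
        then show "\<exists>q'\<in>D. r q' - r q < \<epsilon> * (- snd q' - - snd q)"
          using D' by (intro bexI[of _ "(z + h * c (z, \<tau>), \<tau> - h)"]) (auto simp: q_eq)
      qed (use \<open>compact D\<close> in auto)
    qed
    then show ?thesis using T1(1) by blast
  qed
qed

end

section \<open>Isentropic gas on a strip\<close>

text \<open>The quantity \<open>w = m z\<close> in terms of \<open>p\<close> and
  \<open>A = p \<tau>^\<gamma>\<close>; it equals \<open>2 / (\<gamma> - 1)\<close> times the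
  Eulerian sound speed \<open>sqrt (\<gamma> p \<tau>)\<close>. The pressure serves as variable
  because it is continuous across the jumps of the entropy.\<close>

definition riemann_w :: "real \<Rightarrow> real \<Rightarrow> real \<Rightarrow> real" where
  "riemann_w \<gamma> A p = 2 / (\<gamma> - 1) * sqrt (\<gamma> * A) * (p / A) powr ((\<gamma> - 1) / (2 * \<gamma>))"

definition gas_speed :: "real \<Rightarrow> real \<Rightarrow> real \<Rightarrow> real" where
  "gas_speed \<gamma> A p = sqrt (\<gamma> * A) * (p / A) powr ((\<gamma> + 1) / (2 * \<gamma>))"

lemma riemann_w_pos: "1 < \<gamma> \<Longrightarrow> 0 < A \<Longrightarrow> 0 < p \<Longrightarrow> 0 < riemann_w \<gamma> A p"
  by (simp add: riemann_w_def)

lemma riemann_w_inj_mono: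
  assumes "1 < \<gamma>" "0 < A" "0 < p" "0 < q"
  shows "riemann_w \<gamma> A p \<le> riemann_w \<gamma> A q \<longleftrightarrow> p \<le> q"
proof -
  have "riemann_w \<gamma> A p < riemann_w \<gamma> A q" if "p < q" "0 < p" for p q
    unfolding riemann_w_def using assms that
    by (intro mult_strict_left_mono powr_less_mono2 divide_strict_right_mono) auto
  then show ?thesis using assms by (metis linorder_not_less nless_le)
qed

text \<open>\<open>w\<close> depends on \<open>A\<close> only through the factor
  \<open>A powr (1 / (2 * \<gamma>))\<close>, so at fixed pressure a jump of the entropy multiplies
  it by a constant, the same at all times.\<close>

lemma riemann_w_scale:
  assumes "1 < \<gamma>" "0 < A" "A \<le> B"
  obtains \<kappa> where "1 \<le> \<kappa>" "\<And>p. 0 < p \<Longrightarrow> riemann_w \<gamma> B p = \<kappa> * riemann_w \<gamma> A p"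
proof
  define \<kappa> where "\<kappa> = (B / A) powr (1 / (2 * \<gamma>))"
  have B: "0 < B" using assms by simp
  show "1 \<le> \<kappa>" unfolding \<kappa>_def using assms by (intro ge_one_powr_ge_zero) auto
  fix p :: real assume p: "0 < p"
  have *: "sqrt (\<gamma> * C) * (p / C) powr ((\<gamma> - 1) / (2 * \<gamma>)) =
      sqrt \<gamma> * p powr ((\<gamma> - 1) / (2 * \<gamma>)) * C powr (1 / (2 * \<gamma>))" if C: "0 < C" for C
  proof -
    have "sqrt C = C powr (1/2)" using C by (simp add: powr_half_sqrt)
    also have "1/2 = (\<gamma> - 1) / (2 * \<gamma>) + 1 / (2 * \<gamma>)" using assms by (simp add: field_simps)
    finally have "sqrt C = C powr ((\<gamma> - 1) / (2 * \<gamma>)) * C powr (1 / (2 * \<gamma>))" by (simp only: powr_add)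
    then show ?thesis using C p by (simp add: real_sqrt_mult powr_divide)
  qed
  have "\<kappa> * A powr (1 / (2 * \<gamma>)) = B powr (1 / (2 * \<gamma>))"
    unfolding \<kappa>_def using assms B by (simp flip: powr_mult)
  then have "sqrt (\<gamma> * B) * (p / B) powr ((\<gamma> - 1) / (2 * \<gamma>)) = \<kappa> * (sqrt (\<gamma> * A) * (p / A) powr ((\<gamma> - 1) / (2 * \<gamma>)))"
    unfolding *[OF assms(2)] *[OF B] by (metis mult.assoc mult.left_commute)
  then show "riemann_w \<gamma> B p = \<kappa> * riemann_w \<gamma> A p"
    unfolding riemann_w_def by (simp add: mult.assoc mult.left_commute)
qed

text \<open>This relation turns \<open>p_x / c\<close> into \<open>w_x\<close> and so makes
  \<open>u + w\<close> and \<open>u - w\<close> Riemann invariants.\<close>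

lemma DERIV_riemann_w:
  assumes "1 < \<gamma>" "0 < A" "0 < p"
  shows "(riemann_w \<gamma> A has_real_derivative 1 / gas_speed \<gamma> A p) (at p)"
proof -
  define e where "e = (\<gamma> - 1) / (2 * \<gamma>)"
  define y where "y = p / A"
  have y: "0 < y" using assms by (simp add: y_def)
  have "((\<lambda>p. 2 / (\<gamma> - 1) * sqrt (\<gamma> * A) * (p / A) powr e) has_real_derivative
      2 / (\<gamma> - 1) * sqrt (\<gamma> * A) * (e * y powr (e - 1) * (1 / A))) (at p)"
    unfolding y_def using assms
    by (intro DERIV_cmult DERIV_chain2[OF has_real_derivative_powr]) (auto intro!: derivative_eq_intros)
  moreover have "2 / (\<gamma> - 1) * sqrt (\<gamma> * A) * (e * y powr (e - 1) * (1 / A)) = 1 / gas_speed \<gamma> A p"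
  proof -
    have e1: "e - 1 = - ((\<gamma> + 1) / (2 * \<gamma>))" using assms by (simp add: e_def field_simps)
    have "2 / (\<gamma> - 1) * sqrt (\<gamma> * A) * (e * y powr (e - 1) * (1 / A)) * (sqrt (\<gamma> * A) * y powr ((\<gamma> + 1) / (2 * \<gamma>)))
        = (sqrt (\<gamma> * A) * sqrt (\<gamma> * A)) * (2 / (\<gamma> - 1) * e / A) * (y powr (e - 1) * y powr ((\<gamma> + 1) / (2 * \<gamma>)))"
      by simp
    also have "y powr (e - 1) * y powr ((\<gamma> + 1) / (2 * \<gamma>)) = 1"
      unfolding e1 using y by (simp add: powr_minus)
    also have "sqrt (\<gamma> * A) * sqrt (\<gamma> * A) = \<gamma> * A" using assms by simp
    also have "\<gamma> * A * (2 / (\<gamma> - 1) * e / A) * 1 = 1" using assms by (simp add: e_def field_simps)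
    finally have "2 / (\<gamma> - 1) * sqrt (\<gamma> * A) * (e * y powr (e - 1) * (1 / A)) * gas_speed \<gamma> A p = 1"
      unfolding gas_speed_def y_def[symmetric] .
    moreover have "gas_speed \<gamma> A p \<noteq> 0" using assms by (simp add: gas_speed_def)
    ultimately show ?thesis by (rule eq_divide_imp[rotated])
  qed
  ultimately show ?thesis by (simp add: riemann_w_def[abs_def] e_def)
qed

lemma gas_speed_pos: "1 < \<gamma> \<Longrightarrow> 0 < A \<Longrightarrow> 0 < p \<Longrightarrow> 0 < gas_speed \<gamma> A p"
  by (simp add: gas_speed_def)

lemma gas_speed_mono: "1 < \<gamma> \<Longrightarrow> 0 < A \<Longrightarrow> 0 < p \<Longrightarrow> p \<le> q \<Longrightarrow> gas_speed \<gamma> A p \<le> gas_speed \<gamma> A q"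
  unfolding gas_speed_def by (intro mult_left_mono powr_mono2 divide_right_mono) auto

text \<open>The coefficient \<open>k\<close> in \<open>c = k (s - r)^d\<close>:
  \<open>s - r = 2 w\<close> is \<open>4 / (\<gamma> - 1) * sqrt (\<gamma> * A)\<close> times a
  power of \<open>p / A\<close>, and this prefactor is divided out.\<close>

definition strip_coeff :: "real \<Rightarrow> real \<Rightarrow> real" where
  "strip_coeff \<gamma> A = sqrt (\<gamma> * A) * (4 / (\<gamma> - 1) * sqrt (\<gamma> * A)) powr (- ((\<gamma> + 1) / (\<gamma> - 1)))"

lemma gas_speed_eq_power_of_riemann_w:
  assumes "1 < \<gamma>" "0 < A" "0 < p"
  shows "strip_coeff \<gamma> A * (2 * riemann_w \<gamma> A p) powr ((\<gamma> + 1) / (\<gamma> - 1)) = gas_speed \<gamma> A p"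
proof -
  define M where "M = 4 / (\<gamma> - 1) * sqrt (\<gamma> * A)"
  define d where "d = (\<gamma> + 1) / (\<gamma> - 1)"
  have M: "0 < M" using assms by (simp add: M_def)
  have "2 * riemann_w \<gamma> A p = M * (p / A) powr ((\<gamma> - 1) / (2 * \<gamma>))"
    by (simp add: riemann_w_def M_def)
  then have "(2 * riemann_w \<gamma> A p) powr d = M powr d * (p / A) powr ((\<gamma> - 1) / (2 * \<gamma>) * d)"
    using M assms by (simp add: powr_mult powr_powr)
  also have "(\<gamma> - 1) / (2 * \<gamma>) * d = (\<gamma> + 1) / (2 * \<gamma>)" using assms by (simp add: d_def)
  finally show ?thesis
    unfolding strip_coeff_def gas_speed_def M_def[symmetric] d_def[symmetric]
    using M by (simp add: powr_minus)
qed

text \<open>The system with \<open>\<tau>\<close> eliminated, valid up to the boundary of the strip.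
  Continuity of \<open>ut\<close> is what permits differentiating the momentum of an interval under
  the integral.\<close>

locale strip_solution =
  fixes \<gamma> A :: real and J :: "real set" and u p ux ut px pt :: "real \<times> real \<Rightarrow> real"
  assumes A_pos: "0 < A"
    and cont_ux: "continuous_on (J \<times> {0..}) ux"
    and cont_ut: "continuous_on (J \<times> {0..}) ut"
    and cont_px: "continuous_on (J \<times> {0..}) px"
    and p_pos: "\<And>q. q \<in> J \<times> {0..} \<Longrightarrow> 0 < p q"
    and u_deriv: "\<And>q. q \<in> J \<times> {0..} \<Longrightarrow>
      (u has_derivative (\<lambda>h. ux q * fst h + ut q * snd h)) (at q within J \<times> {0..})"
    and p_deriv: "\<And>q. q \<in> J \<times> {0..} \<Longrightarrow>
      (p has_derivative (\<lambda>h. px q * fst h + pt q * snd h)) (at q within J \<times> {0..})"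
    and ut_eq: "\<And>q. q \<in> J \<times> {0..} \<Longrightarrow> ut q = - px q"
    and pt_eq: "\<And>q. q \<in> J \<times> {0..} \<Longrightarrow> pt q = - (gas_speed \<gamma> A (p q))\<^sup>2 * ux q"

definition isentropic_strip ::
  "real \<Rightarrow> real \<Rightarrow> real set \<Rightarrow> (real \<times> real \<Rightarrow> real) \<Rightarrow> (real \<times> real \<Rightarrow> real) \<Rightarrow> bool" where
  "isentropic_strip \<gamma> A J u p \<longleftrightarrow> (\<exists>ux ut px pt. strip_solution \<gamma> A J u p ux ut px pt)"

lemma isentropic_strip_pos:
  assumes "isentropic_strip \<gamma> A J u p" shows "0 < A" "x \<in> J \<Longrightarrow> 0 \<le> t \<Longrightarrow> 0 < p (x, t)"
  using assms by (auto simp: isentropic_strip_def strip_solution_def)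

lemma isentropic_strip_subset:
  assumes strip: "isentropic_strip \<gamma> A J u p" and sub: "J' \<subseteq> J"
  shows "isentropic_strip \<gamma> A J' u p"
proof -
  obtain ux ut px pt where "strip_solution \<gamma> A J u p ux ut px pt"
    using strip unfolding isentropic_strip_def by blast
  then interpret strip_solution \<gamma> A J u p ux ut px pt .
  have sub': "J' \<times> ({0..} :: real set) \<subseteq> J \<times> {0..}" using sub by auto
  have "strip_solution \<gamma> A J' u p ux ut px pt"
  proof
    show "continuous_on (J' \<times> {0..}) ux" "continuous_on (J' \<times> {0..}) ut" "continuous_on (J' \<times> {0..}) px"
      by (rule continuous_on_subset[OF _ sub'], fact cont_ux cont_ut cont_px)+
    fix q assume "q \<in> J' \<times> ({0..} :: real set)"
    then have q: "q \<in> J \<times> {0..}" using sub' by blast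
    show "(u has_derivative (\<lambda>h. ux q * fst h + ut q * snd h)) (at q within J' \<times> {0..})"
      "(p has_derivative (\<lambda>h. px q * fst h + pt q * snd h)) (at q within J' \<times> {0..})"
      by (rule has_derivative_subset[OF _ sub'], fact u_deriv[OF q] p_deriv[OF q])+
    show "0 < p q" "ut q = - px q" "pt q = - (gas_speed \<gamma> A (p q))\<^sup>2 * ux q"
      by (fact p_pos[OF q] ut_eq[OF q] pt_eq[OF q])+
  qed (rule A_pos)
  then show ?thesis unfolding isentropic_strip_def by blast
qed

text \<open>\<open>A\<close> is a parameter because at an interface the same \<open>u\<close> and
  \<open>p\<close> are combined with the entropies of both adjacent strips.\<close>

definition inv_s :: "real \<Rightarrow> real \<Rightarrow> (real \<times> real \<Rightarrow> real) \<Rightarrow> (real \<times> real \<Rightarrow> real) \<Rightarrow> real \<times> real \<Rightarrow> real" where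
  "inv_s \<gamma> A u p q = u q + riemann_w \<gamma> A (p q)"

definition inv_r :: "real \<Rightarrow> real \<Rightarrow> (real \<times> real \<Rightarrow> real) \<Rightarrow> (real \<times> real \<Rightarrow> real) \<Rightarrow> real \<times> real \<Rightarrow> real" where
  "inv_r \<gamma> A u p q = u q - riemann_w \<gamma> A (p q)"

text \<open>Since \<open>dw / dp = 1 / c\<close>, adding to and subtracting from the equation for
  \<open>u\<close> the equation for \<open>p\<close> divided by \<open>c\<close> diagonalises the
  system. The \<open>x\<close>-derivatives of the two invariants are \<open>\<alpha>\<close> and
  \<open>\<beta>\<close>.\<close>

lemma isentropic_strip_riemann:
  assumes \<gamma>: "1 < \<gamma>" and strip: "isentropic_strip \<gamma> A J u p"
  obtains sx st rx rt where
    "riemann_strip J (strip_coeff \<gamma> A) ((\<gamma> + 1) / (\<gamma> - 1)) (inv_s \<gamma> A u p) (inv_r \<gamma> A u p) sx st rx rt"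
proof -
  obtain ux ut px pt where "strip_solution \<gamma> A J u p ux ut px pt"
    using strip unfolding isentropic_strip_def by blast
  then interpret strip_solution \<gamma> A J u p ux ut px pt .
  define c where "c = (\<lambda>q. gas_speed \<gamma> A (p q))"
  have c: "0 < c q" if "q \<in> J \<times> {0..}" for q
    using p_pos[OF that] gas_speed_pos[OF \<gamma> A_pos] by (simp add: c_def)
  have W: "((\<lambda>q. riemann_w \<gamma> A (p q)) has_derivative (\<lambda>h. (px q * fst h + pt q * snd h) * (1 / c q))) (at q within J \<times> {0..})"
    if q: "q \<in> J \<times> {0..}" for q
    unfolding c_def by (intro DERIV_compose_FDERIV[OF DERIV_riemann_w[OF \<gamma> A_pos]] p_pos p_deriv q)
  have contp: "continuous_on (J \<times> {0..}) p"
    using p_deriv by (rule has_derivative_continuous_on)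
  then have contc: "continuous_on (J \<times> {0..}) c"
    unfolding c_def gas_speed_def using p_pos A_pos
    by (intro continuous_intros) force+
  have speed: "strip_coeff \<gamma> A * (inv_s \<gamma> A u p q - inv_r \<gamma> A u p q) powr ((\<gamma> + 1) / (\<gamma> - 1)) = c q"
    if "q \<in> J \<times> {0..}" for q
    using gas_speed_eq_power_of_riemann_w[OF \<gamma> A_pos, of "p q"] p_pos[OF that] by (simp add: inv_s_def inv_r_def c_def)
  have "riemann_strip J (strip_coeff \<gamma> A) ((\<gamma> + 1) / (\<gamma> - 1)) (inv_s \<gamma> A u p) (inv_r \<gamma> A u p)
      (\<lambda>q. ux q + px q / c q) (\<lambda>q. ut q + pt q / c q) (\<lambda>q. ux q - px q / c q) (\<lambda>q. ut q - pt q / c q)"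
  proof
    show "0 < strip_coeff \<gamma> A" "0 < (\<gamma> + 1) / (\<gamma> - 1)" using \<gamma> A_pos by (auto simp: strip_coeff_def)
    show "continuous_on (J \<times> {0..}) (\<lambda>q. ux q + px q / c q)" "continuous_on (J \<times> {0..}) (\<lambda>q. ux q - px q / c q)"
      using c by (intro continuous_intros cont_ux cont_px contc; force)+
    fix q assume q: "q \<in> J \<times> ({0..} :: real set)"
    show "(inv_s \<gamma> A u p has_derivative (\<lambda>h. (ux q + px q / c q) * fst h + (ut q + pt q / c q) * snd h)) (at q within J \<times> {0..})"
      unfolding inv_s_def[abs_def]
      by (rule has_derivative_eq_rhs[OF has_derivative_add[OF u_deriv[OF q] W[OF q]]]) (auto simp: algebra_simps)
    show "(inv_r \<gamma> A u p has_derivative (\<lambda>h. (ux q - px q / c q) * fst h + (ut q - pt q / c q) * snd h)) (at q within J \<times> {0..})"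
      unfolding inv_r_def[abs_def]
      by (rule has_derivative_eq_rhs[OF has_derivative_diff[OF u_deriv[OF q] W[OF q]]]) (auto simp: algebra_simps)
    show "inv_r \<gamma> A u p q < inv_s \<gamma> A u p q"
      using riemann_w_pos[OF \<gamma> A_pos p_pos[OF q]] by (simp add: inv_r_def inv_s_def)
    have q_eq: "pt q / c q = - c q * ux q" "ut q = - px q"
      using ut_eq[OF q] pt_eq[OF q] c[OF q] by (auto simp: c_def power2_eq_square)
    show "ut q + pt q / c q = - (strip_coeff \<gamma> A * (inv_s \<gamma> A u p q - inv_r \<gamma> A u p q) powr ((\<gamma> + 1) / (\<gamma> - 1))) * (ux q + px q / c q)"
      unfolding speed[OF q] q_eq using c[OF q] by (simp add: algebra_simps)
    show "ut q - pt q / c q = (strip_coeff \<gamma> A * (inv_s \<gamma> A u p q - inv_r \<gamma> A u p q) powr ((\<gamma> + 1) / (\<gamma> - 1))) * (ux q - px q / c q)"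
      unfolding speed[OF q] q_eq using c[OF q] by (simp add: algebra_simps)
  qed
  then show thesis by (rule that)
qed

section \<open>Behaviour of \<open>u\<close> and \<open>p\<close> on a single strip\<close>

lemma left_strip:
  assumes \<gamma>: "1 < \<gamma>" and strip: "isentropic_strip \<gamma> A {..b} u p"
    and init: "\<And>x. x \<le> b \<Longrightarrow> u (x, 0) = uL \<and> p (x, 0) = pL"
  shows "0 \<le> t \<Longrightarrow> u (b, t) + riemann_w \<gamma> A (p (b, t)) = uL + riemann_w \<gamma> A pL"
    and "0 \<le> t \<Longrightarrow> t \<le> t' \<Longrightarrow> inv_r \<gamma> A u p (b, t) \<le> inv_r \<gamma> A u p (b, t')"
proof -
  obtain sx st rx rt where
    "riemann_strip {..b} (strip_coeff \<gamma> A) ((\<gamma> + 1) / (\<gamma> - 1)) (inv_s \<gamma> A u p) (inv_r \<gamma> A u p) sx st rx rt"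
    using isentropic_strip_riemann[OF \<gamma> strip] .
  then interpret riemann_strip "{..b}" "strip_coeff \<gamma> A" "(\<gamma> + 1) / (\<gamma> - 1)" "inv_s \<gamma> A u p" "inv_r \<gamma> A u p" sx st rx rt .
  have A: "0 < A" and pL: "0 < pL"
    using isentropic_strip_pos(1)[OF strip] isentropic_strip_pos(2)[OF strip, of b 0] init[of b] by auto
  have s: "inv_s \<gamma> A u p (x, t) = uL + riemann_w \<gamma> A pL" if "x \<le> b" "0 \<le> t" for x t
    using that init riemann_w_pos[OF \<gamma> A pL]
    by (intro incoming_invariant_constant[where rL = "uL - riemann_w \<gamma> A pL"]) (auto simp: inv_s_def inv_r_def)
  show "0 \<le> t \<Longrightarrow> u (b, t) + riemann_w \<gamma> A (p (b, t)) = uL + riemann_w \<gamma> A pL"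
    using s[of b t] by (simp add: inv_s_def)
  show "0 \<le> t \<Longrightarrow> t \<le> t' \<Longrightarrow> inv_r \<gamma> A u p (b, t) \<le> inv_r \<gamma> A u p (b, t')"
    by (rule outgoing_invariant_mono_left_strip[OF refl, where sL = "uL + riemann_w \<gamma> A pL"]) (use s in auto)
qed

text \<open>The map \<open>x \<mapsto> - x\<close>, \<open>u \<mapsto> - u\<close> preserves the
  system and exchanges \<open>s\<close> with \<open>- r\<close>, so the rightmost strip is reduced
  to the leftmost one.\<close>

lemma isentropic_strip_reflect:
  assumes "isentropic_strip \<gamma> A J u p"
  shows "isentropic_strip \<gamma> A (uminus ` J) (\<lambda>q. - u (- fst q, snd q)) (\<lambda>q. p (- fst q, snd q))"
proof -
  obtain ux ut px pt where "strip_solution \<gamma> A J u p ux ut px pt"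
    using assms unfolding isentropic_strip_def by blast
  then interpret strip_solution \<gamma> A J u p ux ut px pt .
  define \<phi> where "\<phi> = (\<lambda>q::real \<times> real. (- fst q, snd q))"
  have \<phi>J: "\<phi> q \<in> J \<times> {0..}" if "q \<in> uminus ` J \<times> {0..}" for q using that by (auto simp: \<phi>_def)
  have cont\<phi>: "continuous_on X \<phi>" for X unfolding \<phi>_def by (intro continuous_intros)
  have cont: "continuous_on (uminus ` J \<times> {0..}) (\<lambda>q. f (\<phi> q))" if "continuous_on (J \<times> {0..}) f" for f :: "real \<times> real \<Rightarrow> real"
    by (rule continuous_on_compose2[OF that cont\<phi>]) (use \<phi>J in blast)
  have deriv: "((\<lambda>q. f (\<phi> q)) has_derivative (\<lambda>h. - fx (\<phi> q) * fst h + ft (\<phi> q) * snd h)) (at q within uminus ` J \<times> {0..})"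
    if "(f has_derivative (\<lambda>h. fx (\<phi> q) * fst h + ft (\<phi> q) * snd h)) (at (\<phi> q) within J \<times> {0..})"
    for f fx ft :: "real \<times> real \<Rightarrow> real" and q
  proof -
    have "(\<phi> has_derivative (\<lambda>h. (- fst h, snd h))) (at q within uminus ` J \<times> {0..})"
      unfolding \<phi>_def by (auto intro!: derivative_eq_intros)
    from has_derivative_in_compose[OF this has_derivative_subset[OF that]] \<phi>J
    have "((\<lambda>q. f (\<phi> q)) has_derivative (\<lambda>h. fx (\<phi> q) * fst (- fst h, snd h) + ft (\<phi> q) * snd (- fst h, snd h))) (at q within uminus ` J \<times> {0..})"
      by blast
    then show ?thesis by simp
  qed
  have "strip_solution \<gamma> A (uminus ` J) (\<lambda>q. - u (\<phi> q)) (\<lambda>q. p (\<phi> q))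
      (\<lambda>q. ux (\<phi> q)) (\<lambda>q. - ut (\<phi> q)) (\<lambda>q. - px (\<phi> q)) (\<lambda>q. pt (\<phi> q))"
  proof
    show "continuous_on (uminus ` J \<times> {0..}) (\<lambda>q. ux (\<phi> q))" "continuous_on (uminus ` J \<times> {0..}) (\<lambda>q. - ut (\<phi> q))"
      "continuous_on (uminus ` J \<times> {0..}) (\<lambda>q. - px (\<phi> q))"
      by (intro continuous_on_minus cont cont_ux cont_ut cont_px)+
    fix q assume "q \<in> uminus ` J \<times> ({0..} :: real set)"
    note q = \<phi>J[OF this]
    show "((\<lambda>q. - u (\<phi> q)) has_derivative (\<lambda>h. ux (\<phi> q) * fst h + - ut (\<phi> q) * snd h)) (at q within uminus ` J \<times> {0..})"
      using has_derivative_minus[OF deriv[of u ux q ut, OF u_deriv[OF q]]] by simp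
    show "((\<lambda>q. p (\<phi> q)) has_derivative (\<lambda>h. - px (\<phi> q) * fst h + pt (\<phi> q) * snd h)) (at q within uminus ` J \<times> {0..})"
      by (rule deriv[of p px q pt, OF p_deriv[OF q]])
    show "0 < p (\<phi> q)" "- ut (\<phi> q) = - (- px (\<phi> q))" "pt (\<phi> q) = - (gas_speed \<gamma> A (p (\<phi> q)))\<^sup>2 * ux (\<phi> q)"
      using p_pos[OF q] ut_eq[OF q] pt_eq[OF q] by simp_all
  qed (rule A_pos)
  then have "isentropic_strip \<gamma> A (uminus ` J) (\<lambda>q. - u (\<phi> q)) (\<lambda>q. p (\<phi> q))"
    unfolding isentropic_strip_def by blast
  then show ?thesis by (simp add: \<phi>_def)
qed

lemma right_strip:
  assumes \<gamma>: "1 < \<gamma>" and strip: "isentropic_strip \<gamma> A {b..} u p"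
    and init: "\<And>x. b \<le> x \<Longrightarrow> u (x, 0) = uR \<and> p (x, 0) = pR" and t: "0 \<le> t"
  shows "u (b, t) - riemann_w \<gamma> A (p (b, t)) = uR - riemann_w \<gamma> A pR"
proof -
  have strip': "isentropic_strip \<gamma> A {..- b} (\<lambda>q. - u (- fst q, snd q)) (\<lambda>q. p (- fst q, snd q))"
    using isentropic_strip_reflect[OF strip] by simp
  show ?thesis using left_strip(1)[OF \<gamma> strip', of "- uR" pR t] init t by simp
qed

text \<open>The passage through one strip: monotonicity in time at the left end yields monotonicity
  in \<open>x\<close> first of \<open>s\<close>, then of \<open>r\<close>, and from these
  monotonicity in time at every point, in particular at the right end.\<close>

lemma bounded_strip:
  assumes \<gamma>: "1 < \<gamma>" and strip: "isentropic_strip \<gamma> A {a..b} u p" and ab: "a < b"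
    and s_left: "\<And>t t'. 0 \<le> t \<Longrightarrow> t \<le> t' \<Longrightarrow> inv_s \<gamma> A u p (a, t') \<le> inv_s \<gamma> A u p (a, t)"
    and r_left: "\<And>t t'. 0 \<le> t \<Longrightarrow> t \<le> t' \<Longrightarrow> inv_r \<gamma> A u p (a, t) \<le> inv_r \<gamma> A u p (a, t')"
    and init: "\<And>x y. a \<le> x \<Longrightarrow> x \<le> y \<Longrightarrow> y \<le> b \<Longrightarrow> inv_s \<gamma> A u p (x, 0) \<le> inv_s \<gamma> A u p (y, 0)"
  shows "a \<le> x \<Longrightarrow> x \<le> y \<Longrightarrow> y \<le> b \<Longrightarrow> 0 \<le> t \<Longrightarrow> inv_s \<gamma> A u p (x, t) \<le> inv_s \<gamma> A u p (y, t)"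
    and "a \<le> x \<Longrightarrow> x \<le> y \<Longrightarrow> y \<le> b \<Longrightarrow> 0 \<le> t \<Longrightarrow> inv_r \<gamma> A u p (x, t) \<le> inv_r \<gamma> A u p (y, t)"
    and "x \<in> {a..b} \<Longrightarrow> 0 \<le> t \<Longrightarrow> t \<le> t' \<Longrightarrow> inv_s \<gamma> A u p (x, t') \<le> inv_s \<gamma> A u p (x, t)"
    and "x \<in> {a..b} \<Longrightarrow> 0 \<le> t \<Longrightarrow> t \<le> t' \<Longrightarrow> inv_r \<gamma> A u p (x, t) \<le> inv_r \<gamma> A u p (x, t')"
proof -
  obtain sx st rx rt where
    "riemann_strip {a..b} (strip_coeff \<gamma> A) ((\<gamma> + 1) / (\<gamma> - 1)) (inv_s \<gamma> A u p) (inv_r \<gamma> A u p) sx st rx rt"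
    using isentropic_strip_riemann[OF \<gamma> strip] .
  then interpret riemann_strip "{a..b}" "strip_coeff \<gamma> A" "(\<gamma> + 1) / (\<gamma> - 1)" "inv_s \<gamma> A u p" "inv_r \<gamma> A u p" sx st rx rt .
  note s = s_mono[OF order_refl init s_left]
  note r = r_mono[OF order_refl s r_left]
  show "a \<le> x \<Longrightarrow> x \<le> y \<Longrightarrow> y \<le> b \<Longrightarrow> 0 \<le> t \<Longrightarrow> inv_s \<gamma> A u p (x, t) \<le> inv_s \<gamma> A u p (y, t)"
    by (rule s)
  show "a \<le> x \<Longrightarrow> x \<le> y \<Longrightarrow> y \<le> b \<Longrightarrow> 0 \<le> t \<Longrightarrow> inv_r \<gamma> A u p (x, t) \<le> inv_r \<gamma> A u p (y, t)"
    by (rule r)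
  show "x \<in> {a..b} \<Longrightarrow> 0 \<le> t \<Longrightarrow> t \<le> t' \<Longrightarrow> inv_s \<gamma> A u p (x, t') \<le> inv_s \<gamma> A u p (x, t)"
    by (rule s_antimono_time[OF order_refl ab _ _ _ s])
  show "x \<in> {a..b} \<Longrightarrow> 0 \<le> t \<Longrightarrow> t \<le> t' \<Longrightarrow> inv_r \<gamma> A u p (x, t) \<le> inv_r \<gamma> A u p (x, t')"
    by (rule r_mono_time[OF order_refl ab _ _ _ r])
qed

lemma trapped_or_outflow:
  assumes \<gamma>: "1 < \<gamma>" and strip: "isentropic_strip \<gamma> A {a..b} u p" and ab: "a \<le> b" and T: "0 \<le> T"
    and right: "\<And>t. T \<le> t \<Longrightarrow> \<rho> \<le> inv_r \<gamma> A u p (b, t)"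
  shows "(\<exists>Y. \<forall>t\<ge>T. a < Y t \<and> Y t \<le> b \<and>
            (Y has_real_derivative - gas_speed \<gamma> A (p (Y t, t))) (at t within {T..})) \<or>
         (\<exists>T1\<ge>T. \<forall>t\<ge>T1. \<rho> \<le> inv_r \<gamma> A u p (a, t))"
proof -
  obtain sx st rx rt where
    "riemann_strip {a..b} (strip_coeff \<gamma> A) ((\<gamma> + 1) / (\<gamma> - 1)) (inv_s \<gamma> A u p) (inv_r \<gamma> A u p) sx st rx rt"
    using isentropic_strip_riemann[OF \<gamma> strip] .
  then interpret riemann_strip "{a..b}" "strip_coeff \<gamma> A" "(\<gamma> + 1) / (\<gamma> - 1)" "inv_s \<gamma> A u p" "inv_r \<gamma> A u p" sx st rx rt .
  have speed: "c (x, t) = gas_speed \<gamma> A (p (x, t))" if "x \<in> {a..b}" "0 \<le> t" for x t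
    using gas_speed_eq_power_of_riemann_w[OF \<gamma>, of A "p (x, t)"] isentropic_strip_pos[OF strip] that
    by (simp add: c_def inv_s_def inv_r_def)
  have "(\<exists>Y. Y T = b \<and> (\<forall>t\<ge>T. a < Y t \<and> Y t \<le> b \<and> (Y has_real_derivative - c (Y t, t)) (at t within {T..}))) \<or>
      (\<exists>T1\<ge>T. \<forall>t\<ge>T1. \<rho> \<le> inv_r \<gamma> A u p (a, t))"
    by (rule trapped_curve_or_outflow_bound[OF order_refl ab T]) (rule right)
  then show ?thesis
  proof (elim disjE exE conjE)
    fix Y assume Y: "\<forall>t\<ge>T. a < Y t \<and> Y t \<le> b \<and> (Y has_real_derivative - c (Y t, t)) (at t within {T..})"
    have "a < Y t \<and> Y t \<le> b \<and> (Y has_real_derivative - gas_speed \<gamma> A (p (Y t, t))) (at t within {T..})"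
      if t: "T \<le> t" for t
    proof -
      have Y': "a < Y t" "Y t \<le> b" "(Y has_real_derivative - c (Y t, t)) (at t within {T..})" using Y t by auto
      moreover have "c (Y t, t) = gas_speed \<gamma> A (p (Y t, t))" using speed[of "Y t" t] Y' t T by simp
      ultimately show ?thesis by simp
    qed
    then show ?thesis by blast
  qed blast
qed

text \<open>The integral of \<open>u\<close> over \<open>[a, b]\<close> has time derivative
  \<open>p (a, t) - p (b, t)\<close>. It stays bounded, so this derivative cannot tend to a nonzero
  limit.\<close>

lemma momentum_limits_agree:
  assumes strip: "isentropic_strip \<gamma> A {a..b} u p" and ab: "a < b"
    and bound: "\<And>x t. x \<in> {a..b} \<Longrightarrow> 0 \<le> t \<Longrightarrow> \<bar>u (x, t)\<bar> \<le> U"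
    and Pa: "((\<lambda>t. p (a, t)) \<longlongrightarrow> Pa) at_top" and Pb: "((\<lambda>t. p (b, t)) \<longlongrightarrow> Pb) at_top"
  shows "Pa = Pb"
proof (rule ccontr)
  assume ne: "Pa \<noteq> Pb"
  let ?J = "{a..b}"
  obtain ux ut px pt where "strip_solution \<gamma> A {a..b} u p ux ut px pt"
    using strip unfolding isentropic_strip_def by blast
  then interpret strip_solution \<gamma> A "{a..b}" u p ux ut px pt .
  have contu: "continuous_on (?J \<times> {0..}) u"
    using u_deriv by (rule has_derivative_continuous_on)
  define \<phi> where "\<phi> = (\<lambda>t. integral (cbox a b) (\<lambda>x. u (x, t)))"
  have sec: "continuous_on ?J (\<lambda>x. u (x, t))" if "0 \<le> t" for t
    by (rule continuous_on_compose2[OF contu]) (use that in \<open>auto intro!: continuous_intros\<close>)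
  have d\<phi>: "(\<phi> has_real_derivative (p (a, t) - p (b, t))) (at t within {0..})" if t: "0 \<le> t" for t
  proof -
    have "((\<lambda>t. integral (cbox a b) (\<lambda>x. u (x, t))) has_real_derivative integral (cbox a b) (\<lambda>x. ut (x, t))) (at t within {0..})"
    proof (rule leibniz_rule_field_derivative[where f = "\<lambda>t x. u (x, t)" and fx = "\<lambda>t x. ut (x, t)"])
      show "((\<lambda>t. u (x, t)) has_real_derivative ut (x, t)) (at t within {0..})" if "t \<in> {0..}" "x \<in> cbox a b" for t x
        using derivative_along_curve[of u "ux (x, t)" "ut (x, t)" "\<lambda>_. x" t "\<lambda>t. t" "?J \<times> {0..}" 0 "{0..}" 1]
          u_deriv[of "(x, t)"] that by (auto intro!: derivative_eq_intros)
      show "(\<lambda>x. u (x, t)) integrable_on cbox a b" if "t \<in> {0..}" for t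
        using that by (auto intro!: integrable_continuous_real sec)
      have "continuous_on ({0..} \<times> cbox a b) (\<lambda>q. ut (snd q, fst q))"
        by (rule continuous_on_compose2[OF cont_ut]) (auto intro!: continuous_intros)
      then show "continuous_on ({0..} \<times> cbox a b) (\<lambda>(t, x). ut (x, t))" by (simp add: case_prod_beta')
    qed (use t in auto)
    moreover have ut_int: "integral {a..b} (\<lambda>x. ut (x, t)) = integral {a..b} (\<lambda>x. - px (x, t))"
      using ut_eq t by (intro integral_cong) auto
    have "((\<lambda>x. - px (x, t)) has_integral (- p (b, t) - (- p (a, t)))) {a..b}"
    proof (rule fundamental_theorem_of_calculus)
      fix x assume "x \<in> {a..b}"
      then show "((\<lambda>x. - p (x, t)) has_vector_derivative - px (x, t)) (at x within {a..b})"
        using derivative_along_curve[of p "px (x, t)" "pt (x, t)" "\<lambda>x. x" x "\<lambda>_. t" "?J \<times> {0..}" 1 "{a..b}" 0]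
          p_deriv[of "(x, t)"] t
        by (auto intro!: DERIV_minus derivative_eq_intros simp flip: has_real_derivative_iff_has_vector_derivative)
    qed (use ab in simp)
    then have "integral {a..b} (\<lambda>x. ut (x, t)) = p (a, t) - p (b, t)"
      unfolding ut_int by (subst integral_unique) auto
    ultimately show ?thesis unfolding \<phi>_def cbox_interval by simp
  qed
  have b\<phi>: "\<bar>\<phi> t\<bar> \<le> U * (b - a)" if "0 \<le> t" for t
    using integral_bound[of a b "\<lambda>x. u (x, t)" U] sec[OF that] bound that ab by (simp add: \<phi>_def)
  define \<sigma> where "\<sigma> = sgn (Pa - Pb)"
  define \<eta> where "\<eta> = \<bar>Pa - Pb\<bar> / 2"
  have \<eta>: "0 < \<eta>" using ne by (simp add: \<eta>_def)
  have \<sigma>: "\<bar>\<sigma>\<bar> = 1" "\<sigma> * (Pa - Pb) = 2 * \<eta>" using ne by (auto simp: \<sigma>_def \<eta>_def sgn_if)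
  have "((\<lambda>t. \<sigma> * (p (a, t) - p (b, t))) \<longlongrightarrow> 2 * \<eta>) at_top"
    unfolding \<sigma>(2)[symmetric] by (intro tendsto_intros Pa Pb)
  then have "\<forall>\<^sub>F t in at_top. \<eta> < \<sigma> * (p (a, t) - p (b, t))" using \<eta> by (intro order_tendstoD) auto
  then obtain T where T: "\<And>t. T \<le> t \<Longrightarrow> \<eta> < \<sigma> * (p (a, t) - p (b, t))" by (auto simp: eventually_at_top_linorder)
  define T0 where "T0 = max T 0"
  \<comment> \<open>In this time growth at rate \<open>\<eta>\<close> exceeds
    \<open>2 * (\<bar>U\<bar> * (b - a))\<close>, the largest possible change of
    \<open>\<phi>\<close>.\<close>
  define T1 where "T1 = T0 + 2 * (\<bar>U\<bar> * (b - a)) / \<eta> + 1"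
  have "0 \<le> 2 * (\<bar>U\<bar> * (b - a)) / \<eta>" using \<eta> ab by simp
  then have T01: "T0 \<le> T1" "0 \<le> T0" unfolding T0_def T1_def by linarith+
  have "\<eta> * (T1 - T0) \<le> \<sigma> * \<phi> T1 - \<sigma> * \<phi> T0"
  proof (rule real_derivative_within_lower_bound[where f = "\<lambda>t. \<sigma> * \<phi> t", OF T01(1)])
    show "((\<lambda>t. \<sigma> * \<phi> t) has_real_derivative \<sigma> * (p (a, t) - p (b, t))) (at t within {T0..T1})" if "t \<in> {T0..T1}" for t
      using that T01 by (intro DERIV_cmult DERIV_subset[OF d\<phi>]) auto
    show "\<eta> \<le> \<sigma> * (p (a, t) - p (b, t))" if "T0 < t" for t
      using T[of t] that by (auto simp: T0_def)
  qed
  moreover have "\<sigma> * \<phi> T1 - \<sigma> * \<phi> T0 \<le> \<bar>\<phi> T1\<bar> + \<bar>\<phi> T0\<bar>"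
    using \<sigma>(1) by (auto simp: abs_if split: if_splits)
  moreover have "\<bar>\<phi> T1\<bar> + \<bar>\<phi> T0\<bar> \<le> 2 * (\<bar>U\<bar> * (b - a))"
  proof -
    have "U * (b - a) \<le> \<bar>U\<bar> * (b - a)" using ab by (intro mult_right_mono) auto
    then show ?thesis using b\<phi>[of T0] b\<phi>[of T1] T01 by simp
  qed
  moreover have "\<eta> * (T1 - T0) = 2 * (\<bar>U\<bar> * (b - a)) + \<eta>" using \<eta> by (simp add: T1_def field_simps)
  ultimately show False using \<eta> by linarith
qed

section \<open>Piecewise constant entropy\<close>

text \<open>Interface \<open>x i\<close> separates strip \<open>i\<close> from strip
  \<open>Suc i\<close>, so \<open>N + 1\<close> interfaces bound \<open>N + 2\<close> strips; strips
  \<open>0\<close> and \<open>Suc N\<close> are unbounded and start from constant data. Adjacent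
  strips may have equal entropy, so an interface need not be a jump.\<close>

locale layered_gas =
  fixes \<gamma> :: real and A x :: "nat \<Rightarrow> real" and N :: nat and u p :: "real \<times> real \<Rightarrow> real" and uL pL uR pR :: real
  assumes \<gamma>: "1 < \<gamma>"
    and A_mono: "\<And>i. i \<le> N \<Longrightarrow> A i \<le> A (Suc i)"
    and x_less: "\<And>i. i < N \<Longrightarrow> x i < x (Suc i)"
    and left: "isentropic_strip \<gamma> (A 0) {..x 0} u p"
    and middle: "\<And>i. i < N \<Longrightarrow> isentropic_strip \<gamma> (A (Suc i)) {x i..x (Suc i)} u p"
    and right: "isentropic_strip \<gamma> (A (Suc N)) {x N..} u p"
    and init_left: "\<And>y. y \<le> x 0 \<Longrightarrow> u (y, 0) = uL \<and> p (y, 0) = pL"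
    and init_right: "\<And>y. x N \<le> y \<Longrightarrow> u (y, 0) = uR \<and> p (y, 0) = pR"
begin

lemma A_pos: "i \<le> Suc N \<Longrightarrow> 0 < A i"
proof (induction i)
  case 0
  then show ?case using isentropic_strip_pos(1)[OF left] by simp
next
  case (Suc i)
  then show ?case using A_mono[of i] by simp
qed

lemma p_pos:
  assumes "i \<le> N" "0 \<le> t"
  shows "0 < p (x i, t)"
  using assms isentropic_strip_pos(2)[OF left, of "x 0" t] isentropic_strip_pos(2)[OF middle, of "i - 1" "x i" t]
    x_less[of "i - 1"]
  by (cases i) auto

lemma left_boundary:
  "0 \<le> t \<Longrightarrow> u (x 0, t) + riemann_w \<gamma> (A 0) (p (x 0, t)) = uL + riemann_w \<gamma> (A 0) pL"
  using left_strip(1)[OF \<gamma> left init_left] .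

lemma right_boundary:
  "0 \<le> t \<Longrightarrow> u (x N, t) - riemann_w \<gamma> (A (Suc N)) (p (x N, t)) = uR - riemann_w \<gamma> (A (Suc N)) pR"
  using right_strip[OF \<gamma> right init_right] .

text \<open>Passing to the larger entropy \<open>A (Suc i)\<close> only increases the coefficient of the pressure term, hence keeps
  the monotonicity in time of both invariants.\<close>

lemma invariants_across_interface:
  assumes i: "i \<le> N" and t: "0 \<le> t" "t \<le> t'"
    and s: "inv_s \<gamma> (A i) u p (x i, t') \<le> inv_s \<gamma> (A i) u p (x i, t)"
    and r: "inv_r \<gamma> (A i) u p (x i, t) \<le> inv_r \<gamma> (A i) u p (x i, t')"
  shows "inv_s \<gamma> (A (Suc i)) u p (x i, t') \<le> inv_s \<gamma> (A (Suc i)) u p (x i, t)"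
    and "inv_r \<gamma> (A (Suc i)) u p (x i, t) \<le> inv_r \<gamma> (A (Suc i)) u p (x i, t')"
proof -
  have Ai: "0 < A i" using i by (intro A_pos) simp
  obtain \<kappa> where \<kappa>: "1 \<le> \<kappa>" "\<And>p. 0 < p \<Longrightarrow> riemann_w \<gamma> (A (Suc i)) p = \<kappa> * riemann_w \<gamma> (A i) p"
    using riemann_w_scale[OF \<gamma> Ai A_mono[OF i]] by metis
  define w where "w = riemann_w \<gamma> (A i) (p (x i, t))"
  define w' where "w' = riemann_w \<gamma> (A i) (p (x i, t'))"
  have eqs: "riemann_w \<gamma> (A (Suc i)) (p (x i, t)) = \<kappa> * w" "riemann_w \<gamma> (A (Suc i)) (p (x i, t')) = \<kappa> * w'"
    unfolding w_def w'_def using p_pos[OF i] t by (auto intro!: \<kappa>(2))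
  have "w' \<le> w" using s r by (simp add: inv_s_def inv_r_def w_def w'_def)
  then have "(\<kappa> - 1) * w' \<le> (\<kappa> - 1) * w" using \<kappa>(1) by (intro mult_left_mono) auto
  then show "inv_s \<gamma> (A (Suc i)) u p (x i, t') \<le> inv_s \<gamma> (A (Suc i)) u p (x i, t)"
    and "inv_r \<gamma> (A (Suc i)) u p (x i, t) \<le> inv_r \<gamma> (A (Suc i)) u p (x i, t')"
    using s r unfolding inv_s_def inv_r_def eqs w_def[symmetric] w'_def[symmetric] by (auto simp: algebra_simps)
qed

text \<open>The lower bound \<open>\<rho>\<close> for \<open>r\<close> is carried leftwards from the
  rightmost strip; each bounded strip either traps a curve or passes the bound on after some waiting
  time.\<close>

lemma trapped_curve:
  assumes le: "uL + riemann_w \<gamma> (A 0) pL \<le> uR - riemann_w \<gamma> (A (Suc N)) pR"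
  obtains i T Y where "i < N" "0 \<le> T"
    "\<And>t. T \<le> t \<Longrightarrow> x i < Y t \<and> Y t \<le> x (Suc i) \<and>
       (Y has_real_derivative - gas_speed \<gamma> (A (Suc i)) (p (Y t, t))) (at t within {T..})"
proof -
  define \<rho> where "\<rho> = uR - riemann_w \<gamma> (A (Suc N)) pR"
  \<comment> \<open>Leftwards across an interface the entropy does not increase, so \<open>w\<close>
    does not grow and \<open>r = u - w\<close> does not drop.\<close>
  have drop: "\<rho> \<le> inv_r \<gamma> (A i) u p (x i, t)" if i: "i \<le> N" and t: "0 \<le> t" and r: "\<rho> \<le> inv_r \<gamma> (A (Suc i)) u p (x i, t)" for i t
  proof -
    have Ai: "0 < A i" using i by (intro A_pos) simp
    obtain \<kappa> where \<kappa>: "1 \<le> \<kappa>" "\<And>p. 0 < p \<Longrightarrow> riemann_w \<gamma> (A (Suc i)) p = \<kappa> * riemann_w \<gamma> (A i) p"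
      using riemann_w_scale[OF \<gamma> Ai A_mono[OF i]] by metis
    have "riemann_w \<gamma> (A i) (p (x i, t)) \<le> riemann_w \<gamma> (A (Suc i)) (p (x i, t))"
      using \<kappa> p_pos[OF i t] riemann_w_pos[OF \<gamma> Ai, of "p (x i, t)"] by simp
    then show ?thesis using r by (simp add: inv_r_def)
  qed
  have "\<exists>i<N. \<exists>T\<ge>0. \<exists>Y. \<forall>t\<ge>T. x i < Y t \<and> Y t \<le> x (Suc i) \<and>
       (Y has_real_derivative - gas_speed \<gamma> (A (Suc i)) (p (Y t, t))) (at t within {T..})"
  proof (rule ccontr)
    assume none: "\<not> ?thesis"
    \<comment> \<open>\<open>j\<close> counts interfaces from the right; the bound refers to the
      right side of \<open>x (N - j)\<close>.\<close>
    have "\<exists>T\<ge>0. \<forall>t\<ge>T. \<rho> \<le> inv_r \<gamma> (A (Suc (N - j))) u p (x (N - j), t)" if "j \<le> N" for j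
      using that
    proof (induction j)
      case 0
      then show ?case using right_boundary by (intro exI[of _ 0]) (auto simp: \<rho>_def inv_r_def)
    next
      case (Suc j)
      define i where "i = N - Suc j"
      have i: "i < N" "N - j = Suc i" using Suc.prems by (auto simp: i_def)
      obtain T where T: "0 \<le> T" "\<And>t. T \<le> t \<Longrightarrow> \<rho> \<le> inv_r \<gamma> (A (Suc (Suc i))) u p (x (Suc i), t)"
        using Suc.IH Suc.prems i by auto
      have "\<rho> \<le> inv_r \<gamma> (A (Suc i)) u p (x (Suc i), t)" if "T \<le> t" for t
        using drop[of "Suc i" t] T that i by auto
      from trapped_or_outflow[OF \<gamma> middle[OF i(1)] less_imp_le[OF x_less[OF i(1)]] T(1) this] none i(1) T(1)
      obtain T1 where "T1 \<ge> T" "\<forall>t\<ge>T1. \<rho> \<le> inv_r \<gamma> (A (Suc i)) u p (x i, t)" by blast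
      then show ?case using T(1) i_def by (meson order_trans)
    qed
    from this[of N] obtain T where T: "0 \<le> T" "\<forall>t\<ge>T. \<rho> \<le> inv_r \<gamma> (A (Suc 0)) u p (x 0, t)" by auto
    \<comment> \<open>On the left side of \<open>x 0\<close> this means
      \<open>u + w \<le> \<rho> \<le> u - w\<close>, against \<open>w > 0\<close>.\<close>
    then have "\<rho> \<le> inv_r \<gamma> (A 0) u p (x 0, T)" using drop[of 0 T] by auto
    then show False
      using left_boundary[OF T(1)] le riemann_w_pos[OF \<gamma> A_pos[of 0] p_pos[of 0 T]] T(1)
      by (simp add: inv_r_def \<rho>_def)
  qed
  then show thesis using that by blast
qed

end

section \<open>Data without compression: monotonicity in space and time, and the limit of the
  pressure\<close>

locale rarefying_layered_gas = layered_gas +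
  assumes init_s: "\<And>i y y'. i < N \<Longrightarrow> x i \<le> y \<Longrightarrow> y \<le> y' \<Longrightarrow> y' \<le> x (Suc i) \<Longrightarrow>
      inv_s \<gamma> (A (Suc i)) u p (y, 0) \<le> inv_s \<gamma> (A (Suc i)) u p (y', 0)"
begin

text \<open>Induction from left to right, referring to the left side of \<open>x i\<close>. At
  \<open>x 0\<close> the invariant \<open>s\<close> is constant and \<open>r\<close> increases in
  time; the inductive step crosses an interface and then passes through a strip.\<close>

lemma interface_monotone:
  "i \<le> N \<Longrightarrow> 0 \<le> t \<Longrightarrow> t \<le> t' \<Longrightarrow>
     inv_s \<gamma> (A i) u p (x i, t') \<le> inv_s \<gamma> (A i) u p (x i, t) \<and>
     inv_r \<gamma> (A i) u p (x i, t) \<le> inv_r \<gamma> (A i) u p (x i, t')"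
proof (induction i arbitrary: t t')
  case 0
  then show ?case
    using left_strip[OF \<gamma> left init_left] by (auto simp: inv_s_def)
next
  case (Suc i)
  have i: "i < N" "i \<le> N" using Suc.prems by auto
  have s: "inv_s \<gamma> (A (Suc i)) u p (x i, t') \<le> inv_s \<gamma> (A (Suc i)) u p (x i, t)"
    and r: "inv_r \<gamma> (A (Suc i)) u p (x i, t) \<le> inv_r \<gamma> (A (Suc i)) u p (x i, t')" if "0 \<le> t" "t \<le> t'" for t t'
    using invariants_across_interface[OF i(2) that] Suc.IH[OF i(2) that] by auto
  note * = bounded_strip(3,4)[OF \<gamma> middle[OF i(1)] x_less[OF i(1)] s r init_s[OF i(1)]]
  show ?case using *[of "x (Suc i)" t t'] x_less[OF i(1)] Suc.prems by auto
qed

text \<open>\<open>u\<close> is half the sum of the invariants, both increasing in \<open>x\<close>.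
  Twice \<open>w\<close> is their difference, and in time \<open>s\<close> decreases while
  \<open>r\<close> increases; so \<open>w\<close> decreases and with it the pressure.\<close>

lemma strip_monotone:
  assumes i: "i < N"
  shows "x i \<le> y \<Longrightarrow> y \<le> y' \<Longrightarrow> y' \<le> x (Suc i) \<Longrightarrow> 0 \<le> t \<Longrightarrow> u (y, t) \<le> u (y', t)"
    and "y \<in> {x i..x (Suc i)} \<Longrightarrow> 0 \<le> t \<Longrightarrow> t \<le> t' \<Longrightarrow> p (y, t') \<le> p (y, t)"
proof -
  have i': "i \<le> N" using i by simp
  have s: "inv_s \<gamma> (A (Suc i)) u p (x i, t') \<le> inv_s \<gamma> (A (Suc i)) u p (x i, t)"
    and r: "inv_r \<gamma> (A (Suc i)) u p (x i, t) \<le> inv_r \<gamma> (A (Suc i)) u p (x i, t')" if "0 \<le> t" "t \<le> t'" for t t'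
    using invariants_across_interface[OF i' that] interface_monotone[OF i' that] by auto
  note strip = bounded_strip[OF \<gamma> middle[OF i] x_less[OF i] s r init_s[OF i]]
  show "u (y, t) \<le> u (y', t)" if y: "x i \<le> y" "y \<le> y'" "y' \<le> x (Suc i)" "0 \<le> t"
  proof -
    have "inv_s \<gamma> (A (Suc i)) u p (y, t) \<le> inv_s \<gamma> (A (Suc i)) u p (y', t)" by (rule strip(1)) (fact y | assumption)+
    moreover have "inv_r \<gamma> (A (Suc i)) u p (y, t) \<le> inv_r \<gamma> (A (Suc i)) u p (y', t)" by (rule strip(2)) (fact y | assumption)+
    ultimately show ?thesis by (simp add: inv_s_def inv_r_def)
  qed
  show "p (y, t') \<le> p (y, t)" if y: "y \<in> {x i..x (Suc i)}" and t: "0 \<le> t" "t \<le> t'"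
  proof -
    have "inv_s \<gamma> (A (Suc i)) u p (y, t') \<le> inv_s \<gamma> (A (Suc i)) u p (y, t)" by (rule strip(3)) (fact y t | assumption)+
    moreover have "inv_r \<gamma> (A (Suc i)) u p (y, t) \<le> inv_r \<gamma> (A (Suc i)) u p (y, t')" by (rule strip(4)) (fact y t | assumption)+
    ultimately have "riemann_w \<gamma> (A (Suc i)) (p (y, t')) \<le> riemann_w \<gamma> (A (Suc i)) (p (y, t))"
      by (simp add: inv_s_def inv_r_def)
    then show ?thesis
      using riemann_w_inj_mono[OF \<gamma> isentropic_strip_pos(1)[OF middle[OF i]]] isentropic_strip_pos(2)[OF middle[OF i] y] t by simp
  qed
qed

lemma u_mono_interfaces: "i \<le> j \<Longrightarrow> j \<le> N \<Longrightarrow> 0 \<le> t \<Longrightarrow> u (x i, t) \<le> u (x j, t)"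
proof (induction j rule: dec_induct)
  case (step n)
  then show ?case using strip_monotone(1)[of n "x n" "x (Suc n)" t] x_less[of n] by simp
qed simp

text \<open>By monotonicity in \<open>x\<close>, \<open>u\<close> lies between its values at
  \<open>x 0\<close> and \<open>x N\<close>. There it is a constant minus, respectively plus,
  \<open>w\<close>, and \<open>w\<close> never exceeds its initial value because the pressure
  decreases in time.\<close>

lemma u_bounded:
  obtains U where "\<And>i y t. i < N \<Longrightarrow> y \<in> {x i..x (Suc i)} \<Longrightarrow> 0 \<le> t \<Longrightarrow> \<bar>u (y, t)\<bar> \<le> U"
proof
  fix i y t assume i: "i < N" and y: "y \<in> {x i..x (Suc i)}" and t: "0 \<le> (t::real)"
  define l where "l = uL + riemann_w \<gamma> (A 0) pL - riemann_w \<gamma> (A 0) (p (x 0, 0))"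
  define r where "r = uR - riemann_w \<gamma> (A (Suc N)) pR + riemann_w \<gamma> (A (Suc N)) (p (x N, 0))"
  have "p (x 0, t) \<le> p (x 0, 0)" using strip_monotone(2)[of 0 "x 0" 0 t] i x_less[of 0] t by auto
  then have "l \<le> u (x 0, t)"
    using left_boundary[OF t] riemann_w_inj_mono[OF \<gamma> A_pos[of 0] p_pos[of 0 t] p_pos[of 0 0]] t by (simp add: l_def)
  also have "\<dots> \<le> u (x i, t)" using u_mono_interfaces[of 0 i t] i t by simp
  also have "\<dots> \<le> u (y, t)" using strip_monotone(1)[OF i, of "x i" y t] y t by simp
  finally have lower: "l \<le> u (y, t)" .
  have "u (y, t) \<le> u (x (Suc i), t)" using strip_monotone(1)[OF i, of y "x (Suc i)" t] y t by simp
  also have "\<dots> \<le> u (x N, t)" using u_mono_interfaces[of "Suc i" N t] i t by simp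
  also have "p (x N, t) \<le> p (x N, 0)"
    using strip_monotone(2)[of "N - 1" "x N" 0 t] i x_less[of "N - 1"] t by auto
  then have "u (x N, t) \<le> r"
    using right_boundary[OF t] riemann_w_inj_mono[OF \<gamma> A_pos[of "Suc N"] p_pos[of N t] p_pos[of N 0]] t by (simp add: r_def)
  finally show "\<bar>u (y, t)\<bar> \<le> \<bar>uL + riemann_w \<gamma> (A 0) pL - riemann_w \<gamma> (A 0) (p (x 0, 0))\<bar> +
      \<bar>uR - riemann_w \<gamma> (A (Suc N)) pR + riemann_w \<gamma> (A (Suc N)) (p (x N, 0))\<bar>"
    using lower by (simp add: l_def r_def)
qed

text \<open>A positive decreasing pressure converges at every point. Conservation of momentum
  equates the limits within a strip, and shared interfaces link neighbouring strips.\<close>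

lemma pressure_limit:
  obtains P where "\<And>i y. i < N \<Longrightarrow> y \<in> {x i..x (Suc i)} \<Longrightarrow> ((\<lambda>t. p (y, t)) \<longlongrightarrow> P) at_top"
proof -
  obtain U where U: "\<And>i y t. i < N \<Longrightarrow> y \<in> {x i..x (Suc i)} \<Longrightarrow> 0 \<le> t \<Longrightarrow> \<bar>u (y, t)\<bar> \<le> U"
    using u_bounded by metis
  have conv: "\<exists>P. ((\<lambda>t. p (y, t)) \<longlongrightarrow> P) at_top" if i: "i < N" and y: "y \<in> {x i..x (Suc i)}" for i y
  proof -
    define P where "P = (INF t\<in>{0..}. p (y, t))"
    have bdd: "bdd_below ((\<lambda>t. p (y, t)) ` {0..})"
      by (rule bdd_belowI2[where m = 0]) (use isentropic_strip_pos(2)[OF middle[OF i] y] in \<open>auto intro: less_imp_le\<close>)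
    have "((\<lambda>t. p (y, t)) \<longlongrightarrow> P) at_top"
    proof (rule decreasing_tendsto)
      show "\<forall>\<^sub>F t in at_top. P \<le> p (y, t)"
        using eventually_ge_at_top[of 0] by eventually_elim (auto simp: P_def intro!: cINF_lower bdd)
      fix z assume "P < z"
      then obtain t0 where t0: "0 \<le> t0" "p (y, t0) < z"
        unfolding P_def using bdd by (subst (asm) cINF_less_iff) auto
      show "\<forall>\<^sub>F t in at_top. p (y, t) < z"
        using eventually_ge_at_top[of t0]
        by eventually_elim (use strip_monotone(2)[OF i y t0(1)] t0 in force)
    qed
    then show ?thesis by blast
  qed
  define L where "L = (\<lambda>y. Lim at_top (\<lambda>t. p (y, t)))"
  have L: "((\<lambda>t. p (y, t)) \<longlongrightarrow> L y) at_top" if i: "i < N" and y: "y \<in> {x i..x (Suc i)}" for i y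
    using conv[OF that] by (auto simp: L_def tendsto_Lim)
  have same: "L y = L (x i)" if i: "i < N" and y: "y \<in> {x i..x (Suc i)}" for i y
  proof (cases "y = x i")
    case False
    have xi: "x i \<in> {x i..x (Suc i)}" using y by auto
    have "L (x i) = L y"
    proof (rule momentum_limits_agree[where a = "x i" and b = y])
      show "isentropic_strip \<gamma> (A (Suc i)) {x i..y} u p"
        by (rule isentropic_strip_subset[OF middle[OF i]]) (use y in auto)
      show "x i < y" using False y by auto
      show "\<bar>u (z, t)\<bar> \<le> U" if "z \<in> {x i..y}" "0 \<le> t" for z t using U[OF i _ that(2)] that y by auto
    qed (use L[OF i y] L[OF i xi] in auto)
    then show ?thesis by simp
  qed simp
  have "L (x i) = L (x 0)" if "i \<le> N" for i
    using that
  proof (induction i)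
    case (Suc i)
    then show ?case using same[of i "x (Suc i)"] x_less[of i] by auto
  qed simp
  then have "\<And>i y. i < N \<Longrightarrow> y \<in> {x i..x (Suc i)} \<Longrightarrow> ((\<lambda>t. p (y, t)) \<longlongrightarrow> L (x 0)) at_top"
    using L same by (metis less_imp_le)
  then show thesis by (rule that)
qed

text \<open>A pressure that decreases in time stays above its limit \<open>P\<close>, so all that
  has to be shown is \<open>0 < P\<close>.\<close>

lemma pressure_bounded_below:
  assumes N: "0 < N" and gt: "uR - riemann_w \<gamma> (A (Suc N)) pR < uL + riemann_w \<gamma> (A 0) pL"
  obtains P where "0 < P" "\<And>i y t. i < N \<Longrightarrow> y \<in> {x i..x (Suc i)} \<Longrightarrow> 0 \<le> t \<Longrightarrow> P \<le> p (y, t)"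
proof -
  obtain P where P: "\<And>i y. i < N \<Longrightarrow> y \<in> {x i..x (Suc i)} \<Longrightarrow> ((\<lambda>t. p (y, t)) \<longlongrightarrow> P) at_top"
    using pressure_limit by metis
  have low: "P \<le> p (y, t)" if i: "i < N" and y: "y \<in> {x i..x (Suc i)}" and t: "0 \<le> t" for i y t
  proof (rule tendsto_upperbound[OF P[OF i y]])
    show "\<forall>\<^sub>F t' in at_top. p (y, t') \<le> p (y, t)"
      using eventually_ge_at_top[of t] by eventually_elim (use strip_monotone(2)[OF i y t] in auto)
  qed simp
  have "0 < P"
  proof (rule ccontr)
    assume nonpos: "\<not> 0 < P"
    define gap where "gap = uL + riemann_w \<gamma> (A 0) pL - (uR - riemann_w \<gamma> (A (Suc N)) pR)"
    have x0: "x 0 \<in> {x 0..x (Suc 0)}" and xN: "x N \<in> {x (N - 1)..x (Suc (N - 1))}"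
      using x_less[of 0] x_less[of "N - 1"] N by auto
    \<comment> \<open>This is \<open>u (x 0, t) \<le> u (x N, t)\<close> rewritten with the boundary
      invariants; if \<open>P\<close> were 0, the right-hand side would tend to 0.\<close>
    have gap_le: "gap \<le> riemann_w \<gamma> (A 0) (p (x 0, t)) + riemann_w \<gamma> (A (Suc N)) (p (x N, t))" if t: "0 \<le> t" for t
      using left_boundary[OF t] right_boundary[OF t] u_mono_interfaces[of 0 N t] t by (simp add: gap_def)
    have to_0: "((\<lambda>t. p (x i, t)) \<longlongrightarrow> 0) at_top" if "i \<in> {0, N}" for i
    proof -
      have lim: "((\<lambda>t. p (x i, t)) \<longlongrightarrow> P) at_top"
        using that P[OF N x0] P[of "N - 1" "x N"] xN N by auto
      have "\<forall>\<^sub>F t in at_top. 0 \<le> p (x i, t)"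
        using eventually_ge_at_top[of 0] by eventually_elim (use p_pos[of i] that in \<open>auto intro: less_imp_le\<close>)
      then have "0 \<le> P" by (intro tendsto_lowerbound[OF lim]) auto
      then show ?thesis using lim nonpos by simp
    qed
    have W: "((\<lambda>t. riemann_w \<gamma> B (p (x i, t))) \<longlongrightarrow> 0) at_top" if "i \<in> {0, N}" "0 < B" for i B
    proof -
      have "\<forall>\<^sub>F t in at_top. 0 \<le> p (x i, t) / B"
        using eventually_ge_at_top[of 0] by eventually_elim (use p_pos[of i] that in \<open>auto intro: less_imp_le\<close>)
      moreover have "((\<lambda>t. p (x i, t) / B) \<longlongrightarrow> 0) at_top"
        using tendsto_divide[OF to_0[OF that(1)] tendsto_const, of B] that(2) by simp
      ultimately have "((\<lambda>t. (p (x i, t) / B) powr ((\<gamma> - 1) / (2 * \<gamma>))) \<longlongrightarrow> 0 powr ((\<gamma> - 1) / (2 * \<gamma>))) at_top"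
        using \<gamma> by (intro tendsto_powr') auto
      from tendsto_mult_left[OF this, of "2 / (\<gamma> - 1) * sqrt (\<gamma> * B)"]
      show ?thesis unfolding riemann_w_def by simp
    qed
    have "((\<lambda>t. riemann_w \<gamma> (A 0) (p (x 0, t)) + riemann_w \<gamma> (A (Suc N)) (p (x N, t))) \<longlongrightarrow> 0 + 0) at_top"
      by (intro tendsto_add W A_pos) auto
    moreover have "\<forall>\<^sub>F t in at_top. gap \<le> riemann_w \<gamma> (A 0) (p (x 0, t)) + riemann_w \<gamma> (A (Suc N)) (p (x N, t))"
      using eventually_ge_at_top[of 0] by eventually_elim (rule gap_le)
    ultimately have "gap \<le> 0 + 0" by (intro tendsto_lowerbound) auto
    then show False using gt by (simp add: gap_def)
  qed
  then show thesis using that low by blast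
qed

end

section \<open>Solutions of the Euler equations\<close>

text \<open>The factor \<open>A\<close> in \<open>p = A \<tau>^(- \<gamma>)\<close>, a constant
  multiple of \<open>m\<^sup>2\<close>.\<close>

definition adiabat :: "real \<Rightarrow> real \<Rightarrow> (real \<Rightarrow> real) \<Rightarrow> real \<Rightarrow> real" where
  "adiabat K c\<^sub>v S x = K * exp (S x / c\<^sub>v)"

lemma C_z_pos: "1 < \<gamma> \<Longrightarrow> 0 < C_z \<gamma>"
  by (simp add: C_z_def d_exp_def divide_simps)

lemma C_m_pos: "1 < \<gamma> \<Longrightarrow> 0 < K \<Longrightarrow> 0 < C_m \<gamma> K"
  using C_z_pos by (simp add: C_m_def less_imp_neq[symmetric])

lemma adiabat_pos: "0 < K \<Longrightarrow> 0 < adiabat K c\<^sub>v S x"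
  by (simp add: adiabat_def)

lemma pressure_pos: "0 < K \<Longrightarrow> 0 < \<tau> q \<Longrightarrow> 0 < pressure \<gamma> K c\<^sub>v \<tau> S q"
  by (simp add: pressure_def)

lemma pressure_div_adiabat:
  "0 < K \<Longrightarrow> pressure \<gamma> K c\<^sub>v \<tau> S q / adiabat K c\<^sub>v S (fst q) = \<tau> q powr (- \<gamma>)"
  by (simp add: pressure_def adiabat_def)

lemma sqrt_adiabat:
  assumes "0 < K" "1 < \<gamma>"
  shows "sqrt (\<gamma> * adiabat K c\<^sub>v S x) = sqrt (K * \<gamma>) * exp (S x / (2 * c\<^sub>v))"
proof -
  have "sqrt (exp (S x / c\<^sub>v)) = exp (S x / (2 * c\<^sub>v))"
    by (rule real_sqrt_unique) (auto simp: power2_eq_square simp flip: exp_add)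
  then show ?thesis by (simp add: adiabat_def real_sqrt_mult algebra_simps)
qed

text \<open>\<open>C_z\<close> is normalised so that
  \<open>C_z^(1 - d) = d - 1 = 2 / (\<gamma> - 1)\<close>, which is the leading factor of
  \<open>riemann_w\<close>.\<close>

lemma m_times_z:
  assumes "1 < \<gamma>" "0 < K" "0 < \<tau> q"
  shows "m_var \<gamma> K c\<^sub>v S (fst q) * z_var \<gamma> \<tau> q
       = riemann_w \<gamma> (adiabat K c\<^sub>v S (fst q)) (pressure \<gamma> K c\<^sub>v \<tau> S q)"
proof -
  have d1: "d_exp \<gamma> - 1 = 2 / (\<gamma> - 1)" using assms by (simp add: d_exp_def field_simps)
  moreover have "0 < 2 / (\<gamma> - 1)" using assms by simp
  ultimately have d_ne: "d_exp \<gamma> \<noteq> 1" by linarith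
  have "C_z \<gamma> powr (- d_exp \<gamma>) * C_z \<gamma> = C_z \<gamma> powr (1 - d_exp \<gamma>)"
    using C_z_pos[OF assms(1)] powr_add[of "C_z \<gamma>" "- d_exp \<gamma>" 1] by simp
  also have "\<dots> = (d_exp \<gamma> - 1) powr (1 / (1 - d_exp \<gamma>) * (1 - d_exp \<gamma>))"
    by (simp add: C_z_def powr_powr)
  also have "1 / (1 - d_exp \<gamma>) * (1 - d_exp \<gamma>) = 1" using d_ne by simp
  finally have C: "C_z \<gamma> powr (- d_exp \<gamma>) * C_z \<gamma> = 2 / (\<gamma> - 1)" using assms by (simp add: d1)
  have "(pressure \<gamma> K c\<^sub>v \<tau> S q / adiabat K c\<^sub>v S (fst q)) powr ((\<gamma> - 1) / (2 * \<gamma>)) = \<tau> q powr (- (\<gamma> - 1) / 2)"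
    unfolding pressure_div_adiabat[OF assms(2)] powr_powr using assms by (intro arg_cong[where f = "\<lambda>e. \<tau> q powr e"]) (simp add: field_simps)
  then show ?thesis
    unfolding riemann_w_def sqrt_adiabat[OF assms(2,1)] m_var_def z_var_def C_m_def C[symmetric]
    by simp
qed

lemma sound_speed_eq:
  assumes "1 < \<gamma>" "0 < K" "0 < \<tau> q"
  shows "sound_speed \<gamma> K c\<^sub>v \<tau> S q = gas_speed \<gamma> (adiabat K c\<^sub>v S (fst q)) (pressure \<gamma> K c\<^sub>v \<tau> S q)"
proof -
  have x: "- (\<gamma> - 1) / 2 * d_exp \<gamma> = - \<gamma> * ((\<gamma> + 1) / (2 * \<gamma>))"
    using assms by (simp add: d_exp_def field_simps)
  have "(C_z \<gamma> * \<tau> q powr (- (\<gamma> - 1) / 2)) powr d_exp \<gamma> = C_z \<gamma> powr d_exp \<gamma> * \<tau> q powr (- \<gamma> * ((\<gamma> + 1) / (2 * \<gamma>)))"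
    using C_z_pos[OF assms(1)] by (simp only: powr_mult powr_powr x)
  also have "\<tau> q powr (- \<gamma> * ((\<gamma> + 1) / (2 * \<gamma>))) = (\<tau> q powr (- \<gamma>)) powr ((\<gamma> + 1) / (2 * \<gamma>))"
    by (simp only: powr_powr)
  finally have z: "(C_z \<gamma> * \<tau> q powr (- (\<gamma> - 1) / 2)) powr d_exp \<gamma>
      = C_z \<gamma> powr d_exp \<gamma> * (\<tau> q powr (- \<gamma>)) powr ((\<gamma> + 1) / (2 * \<gamma>))" .
  have "C_z \<gamma> powr (- d_exp \<gamma>) * C_z \<gamma> powr d_exp \<gamma> = 1"
    using C_z_pos[OF assms(1)] by (simp flip: powr_add)
  then have "sqrt (K * \<gamma>) * (C_z \<gamma> powr (- d_exp \<gamma>) * C_z \<gamma> powr d_exp \<gamma>) * exp (S (fst q) / (2 * c\<^sub>v)) * X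
      = sqrt (K * \<gamma>) * exp (S (fst q) / (2 * c\<^sub>v)) * X" for X by (simp only: mult_1_right)
  from this[of "(\<tau> q powr (- \<gamma>)) powr ((\<gamma> + 1) / (2 * \<gamma>))"] show ?thesis
    unfolding gas_speed_def pressure_div_adiabat[OF assms(2)] sqrt_adiabat[OF assms(2,1)] sound_speed_def
      m_var_def z_var_def C_m_def z by (simp only: mult.assoc mult.left_commute)
qed

lemma adiabat_le_iff:
  assumes "1 < \<gamma>" "0 < K" "0 < c\<^sub>v"
  shows "adiabat K c\<^sub>v S x \<le> adiabat K c\<^sub>v S y \<longleftrightarrow> m_var \<gamma> K c\<^sub>v S x \<le> m_var \<gamma> K c\<^sub>v S y"
  using assms C_m_pos[OF assms(1,2)] by (simp add: adiabat_def m_var_def divide_le_cancel)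

section \<open>From the Euler equations to the pressure formulation on strips without jumps\<close>

lemma C1_on_continuous: "C1_on D f \<Longrightarrow> continuous_on D f"
proof -
  assume "C1_on D f"
  then obtain fx ft where "\<forall>q\<in>D. (f has_derivative (\<lambda>h. fx q * fst h + ft q * snd h)) (at q within D)"
    unfolding C1_on_def by blast
  then show ?thesis
    by (intro has_derivative_continuous_on[where f' = "\<lambda>q h. fx q * fst h + ft q * snd h"]) blast
qed

lemma C2_on_subsetE:
  assumes C2: "C2_on D f" and E: "E \<subseteq> D"
  obtains fx ft where "continuous_on E fx" "continuous_on E ft"
    "\<forall>q\<in>E. (f has_derivative (\<lambda>h. fx q * fst h + ft q * snd h)) (at q within E)"
proof -
  obtain fx ft where f: "C1_on D fx" "C1_on D ft"
    "\<forall>q\<in>D. (f has_derivative (\<lambda>h. fx q * fst h + ft q * snd h)) (at q within D)"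
    using C2 unfolding C2_on_def by blast
  show thesis
  proof (rule that[of fx ft])
    show "continuous_on E fx" "continuous_on E ft"
      using f(1,2) by (auto intro: continuous_on_subset[OF C1_on_continuous E])
    show "\<forall>q\<in>E. (f has_derivative (\<lambda>h. fx q * fst h + ft q * snd h)) (at q within E)"
      by (intro ballI has_derivative_subset[OF _ E]) (rule bspec[OF f(3)], erule subsetD[OF E])
  qed
qed

lemma at_within_Ici_neq_bot: "0 \<le> (t::real) \<Longrightarrow> at t within {0..} \<noteq> bot"
proof -
  assume "0 \<le> t"
  then have "at_right t \<le> at t within {0..}" by (intro at_le) auto
  then show ?thesis using trivial_limit_at_right_real[of t] bot.extremum_uniqueI by metis
qed

lemma real_derivative_unique_within:
  assumes "at x within S \<noteq> bot" "(f has_real_derivative D) (at x within S)" "(f has_real_derivative E) (at x within S)"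
  shows "D = (E::real)"
  using assms vector_derivative_unique_within
  by (metis has_real_derivative_iff_has_vector_derivative)

text \<open>\<open>V\<close> is any open interval without jumps, not only a whole component, because
  the layering also cuts at points that are not jumps. The equations hold on \<open>V\<close> and
  extend to its closure by continuity.\<close>

lemma isentropic_strip_of_interval:
  assumes \<gamma>: "1 < \<gamma>" and K: "0 < K" and cv: "0 < c\<^sub>v"
    and sol: "global_shock_free \<gamma> K c\<^sub>v \<tau> u S"
    and V: "open V" "connected V" "V \<inter> jumps (m_var \<gamma> K c\<^sub>v S) = {}" and x: "x \<in> V"
  shows "isentropic_strip \<gamma> (adiabat K c\<^sub>v S x) (closure V) u (pressure \<gamma> K c\<^sub>v \<tau> S)"
    and "y \<in> V \<Longrightarrow> adiabat K c\<^sub>v S y = adiabat K c\<^sub>v S x"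
proof -
  define m where "m = m_var \<gamma> K c\<^sub>v S"
  define p where "p = pressure \<gamma> K c\<^sub>v \<tau> S"
  define A where "A = adiabat K c\<^sub>v S x"
  define I where "I = connected_component_set (- jumps m) x"
  have Icomp: "I \<in> components (- jumps m)" using x V by (auto simp: components_def I_def m_def)
  have VI: "V \<subseteq> I" unfolding I_def
    by (rule connected_component_maximal) (use x V in \<open>auto simp: m_def\<close>)
  note parts = sol[unfolded global_shock_free_def Let_def, folded m_def p_def]
  note pc = parts[THEN conjunct1]
  have \<tau>_pos: "0 < \<tau> (x, t)" if "0 \<le> t" for x t
    using parts[THEN conjunct2, THEN conjunct1] that by simp
  note comp = bspec[OF parts[THEN conjunct2, THEN conjunct2, THEN conjunct2, THEN conjunct2] Icomp]
  note C2 = comp[THEN conjunct1] comp[THEN conjunct2, THEN conjunct1]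
  have balance: "balance_at \<tau> (\<lambda>q. - u q) x t \<and> balance_at u p x t" if "x \<in> I" "0 \<le> t" for x t
    using comp[THEN conjunct2, THEN conjunct2] that by simp
  have "m constant_on I" using pc Icomp by (auto simp: piecewise_constant_def)
  then have mI: "m y = m x" if "y \<in> V" for y using that x VI unfolding constant_on_def by (metis subsetD)
  have AV: "adiabat K c\<^sub>v S y = A" if "y \<in> V" for y
    using mI[OF that] adiabat_le_iff[OF \<gamma> K cv, of S y x] adiabat_le_iff[OF \<gamma> K cv, of S x y]
    unfolding A_def m_def by simp
  then show "y \<in> V \<Longrightarrow> adiabat K c\<^sub>v S y = adiabat K c\<^sub>v S x" by (simp add: A_def)
  have A: "0 < A" using K by (simp add: A_def adiabat_pos)
  let ?E = "closure V \<times> ({0..} :: real set)"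
  have EI: "?E \<subseteq> closure I \<times> {0..}" using closure_mono[OF VI] by auto
  obtain ux ut where u': "continuous_on ?E ux" "continuous_on ?E ut"
    "\<forall>q\<in>?E. (u has_derivative (\<lambda>h. ux q * fst h + ut q * snd h)) (at q within ?E)"
    using C2_on_subsetE[OF C2(1) EI] .
  note u = u'(1,2) bspec[OF u'(3)]
  obtain px pt where p': "continuous_on ?E px" "continuous_on ?E pt"
    "\<forall>q\<in>?E. (p has_derivative (\<lambda>h. px q * fst h + pt q * snd h)) (at q within ?E)"
    using C2_on_subsetE[OF C2(2) EI] .
  note p = p'(1,2) bspec[OF p'(3)]
  have p_pos: "0 < p q" if "q \<in> ?E" for q
    using that \<tau>_pos[of "snd q" "fst q"] K unfolding p_def by (intro pressure_pos) auto
  have VE: "y \<in> V \<Longrightarrow> 0 \<le> t \<Longrightarrow> (y, t) \<in> ?E" for y t using closure_subset by auto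
  have u_x: "((\<lambda>y. u (y, t)) has_real_derivative ux (y, t)) (at y)" if yt: "y \<in> V" "0 \<le> t" for y t
  proof -
    have "((\<lambda>y. u (y, t)) has_real_derivative ux (y, t) * 1 + ut (y, t) * 0) (at y within V)"
      by (rule derivative_along_curve[where X = "\<lambda>y. y" and \<Theta> = "\<lambda>_. t", OF u(3)[OF VE[OF yt]]])
         (rule DERIV_ident DERIV_const VE yt(2) | assumption)+
    then show ?thesis by (simp add: at_within_open[OF yt(1) V(1)])
  qed
  have p_x: "((\<lambda>y. p (y, t)) has_real_derivative px (y, t)) (at y)" if yt: "y \<in> V" "0 \<le> t" for y t
  proof -
    have "((\<lambda>y. p (y, t)) has_real_derivative px (y, t) * 1 + pt (y, t) * 0) (at y within V)"
      by (rule derivative_along_curve[where X = "\<lambda>y. y" and \<Theta> = "\<lambda>_. t", OF p(3)[OF VE[OF yt]]])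
         (rule DERIV_ident DERIV_const VE yt(2) | assumption)+
    then show ?thesis by (simp add: at_within_open[OF yt(1) V(1)])
  qed
  have u_t: "((\<lambda>t. u (y, t)) has_real_derivative ut (y, t)) (at t within {0..})" if yt: "y \<in> V" "0 \<le> t" for y t
  proof -
    have "((\<lambda>t. u (y, t)) has_real_derivative ux (y, t) * 0 + ut (y, t) * 1) (at t within {0..})"
      by (rule derivative_along_curve[where X = "\<lambda>_. y" and \<Theta> = "\<lambda>t. t", OF u(3)[OF VE[OF yt]]])
         (rule DERIV_ident DERIV_const VE yt(1) | simp)+
    then show ?thesis by simp
  qed
  have p_t: "((\<lambda>t. p (y, t)) has_real_derivative pt (y, t)) (at t within {0..})" if yt: "y \<in> V" "0 \<le> t" for y t
  proof -
    have "((\<lambda>t. p (y, t)) has_real_derivative px (y, t) * 0 + pt (y, t) * 1) (at t within {0..})"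
      by (rule derivative_along_curve[where X = "\<lambda>_. y" and \<Theta> = "\<lambda>t. t", OF p(3)[OF VE[OF yt]]])
         (rule DERIV_ident DERIV_const VE yt(1) | simp)+
    then show ?thesis by simp
  qed
  \<comment> \<open>The momentum equation gives the first identity; conservation of mass,
    \<open>\<tau>_t = u_x\<close>, inserted into \<open>p = A \<tau>^(- \<gamma>)\<close> with
    \<open>A\<close> independent of time, gives the second.\<close>
  have interior: "ut (y, t) + px (y, t) = 0 \<and> pt (y, t) + (gas_speed \<gamma> A (p (y, t)))\<^sup>2 * ux (y, t) = 0"
    if yt: "y \<in> V" "0 \<le> t" for y t
  proof
    note nb = at_within_Ici_neq_bot[OF yt(2)]
    obtain wt fx where w: "((\<lambda>s. u (y, s)) has_real_derivative wt) (at t within {0..})"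
      "((\<lambda>z. p (z, t)) has_real_derivative fx) (at y)" "wt + fx = 0"
      using balance[of y t] yt VI unfolding balance_at_def by blast
    then show "ut (y, t) + px (y, t) = 0"
      using real_derivative_unique_within[OF nb w(1) u_t[OF yt]] DERIV_unique[OF w(2) p_x[OF yt]] by simp
    obtain \<tau>t gx where g: "((\<lambda>s. \<tau> (y, s)) has_real_derivative \<tau>t) (at t within {0..})"
      "((\<lambda>z. - u (z, t)) has_real_derivative gx) (at y)" "\<tau>t + gx = 0"
      using balance[of y t] yt VI unfolding balance_at_def by blast
    have "gx = - ux (y, t)" using DERIV_unique[OF g(2) DERIV_minus[OF u_x[OF yt]]] .
    then have \<tau>t: "\<tau>t = ux (y, t)" using g(3) by simp
    have pos: "0 < \<tau> (y, t)" using \<tau>_pos yt by simp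
    have p_eq: "p (y, s) = A * \<tau> (y, s) powr (- \<gamma>)" for s
      using AV[OF yt(1)] by (simp add: p_def pressure_def adiabat_def)
    have "((\<lambda>s. A * \<tau> (y, s) powr (- \<gamma>)) has_real_derivative A * (- \<gamma> * \<tau> (y, t) powr (- \<gamma> - 1) * ux (y, t))) (at t within {0..})"
      using DERIV_cmult[OF DERIV_chain2[OF has_real_derivative_powr[OF pos, of "- \<gamma>"] g(1)], of A] unfolding \<tau>t .
    then have "pt (y, t) = A * (- \<gamma> * \<tau> (y, t) powr (- \<gamma> - 1) * ux (y, t))"
      using real_derivative_unique_within[OF nb p_t[OF yt]] unfolding p_eq by blast
    moreover have "(gas_speed \<gamma> A (p (y, t)))\<^sup>2 = \<gamma> * A * \<tau> (y, t) powr (- \<gamma> - 1)"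
    proof -
      have e: "- \<gamma> * ((\<gamma> + 1) / (2 * \<gamma>)) * 2 = - \<gamma> - 1" using \<gamma> by (simp add: field_simps)
      have "gas_speed \<gamma> A (p (y, t)) = sqrt (\<gamma> * A) * \<tau> (y, t) powr (- \<gamma> * ((\<gamma> + 1) / (2 * \<gamma>)))"
        using A by (simp add: gas_speed_def p_eq powr_powr)
      then have "(gas_speed \<gamma> A (p (y, t)))\<^sup>2 = (sqrt (\<gamma> * A))\<^sup>2 * (\<tau> (y, t) powr (- \<gamma> * ((\<gamma> + 1) / (2 * \<gamma>))))\<^sup>2"
        by (simp only: power_mult_distrib)
      also have "(\<tau> (y, t) powr (- \<gamma> * ((\<gamma> + 1) / (2 * \<gamma>))))\<^sup>2 = \<tau> (y, t) powr (- \<gamma> - 1)"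
        unfolding power2_eq_square powr_add[symmetric]
          using e by (intro arg_cong[where f = "\<lambda>e. \<tau> (y, t) powr e"]) linarith
      also have "(sqrt (\<gamma> * A))\<^sup>2 = \<gamma> * A" using A \<gamma> by simp
      finally show ?thesis .
    qed
    ultimately show "pt (y, t) + (gas_speed \<gamma> A (p (y, t)))\<^sup>2 * ux (y, t) = 0" by (simp add: algebra_simps)
  qed
  have closure_E: "closure (V \<times> ({0..} :: real set)) = ?E" by (simp add: closure_Times)
  have contp: "continuous_on ?E p" using p(3) by (rule has_derivative_continuous_on)
  have cont_speed: "continuous_on ?E (\<lambda>q. gas_speed \<gamma> A (p q))"
    unfolding gas_speed_def using p_pos A by (intro continuous_intros contp) force+
  have ut_px: "ut q + px q = 0" if "q \<in> ?E" for q
    by (rule continuous_constant_on_closure[where S = "V \<times> {0..}"])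
       (use that interior closure_E in \<open>auto intro!: continuous_intros u p\<close>)
  have pt_ux: "pt q + (gas_speed \<gamma> A (p q))\<^sup>2 * ux q = 0" if "q \<in> ?E" for q
    by (rule continuous_constant_on_closure[where S = "V \<times> {0..}"])
       (use that interior closure_E in \<open>auto intro!: continuous_intros u p cont_speed\<close>)
  have "strip_solution \<gamma> A (closure V) u p ux ut px pt"
  proof
    fix q assume q: "q \<in> ?E"
    show "0 < p q" "(u has_derivative (\<lambda>h. ux q * fst h + ut q * snd h)) (at q within ?E)"
      "(p has_derivative (\<lambda>h. px q * fst h + pt q * snd h)) (at q within ?E)"
      using p_pos[OF q] u(3)[OF q] p(3)[OF q] by auto
    show "ut q = - px q" "pt q = - (gas_speed \<gamma> A (p q))\<^sup>2 * ux q"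
      using ut_px[OF q] pt_ux[OF q] by auto
  qed (use A u p in auto)
  then show "isentropic_strip \<gamma> (adiabat K c\<^sub>v S x) (closure V) u (pressure \<gamma> K c\<^sub>v \<tau> S)"
    unfolding isentropic_strip_def A_def p_def by blast
qed

text \<open>At a jump the pressure is continuous but the entropy is not, so the limit takes its
  entropy from the side \<open>V\<close> on which the filter \<open>F\<close> lives.\<close>

lemma Lim_sound_speed:
  assumes \<gamma>: "1 < \<gamma>" and K: "0 < K"
    and \<tau>: "\<And>y. 0 < \<tau> (y, t)" and t: "0 \<le> t"
    and p: "continuous_on (UNIV \<times> {0..}) (pressure \<gamma> K c\<^sub>v \<tau> S)"
    and F: "F \<noteq> bot" "F \<le> at x" "\<forall>\<^sub>F y in F. y \<in> V"
    and A: "\<And>y. y \<in> V \<Longrightarrow> adiabat K c\<^sub>v S y = A" and A_pos: "0 < A"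
  shows "Lim F (\<lambda>y. sound_speed \<gamma> K c\<^sub>v \<tau> S (y, t)) = gas_speed \<gamma> A (pressure \<gamma> K c\<^sub>v \<tau> S (x, t))"
proof (rule tendsto_Lim[OF F(1)])
  let ?p = "pressure \<gamma> K c\<^sub>v \<tau> S"
  have "((\<lambda>y. ?p (y, t)) \<longlongrightarrow> ?p (x, t)) F"
  proof (rule continuous_on_tendsto_compose[OF p])
    have "((\<lambda>y. y) \<longlongrightarrow> x) F" using tendsto_mono[OF F(2) tendsto_ident_at] .
    then show "((\<lambda>y. (y, t)) \<longlongrightarrow> (x, t)) F" by (intro tendsto_Pair tendsto_const)
  qed (use t in auto)
  moreover have "0 < ?p (x, t)" by (rule pressure_pos[where \<tau> = \<tau>, OF K \<tau>])
  ultimately have "((\<lambda>y. gas_speed \<gamma> A (?p (y, t))) \<longlongrightarrow> gas_speed \<gamma> A (?p (x, t))) F"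
    unfolding gas_speed_def using A_pos by (intro tendsto_intros) auto
  moreover have "\<forall>\<^sub>F y in F. gas_speed \<gamma> A (?p (y, t)) = sound_speed \<gamma> K c\<^sub>v \<tau> S (y, t)"
    using F(3) by eventually_elim (simp add: sound_speed_eq[where \<tau> = \<tau>, OF \<gamma> K \<tau>] A)
  ultimately show "((\<lambda>y. sound_speed \<gamma> K c\<^sub>v \<tau> S (y, t)) \<longlongrightarrow> gas_speed \<gamma> A (?p (x, t))) F"
    by (rule Lim_transform_eventually)
qed

lemma eventually_at_right_in: "a \<le> x \<Longrightarrow> x < (b::real) \<Longrightarrow> \<forall>\<^sub>F y in at_right x. y \<in> {a<..<b}"
  unfolding eventually_at_right_field by (intro exI[of _ b]) auto

lemma eventually_at_left_in: "a < x \<Longrightarrow> x \<le> (b::real) \<Longrightarrow> \<forall>\<^sub>F y in at_left x. y \<in> {a<..<b}"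
  unfolding eventually_at_left_field by (intro exI[of _ a]) auto

text \<open>The \<open>x\<close>-derivative of \<open>s = u + w\<close> is
  \<open>u_x + p_x / c = \<alpha>\<close>, read off inside the strip from its right-sided
  value.\<close>

lemma inv_s_initially_mono:
  assumes \<gamma>: "1 < \<gamma>" and K: "0 < K" and \<tau>: "\<And>y. 0 < \<tau> (y, 0)"
    and p: "continuous_on (UNIV \<times> {0..}) (pressure \<gamma> K c\<^sub>v \<tau> S)"
    and strip: "isentropic_strip \<gamma> A {a..b} u (pressure \<gamma> K c\<^sub>v \<tau> S)"
    and A: "\<And>y. y \<in> {a<..<b} \<Longrightarrow> adiabat K c\<^sub>v S y = A"
    and nc: "nowhere_compressive_initially \<gamma> K c\<^sub>v \<tau> u S"
    and xy: "a \<le> x" "x \<le> y" "y \<le> b"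
  shows "inv_s \<gamma> A u (pressure \<gamma> K c\<^sub>v \<tau> S) (x, 0) \<le> inv_s \<gamma> A u (pressure \<gamma> K c\<^sub>v \<tau> S) (y, 0)"
proof -
  let ?p = "pressure \<gamma> K c\<^sub>v \<tau> S"
  obtain ux ut px pt where "strip_solution \<gamma> A {a..b} u ?p ux ut px pt"
    using strip unfolding isentropic_strip_def by blast
  then interpret strip_solution \<gamma> A "{a..b}" u ?p ux ut px pt .
  have u_x: "((\<lambda>z. u (z, 0)) has_real_derivative ux (z, 0)) (at z within {a..b})"
    and p_x: "((\<lambda>z. ?p (z, 0)) has_real_derivative px (z, 0)) (at z within {a..b})" if z: "z \<in> {a..b}" for z
    using derivative_along_curve[where X = "\<lambda>y. y" and \<Theta> = "\<lambda>_. 0" and t = z and X' = 1 and \<Theta>' = 0 and I = "{a..b}", OF u_deriv]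
      derivative_along_curve[where X = "\<lambda>y. y" and \<Theta> = "\<lambda>_. 0" and t = z and X' = 1 and \<Theta>' = 0 and I = "{a..b}", OF p_deriv]
      z by (auto intro!: derivative_eq_intros)
  show ?thesis unfolding inv_s_def
  proof (rule DERIV_nonneg_imp_increasing_open[OF xy(2)])
    fix z assume z: "x < z" "z < y"
    then have z': "a < z" "z < b" "z \<in> {a..b}" using xy by auto
    have u_z: "((\<lambda>z. u (z, 0)) has_real_derivative ux (z, 0)) (at z)"
      and p_z: "((\<lambda>z. ?p (z, 0)) has_real_derivative px (z, 0)) (at z)"
      using u_x[OF z'(3)] p_x[OF z'(3)] z' by (simp_all add: at_within_interior[of z "{a..b}"])
    have "vector_derivative (\<lambda>y. u (y, 0)) (at_right z) = ux (z, 0)"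
      "vector_derivative (\<lambda>y. ?p (y, 0)) (at_right z) = px (z, 0)"
      using u_z p_z
      by (auto intro!: vector_derivative_within
          simp flip: has_real_derivative_iff_has_vector_derivative intro: has_field_derivative_at_within)
    moreover have "Lim (at_right z) (\<lambda>y. sound_speed \<gamma> K c\<^sub>v \<tau> S (y, 0)) = gas_speed \<gamma> A (?p (z, 0))"
      by (rule Lim_sound_speed[OF \<gamma> K \<tau> order_refl p _ _ eventually_at_right_in[of a z b]])
         (use z' A A_pos in \<open>auto intro: at_le\<close>)
    moreover have "0 \<le> alpha \<gamma> K c\<^sub>v \<tau> u S (at_right z) 0"
      using nc unfolding nowhere_compressive_initially_def by blast
    ultimately have "0 \<le> ux (z, 0) + px (z, 0) / gas_speed \<gamma> A (?p (z, 0))" by (simp add: alpha_def)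
    moreover have "((\<lambda>z. u (z, 0) + riemann_w \<gamma> A (?p (z, 0))) has_real_derivative
        ux (z, 0) + 1 / gas_speed \<gamma> A (?p (z, 0)) * px (z, 0)) (at z)"
      using z' by (intro DERIV_add u_z DERIV_chain2[OF DERIV_riemann_w p_z] \<gamma> A_pos p_pos) auto
    ultimately show "\<exists>D. ((\<lambda>z. u (z, 0) + riemann_w \<gamma> A (?p (z, 0))) has_real_derivative D) (at z) \<and> 0 \<le> D"
      by auto
  next
    have "((\<lambda>z. u (z, 0) + riemann_w \<gamma> A (?p (z, 0))) has_real_derivative
        ux (z, 0) + 1 / gas_speed \<gamma> A (?p (z, 0)) * px (z, 0)) (at z within {a..b})" if "z \<in> {a..b}" for z
      using that by (intro DERIV_add u_x DERIV_chain2[OF DERIV_riemann_w p_x] \<gamma> A_pos p_pos) auto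
    then have "continuous_on {a..b} (\<lambda>z. u (z, 0) + riemann_w \<gamma> A (?p (z, 0)))"
      by (rule DERIV_continuous_on)
    then show "continuous_on {x..y} (\<lambda>z. u (z, 0) + riemann_w \<gamma> A (?p (z, 0)))"
      by (rule continuous_on_subset) (use xy in auto)
  qed
qed

text \<open>The points of \<open>B\<close> in increasing order, framed by \<open>a\<close> and
  \<open>b\<close>, so that there is a cell even if \<open>B\<close> is empty. The induction adds
  the largest point \<open>c\<close>: a grid on \<open>[a, c]\<close> is extended by
  \<open>b\<close>.\<close>

lemma grid_through_finite_set:
  fixes a b :: real
  assumes "finite B" "B \<subseteq> {a<..<b}" "a < b"
  shows "\<exists>N x. 0 < N \<and> x 0 = a \<and> x N = b \<and> (\<forall>i<N. x i < x (Suc i) \<and> {x i<..<x (Suc i)} \<inter> B = {})"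
  using assms
proof (induction B arbitrary: b rule: finite_linorder_max_induct)
  case empty
  then show ?case by (intro exI[of _ 1] exI[of _ "\<lambda>i. if i = 0 then a else b"]) auto
next
  case (insert c B)
  then have "B \<subseteq> {a<..<c}" "a < c" "c < b" by auto
  then obtain N x where x: "0 < N" "x 0 = a" "x N = c" "\<forall>i<N. x i < x (Suc i) \<and> {x i<..<x (Suc i)} \<inter> B = {}"
    using insert.IH by blast
  have le: "x (Suc i) \<le> c" if "i < N" for i
  proof -
    have "Suc i \<le> N" using that by simp
    then have "x (Suc i) \<le> x N"
    proof (induction N rule: dec_induct)
      case (step n)
      then show ?case using x(4) \<open>i < N\<close> by (cases "n < N") auto
    qed simp
    then show ?thesis using x by simp
  qed
  define x' where "x' = x(Suc N := b)"
  have "x' i < x' (Suc i) \<and> {x' i<..<x' (Suc i)} \<inter> insert c B = {}" if "i < Suc N" for i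
  proof (cases "i = N")
    case True
    then show ?thesis using x \<open>c < b\<close> insert.hyps by (force simp: x'_def)
  next
    case False
    then have "i < N" using that by simp
    then show ?thesis using x(4) le[of i] by (auto simp: x'_def)
  qed
  then show ?case using x by (intro exI[of _ "Suc N"] exI[of _ x']) (auto simp: x'_def)
qed

text \<open>The half-open cells fit the one-sided slopes: at an interface the right derivative of a
  forward characteristic is the speed in the cell to the right, that of a backward one is minus the
  speed in the cell to the left.\<close>

lemma in_cell_right_open:
  fixes x :: "nat \<Rightarrow> real"
  shows "x 0 \<le> y \<Longrightarrow> y < x n \<Longrightarrow> \<exists>i<n. x i \<le> y \<and> y < x (Suc i)"
proof (induction n)
  case (Suc n)
  then show ?case by (cases "y < x n") (auto simp: less_Suc_eq)
qed simp

lemma in_cell_left_open: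
  fixes x :: "nat \<Rightarrow> real"
  shows "x 0 < y \<Longrightarrow> y \<le> x n \<Longrightarrow> \<exists>i<n. x i < y \<and> y \<le> x (Suc i)"
proof (induction n)
  case (Suc n)
  then show ?case by (cases "y \<le> x n") (auto simp: less_Suc_eq)
qed simp

text \<open>Characteristics may have kinks at jumps, so right derivatives are used. A maximum of
  \<open>g t - \<eta> / 2 * t\<close> before the end of the interval is excluded by its right
  derivative, which halving \<open>\<eta>\<close> keeps positive.\<close>

lemma right_derivative_growth:
  fixes g :: "real \<Rightarrow> real"
  assumes cont: "continuous_on {T..} g" and \<eta>: "0 < \<eta>" and t: "T \<le> t"
    and D: "\<And>t. T \<le> t \<Longrightarrow> \<exists>D\<ge>\<eta>. (g has_real_derivative D) (at_right t)"
  shows "g T + \<eta> / 2 * (t - T) \<le> g t"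
proof -
  define f where "f = (\<lambda>t. g t - \<eta> / 2 * t)"
  have "continuous_on {T..t} f"
    unfolding f_def by (intro continuous_intros continuous_on_subset[OF cont]) auto
  then obtain s where s: "s \<in> {T..t}" "\<And>y. y \<in> {T..t} \<Longrightarrow> f y \<le> f s"
    using continuous_attains_sup[of "{T..t}" f] t by auto
  have "s = t"
  proof (rule ccontr)
    assume "s \<noteq> t"
    then have st: "s < t" using s by simp
    obtain D where D: "\<eta> \<le> D" "(g has_real_derivative D) (at_right s)" using D[of s] s by auto
    have "(f has_real_derivative D - \<eta> / 2) (at_right s)"
      unfolding f_def by (auto intro!: derivative_eq_intros D(2))
    from has_real_derivative_pos_inc_right[OF this] D(1) \<eta>
    obtain d where d: "0 < d" "\<forall>h>0. s + h \<in> {s<..} \<longrightarrow> h < d \<longrightarrow> f s < f (s + h)" by auto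
    define h where "h = min (d / 2) (t - s)"
    have "0 < h" "h < d" "s + h \<in> {T..t}" using d st s by (auto simp: h_def)
    then show False using d(2) s(2)[of "s + h"] by force
  qed
  then show ?thesis using s(2)[of T] t by (simp add: f_def right_diff_distrib)
qed

text \<open>The threshold form permits one common \<open>R\<close> for \<open>u\<close>,
  \<open>\<tau>\<close> and \<open>S\<close>.\<close>

lemma constant_outside_compactE:
  assumes "constant_outside_compact f"
  obtains M where "\<forall>R>M. (\<forall>y\<le>-R. f y = f (- R)) \<and> (\<forall>y\<ge>R. f y = f R)"
proof -
  obtain a b where "f constant_on {..a}" "f constant_on {b..}"
    using assms unfolding constant_outside_compact_def by blast
  then obtain c d where f: "\<forall>y\<le>a. f y = c" "\<forall>y\<ge>b. f y = d"
    unfolding constant_on_def by auto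
  have "(\<forall>y\<le>-R. f y = f (- R)) \<and> (\<forall>y\<ge>R. f y = f R)" if "max \<bar>a\<bar> \<bar>b\<bar> < R" for R
    using f that by auto
  then show thesis using that by blast
qed

section \<open>Reduction of the full problem to layers, and the two implications\<close>

locale rarefying_flow =
  fixes \<gamma> K c\<^sub>v :: real and \<tau> u :: "real \<times> real \<Rightarrow> real" and S :: "real \<Rightarrow> real"
  assumes \<gamma>: "1 < \<gamma>" and K: "0 < K" and cv: "0 < c\<^sub>v"
    and sol: "global_shock_free \<gamma> K c\<^sub>v \<tau> u S"
    and mono_m: "mono (m_var \<gamma> K c\<^sub>v S)"
    and const_u: "constant_outside_compact (\<lambda>x. u (x, 0))"
    and const_\<tau>: "constant_outside_compact (\<lambda>x. \<tau> (x, 0))"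
    and const_S: "constant_outside_compact S"
    and nc: "nowhere_compressive_initially \<gamma> K c\<^sub>v \<tau> u S"
begin

abbreviation "p \<equiv> pressure \<gamma> K c\<^sub>v \<tau> S"
abbreviation "ad \<equiv> adiabat K c\<^sub>v S"
abbreviation "speed \<equiv> sound_speed \<gamma> K c\<^sub>v \<tau> S"

lemma \<tau>_pos: "0 \<le> t \<Longrightarrow> 0 < \<tau> (x, t)"
  using sol by (simp add: global_shock_free_def Let_def)

lemma cont_p: "continuous_on (UNIV \<times> {0..}) p"
  using sol by (simp add: global_shock_free_def Let_def)

lemma finite_jumps: "finite (jumps (m_var \<gamma> K c\<^sub>v S))"
  using sol by (simp add: global_shock_free_def Let_def piecewise_constant_def)

lemma ad_mono: "x \<le> y \<Longrightarrow> ad x \<le> ad y"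
  using adiabat_le_iff[OF \<gamma> K cv] mono_m by (auto simp: mono_def)

lemmas strip_of_interval = isentropic_strip_of_interval[OF \<gamma> K cv sol]

text \<open>The line is cut at the jumps and at \<open>- R\<close> and \<open>R\<close>, outside of
  which the data are constant. The parameter \<open>L\<close> allows the limit of a given
  characteristic to be placed strictly inside the bounded cells.\<close>

lemma layering:
  fixes L :: real
  obtains A x N where "0 < N" "x 0 < L" "L < x N"
    "rarefying_layered_gas \<gamma> A x N u p (u (x 0, 0)) (p (x 0, 0)) (u (x N, 0)) (p (x N, 0))"
    "\<forall>i<N. \<forall>y\<in>{x i<..<x (Suc i)}. ad y = A (Suc i)"
    "Lim at_bot (\<lambda>x. u (x, 0)) = u (x 0, 0)" "Lim at_top (\<lambda>x. u (x, 0)) = u (x N, 0)"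
    "Lim at_bot (m_var \<gamma> K c\<^sub>v S) * Lim at_bot (\<lambda>x. z_var \<gamma> \<tau> (x, 0)) = riemann_w \<gamma> (A 0) (p (x 0, 0))"
    "Lim at_top (m_var \<gamma> K c\<^sub>v S) * Lim at_top (\<lambda>x. z_var \<gamma> \<tau> (x, 0)) = riemann_w \<gamma> (A (Suc N)) (p (x N, 0))"
proof -
  let ?m = "m_var \<gamma> K c\<^sub>v S"
  obtain Mu where Mu: "\<forall>R>Mu. (\<forall>y\<le>-R. u (y, 0) = u (- R, 0)) \<and> (\<forall>y\<ge>R. u (y, 0) = u (R, 0))"
    using constant_outside_compactE[OF const_u] .
  obtain Mt where Mt: "\<forall>R>Mt. (\<forall>y\<le>-R. \<tau> (y, 0) = \<tau> (- R, 0)) \<and> (\<forall>y\<ge>R. \<tau> (y, 0) = \<tau> (R, 0))"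
    using constant_outside_compactE[OF const_\<tau>] .
  obtain MS where MS: "\<forall>R>MS. (\<forall>y\<le>-R. S y = S (- R)) \<and> (\<forall>y\<ge>R. S y = S R)"
    using constant_outside_compactE[OF const_S] .
  obtain Mj where Mj: "\<And>y. y \<in> jumps ?m \<Longrightarrow> \<bar>y\<bar> \<le> Mj"
    using finite_imp_bounded[OF finite_jumps] by (auto simp: bounded_iff)
  define R where "R = \<bar>Mu\<bar> + \<bar>Mt\<bar> + \<bar>MS\<bar> + \<bar>Mj\<bar> + \<bar>L\<bar> + 1"
  have R: "Mu < R" "Mt < R" "MS < R" "Mj < R" "\<bar>L\<bar> < R" "0 < R" by (auto simp: R_def)
  have jumps_R: "jumps ?m \<subseteq> {-R<..<R}"
  proof
    fix y assume "y \<in> jumps ?m"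
    then show "y \<in> {-R<..<R}" using Mj[of y] R by auto
  qed
  obtain N x where N: "0 < N" and x: "x 0 = - R" "x N = R"
    and cells: "\<And>i. i < N \<Longrightarrow> x i < x (Suc i) \<and> {x i<..<x (Suc i)} \<inter> jumps ?m = {}"
    using grid_through_finite_set[OF finite_jumps jumps_R] R by auto
  \<comment> \<open>One sample point per strip: midpoints for the bounded cells, \<open>- R\<close>
    and \<open>R\<close> for the unbounded strips. The entropy is sampled away from the jumps, where
    its value is not determined by the strips; \<open>q i \<le> x i \<le> q (Suc i)\<close> makes
    \<open>A\<close> monotone.\<close>
  define q where "q = (\<lambda>i. if i = 0 then - R else if i \<le> N then (x (i - 1) + x i) / 2 else R)"
  define A where "A = (\<lambda>i. ad (q i))"
  have q_le: "q i \<le> x i" if "i \<le> N" for i using that cells[of "i - 1"] x by (cases i) (auto simp: q_def)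
  have le_q: "x i \<le> q (Suc i)" if "i \<le> N" for i using that cells[of i] x by (cases "i = N") (auto simp: q_def)
  have q_in: "q (Suc i) \<in> {x i<..<x (Suc i)}" if "i < N" for i using that cells[of i] by (auto simp: q_def)
  have u_left: "u (y, 0) = u (- R, 0)" if "y \<le> - R" for y
    by (rule Mu[rule_format, OF R(1), THEN conjunct1, rule_format, OF that])
  have \<tau>_left: "\<tau> (y, 0) = \<tau> (- R, 0)" if "y \<le> - R" for y
    by (rule Mt[rule_format, OF R(2), THEN conjunct1, rule_format, OF that])
  have S_left: "S y = S (- R)" if "y \<le> - R" for y
    by (rule MS[rule_format, OF R(3), THEN conjunct1, rule_format, OF that])
  have u_right: "u (y, 0) = u (R, 0)" if "R \<le> y" for y
    by (rule Mu[rule_format, OF R(1), THEN conjunct2, rule_format, OF that])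
  have \<tau>_right: "\<tau> (y, 0) = \<tau> (R, 0)" if "R \<le> y" for y
    by (rule Mt[rule_format, OF R(2), THEN conjunct2, rule_format, OF that])
  have S_right: "S y = S R" if "R \<le> y" for y
    by (rule MS[rule_format, OF R(3), THEN conjunct2, rule_format, OF that])
  have left: "isentropic_strip \<gamma> (A 0) {..x 0} u p"
  proof -
    have "isentropic_strip \<gamma> (ad (- R - 1)) (closure {..<- R}) u p"
      by (rule strip_of_interval(1)) (use jumps_R in auto)
    moreover have "ad (- R - 1) = A 0" using S_left[of "- R - 1"] by (simp add: A_def q_def adiabat_def)
    ultimately show ?thesis using x by simp
  qed
  have right: "isentropic_strip \<gamma> (A (Suc N)) {x N..} u p"
  proof -
    have "isentropic_strip \<gamma> (ad (R + 1)) (closure {R<..}) u p"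
      by (rule strip_of_interval(1)) (use jumps_R in auto)
    moreover have "ad (R + 1) = A (Suc N)" using S_right[of "R + 1"] by (simp add: A_def q_def adiabat_def)
    ultimately show ?thesis using x by simp
  qed
  have middle: "isentropic_strip \<gamma> (A (Suc i)) {x i..x (Suc i)} u p" if i: "i < N" for i
  proof -
    have "isentropic_strip \<gamma> (ad (q (Suc i))) (closure {x i<..<x (Suc i)}) u p"
      by (rule strip_of_interval(1)) (use cells[OF i] q_in[OF i] in auto)
    then show ?thesis using cells[OF i] by (simp add: A_def)
  qed
  have cell_ad: "ad y = A (Suc i)" if i: "i < N" and y: "y \<in> {x i<..<x (Suc i)}" for i y
    unfolding A_def by (rule strip_of_interval(2)[OF _ _ _ q_in[OF i] y]) (use cells[OF i] in auto)
  have flow: "rarefying_layered_gas \<gamma> A x N u p (u (x 0, 0)) (p (x 0, 0)) (u (x N, 0)) (p (x N, 0))"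
  proof
    show "A i \<le> A (Suc i)" if "i \<le> N" for i
      unfolding A_def using q_le[OF that] le_q[OF that] by (intro ad_mono) simp
    show "u (y, 0) = u (x 0, 0) \<and> p (y, 0) = p (x 0, 0)" if "y \<le> x 0" for y
      using u_left[of y] \<tau>_left[of y] S_left[of y] that x by (simp add: pressure_def)
    show "u (y, 0) = u (x N, 0) \<and> p (y, 0) = p (x N, 0)" if "x N \<le> y" for y
      using u_right[of y] \<tau>_right[of y] S_right[of y] that x by (simp add: pressure_def)
    show "inv_s \<gamma> (A (Suc i)) u p (y, 0) \<le> inv_s \<gamma> (A (Suc i)) u p (y', 0)"
      if "i < N" "x i \<le> y" "y \<le> y'" "y' \<le> x (Suc i)" for i y y'
      by (rule inv_s_initially_mono[OF \<gamma> K \<tau>_pos[OF order_refl] cont_p middle[OF that(1)] cell_ad[OF that(1)] nc that(2-4)])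
  qed (use \<gamma> left middle right cells in auto)
  have Lim_bot: "Lim at_bot f = f (- R)" if "\<And>y. y \<le> - R \<Longrightarrow> f y = f (- R)" for f :: "real \<Rightarrow> real"
  proof (rule tendsto_Lim)
    show "(f \<longlongrightarrow> f (- R)) at_bot"
      using that by (intro tendsto_eventually) (unfold eventually_at_bot_linorder, blast)
  qed simp
  have Lim_top: "Lim at_top f = f R" if "\<And>y. R \<le> y \<Longrightarrow> f y = f R" for f :: "real \<Rightarrow> real"
  proof (rule tendsto_Lim)
    show "(f \<longlongrightarrow> f R) at_top"
      using that by (intro tendsto_eventually) (unfold eventually_at_top_linorder, blast)
  qed simp
  show thesis
  proof (rule that[OF N _ _ flow])
    show "\<forall>i<N. \<forall>y\<in>{x i<..<x (Suc i)}. ad y = A (Suc i)" using cell_ad by blast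
    show "x 0 < L" "L < x N" using R x by auto
    show "Lim at_bot (\<lambda>x. u (x, 0)) = u (x 0, 0)" "Lim at_top (\<lambda>x. u (x, 0)) = u (x N, 0)"
      unfolding x by (rule Lim_bot, erule u_left) (rule Lim_top, erule u_right)
    have "Lim at_bot ?m = ?m (- R)" by (rule Lim_bot) (drule S_left, simp add: m_var_def)
    moreover have "Lim at_bot (\<lambda>x. z_var \<gamma> \<tau> (x, 0)) = z_var \<gamma> \<tau> (- R, 0)"
      by (rule Lim_bot) (drule \<tau>_left, simp add: z_var_def)
    ultimately show "Lim at_bot ?m * Lim at_bot (\<lambda>x. z_var \<gamma> \<tau> (x, 0)) = riemann_w \<gamma> (A 0) (p (x 0, 0))"
      using m_times_z[where \<tau> = \<tau> and q = "(- R, 0)" and S = S and c\<^sub>v = c\<^sub>v, OF \<gamma> K \<tau>_pos[OF order_refl]] x by (simp add: A_def q_def)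
    have "Lim at_top ?m = ?m R" by (rule Lim_top) (drule S_right, simp add: m_var_def)
    moreover have "Lim at_top (\<lambda>x. z_var \<gamma> \<tau> (x, 0)) = z_var \<gamma> \<tau> (R, 0)"
      by (rule Lim_top) (drule \<tau>_right, simp add: z_var_def)
    ultimately show "Lim at_top ?m * Lim at_top (\<lambda>x. z_var \<gamma> \<tau> (x, 0)) = riemann_w \<gamma> (A (Suc N)) (p (x N, 0))"
      using m_times_z[where \<tau> = \<tau> and q = "(R, 0)" and S = S and c\<^sub>v = c\<^sub>v, OF \<gamma> K \<tau>_pos[OF order_refl]] x by (simp add: A_def q_def)
  qed
qed

lemma Lim_speed:
  assumes t: "0 \<le> t" and A: "\<And>y. y \<in> {a<..<b} \<Longrightarrow> ad y = A" and A_pos: "0 < A"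
  shows "a \<le> x \<Longrightarrow> x < b \<Longrightarrow> Lim (at_right x) (\<lambda>y. speed (y, t)) = gas_speed \<gamma> A (p (x, t))"
    and "a < x \<Longrightarrow> x \<le> b \<Longrightarrow> Lim (at_left x) (\<lambda>y. speed (y, t)) = gas_speed \<gamma> A (p (x, t))"
proof -
  show "Lim (at_right x) (\<lambda>y. speed (y, t)) = gas_speed \<gamma> A (p (x, t))" if "a \<le> x" "x < b"
    by (rule Lim_sound_speed[OF \<gamma> K \<tau>_pos[OF t] t cont_p _ _ eventually_at_right_in[OF that] A A_pos])
       (auto intro: at_le)
  show "Lim (at_left x) (\<lambda>y. speed (y, t)) = gas_speed \<gamma> A (p (x, t))" if "a < x" "x \<le> b"
    by (rule Lim_sound_speed[OF \<gamma> K \<tau>_pos[OF t] t cont_p _ _ eventually_at_left_in[OF that] A A_pos])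
       (auto intro: at_le)
qed

text \<open>By contradiction: a pressure bounded below keeps every characteristic in the bounded
  cells faster than some \<open>\<eta> > 0\<close>, so it has to leave them and cannot converge to a
  point inside.\<close>

lemma vacuum_imp_large_velocity_difference:
  assumes vac: "has_asymptotic_vacuum \<gamma> K c\<^sub>v \<tau> S"
  shows "Lim at_top (\<lambda>x. u (x, 0)) - Lim at_bot (\<lambda>x. u (x, 0))
    \<ge> Lim at_bot (m_var \<gamma> K c\<^sub>v S) * Lim at_bot (\<lambda>x. z_var \<gamma> \<tau> (x, 0))
      + Lim at_top (m_var \<gamma> K c\<^sub>v S) * Lim at_top (\<lambda>x. z_var \<gamma> \<tau> (x, 0))"
proof (rule ccontr)
  assume small: "\<not> ?thesis"
  obtain t0 X L where t0: "0 \<le> t0" and X: "forward_characteristic \<gamma> K c\<^sub>v \<tau> S t0 X \<or> backward_characteristic \<gamma> K c\<^sub>v \<tau> S t0 X"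
    and lim: "(X \<longlongrightarrow> L) at_top"
    using vac unfolding has_asymptotic_vacuum_def by blast
  obtain A x N where N: "0 < N" and L: "x 0 < L" "L < x N"
    and flow: "rarefying_layered_gas \<gamma> A x N u p (u (x 0, 0)) (p (x 0, 0)) (u (x N, 0)) (p (x N, 0))"
    and cell': "\<forall>i<N. \<forall>y\<in>{x i<..<x (Suc i)}. ad y = A (Suc i)"
    and Lims: "Lim at_bot (\<lambda>x. u (x, 0)) = u (x 0, 0)" "Lim at_top (\<lambda>x. u (x, 0)) = u (x N, 0)"
    "Lim at_bot (m_var \<gamma> K c\<^sub>v S) * Lim at_bot (\<lambda>x. z_var \<gamma> \<tau> (x, 0)) = riemann_w \<gamma> (A 0) (p (x 0, 0))"
    "Lim at_top (m_var \<gamma> K c\<^sub>v S) * Lim at_top (\<lambda>x. z_var \<gamma> \<tau> (x, 0)) = riemann_w \<gamma> (A (Suc N)) (p (x N, 0))"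
    by (rule layering[of L]) blast
  have cell: "ad y = A (Suc i)" if "i < N" "y \<in> {x i<..<x (Suc i)}" for i y using cell' that by blast
  interpret rarefying_layered_gas \<gamma> A x N u p "u (x 0, 0)" "p (x 0, 0)" "u (x N, 0)" "p (x N, 0)" by (rule flow)
  have gap: "u (x N, 0) - riemann_w \<gamma> (A (Suc N)) (p (x N, 0)) < u (x 0, 0) + riemann_w \<gamma> (A 0) (p (x 0, 0))"
    using small unfolding Lims by simp
  obtain P where P: "0 < P" "\<And>i y t. i < N \<Longrightarrow> y \<in> {x i..x (Suc i)} \<Longrightarrow> 0 \<le> t \<Longrightarrow> P \<le> p (y, t)"
    using pressure_bounded_below[OF N gap] by blast
  \<comment> \<open>The least speed that the pressure bound \<open>P\<close> permits, over the
    finitely many entropies.\<close>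
  define \<eta> where "\<eta> = Min ((\<lambda>i. gas_speed \<gamma> (A (Suc i)) P) ` {..<N})"
  have A_pos': "0 < A (Suc i)" if "i < N" for i using that by (intro A_pos) simp
  have "0 < \<eta>" unfolding \<eta>_def using N A_pos' gas_speed_pos[OF \<gamma> _ P(1)] by (subst Min_gr_iff) auto
  have fast: "\<eta> \<le> gas_speed \<gamma> (A (Suc i)) (p (y, t))" if "i < N" "y \<in> {x i..x (Suc i)}" "0 \<le> t" for i y t
  proof -
    have "\<eta> \<le> gas_speed \<gamma> (A (Suc i)) P" unfolding \<eta>_def using that by (intro Min_le) auto
    also have "\<dots> \<le> gas_speed \<gamma> (A (Suc i)) (p (y, t))" by (rule gas_speed_mono[OF \<gamma> A_pos'[OF that(1)] P(1) P(2)[OF that]])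
    finally show ?thesis .
  qed
  have "\<forall>\<^sub>F t in at_top. x 0 < X t \<and> X t < x N \<and> t0 \<le> t"
    using L by (intro eventually_conj order_tendstoD[OF lim] eventually_ge_at_top) auto
  then obtain T where T: "\<And>t. T \<le> t \<Longrightarrow> x 0 < X t \<and> X t < x N \<and> t0 \<le> t"
    by (auto simp: eventually_at_top_linorder)
  \<comment> \<open>\<open>\<sigma> * X\<close> increases for both families, so one growth estimate
    serves for both.\<close>
  obtain \<sigma> :: real where \<sigma>: "\<sigma> \<in> {-1, 1}"
    and D: "\<And>t. T \<le> t \<Longrightarrow> \<exists>D\<ge>\<eta>. ((\<lambda>t. \<sigma> * X t) has_real_derivative D) (at_right t)"
    and cont: "continuous_on {T..} (\<lambda>t. \<sigma> * X t)"
    using X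
  proof
    assume fw: "forward_characteristic \<gamma> K c\<^sub>v \<tau> S t0 X"
    show thesis
    proof (rule that[of 1])
      fix t assume t: "T \<le> t"
      then have t': "t0 \<le> t" "0 \<le> t" using T[of t] t0 by auto
      obtain i where i: "i < N" "x i \<le> X t" "X t < x (Suc i)"
        using in_cell_right_open[of x "X t" N] T[OF t] by auto
      have "\<eta> \<le> Lim (at_right (X t)) (\<lambda>y. speed (y, t))"
      proof -
        have "Lim (at_right (X t)) (\<lambda>y. speed (y, t)) = gas_speed \<gamma> (A (Suc i)) (p (X t, t))"
          by (rule Lim_speed(1)[OF t'(2) cell[OF i(1)] A_pos'[OF i(1)] i(2,3)])
        then show ?thesis using fast[OF i(1), of "X t" t] i t' by simp
      qed
      then show "\<exists>D\<ge>\<eta>. ((\<lambda>t. 1 * X t) has_real_derivative D) (at_right t)"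
        using fw t' unfolding forward_characteristic_def by auto
    next
      show "continuous_on {T..} (\<lambda>t. 1 * X t)"
        using fw T[of T] by (auto simp: forward_characteristic_def elim!: continuous_on_subset)
    qed simp
  next
    assume bw: "backward_characteristic \<gamma> K c\<^sub>v \<tau> S t0 X"
    show thesis
    proof (rule that[of "-1"])
      fix t assume t: "T \<le> t"
      then have t': "t0 \<le> t" "0 \<le> t" using T[of t] t0 by auto
      obtain i where i: "i < N" "x i < X t" "X t \<le> x (Suc i)"
        using in_cell_left_open[of x "X t" N] T[OF t] by auto
      have le: "\<eta> \<le> Lim (at_left (X t)) (\<lambda>y. speed (y, t))"
      proof -
        have "Lim (at_left (X t)) (\<lambda>y. speed (y, t)) = gas_speed \<gamma> (A (Suc i)) (p (X t, t))"
          by (rule Lim_speed(2)[OF t'(2) cell[OF i(1)] A_pos'[OF i(1)] i(2,3)])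
        then show ?thesis using fast[OF i(1), of "X t" t] i t' by simp
      qed
      have "(X has_real_derivative - Lim (at_left (X t)) (\<lambda>y. speed (y, t))) (at_right t)"
        using bw t' unfolding backward_characteristic_def by blast
      from DERIV_cmult[OF this, of "-1"] le
      show "\<exists>D\<ge>\<eta>. ((\<lambda>t. -1 * X t) has_real_derivative D) (at_right t)" by auto
    next
      have "continuous_on {T..} X"
        using bw T[of T] by (auto simp: backward_characteristic_def elim!: continuous_on_subset)
      then show "continuous_on {T..} (\<lambda>t. -1 * X t)" by (intro continuous_intros)
    qed simp
  qed
  \<comment> \<open>At the guaranteed rate \<open>\<eta> / 2\<close> the curve covers the whole
    width \<open>x N - x 0\<close> by this time.\<close>
  define t where "t = T + 2 * (x N - x 0) / \<eta>"
  have "0 \<le> 2 * (x N - x 0) / \<eta>" using L \<open>0 < \<eta>\<close> by simp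
  then have t: "T \<le> t" by (simp add: t_def)
  have "\<sigma> * X T + \<eta> / 2 * (t - T) \<le> \<sigma> * X t"
    by (rule right_derivative_growth[OF cont \<open>0 < \<eta>\<close> t D])
  moreover have "\<eta> / 2 * (t - T) = x N - x 0" using \<open>0 < \<eta>\<close> by (simp add: t_def)
  ultimately have "\<sigma> * X T + (x N - x 0) \<le> \<sigma> * X t" by linarith
  then show False using \<sigma> T[OF t] T[OF order_refl] by auto
qed

text \<open>The trapped curve decreases and is bounded below, hence converges; the remaining work is
  to verify the one-sided slopes that define a backward characteristic.\<close>

lemma large_velocity_difference_imp_vacuum:
  assumes large: "Lim at_top (\<lambda>x. u (x, 0)) - Lim at_bot (\<lambda>x. u (x, 0))
    \<ge> Lim at_bot (m_var \<gamma> K c\<^sub>v S) * Lim at_bot (\<lambda>x. z_var \<gamma> \<tau> (x, 0))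
      + Lim at_top (m_var \<gamma> K c\<^sub>v S) * Lim at_top (\<lambda>x. z_var \<gamma> \<tau> (x, 0))"
  shows "has_asymptotic_vacuum \<gamma> K c\<^sub>v \<tau> S"
proof -
  obtain A x N where flow: "rarefying_layered_gas \<gamma> A x N u p (u (x 0, 0)) (p (x 0, 0)) (u (x N, 0)) (p (x N, 0))"
    and cell': "\<forall>i<N. \<forall>y\<in>{x i<..<x (Suc i)}. ad y = A (Suc i)"
    and Lims: "Lim at_bot (\<lambda>x. u (x, 0)) = u (x 0, 0)" "Lim at_top (\<lambda>x. u (x, 0)) = u (x N, 0)"
    "Lim at_bot (m_var \<gamma> K c\<^sub>v S) * Lim at_bot (\<lambda>x. z_var \<gamma> \<tau> (x, 0)) = riemann_w \<gamma> (A 0) (p (x 0, 0))"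
    "Lim at_top (m_var \<gamma> K c\<^sub>v S) * Lim at_top (\<lambda>x. z_var \<gamma> \<tau> (x, 0)) = riemann_w \<gamma> (A (Suc N)) (p (x N, 0))"
    by (rule layering[of 0]) blast
  have cell: "ad y = A (Suc i)" if "i < N" "y \<in> {x i<..<x (Suc i)}" for i y using cell' that by blast
  interpret rarefying_layered_gas \<gamma> A x N u p "u (x 0, 0)" "p (x 0, 0)" "u (x N, 0)" "p (x N, 0)" by (rule flow)
  have le: "u (x 0, 0) + riemann_w \<gamma> (A 0) (p (x 0, 0)) \<le> u (x N, 0) - riemann_w \<gamma> (A (Suc N)) (p (x N, 0))"
    using large unfolding Lims by simp
  obtain i T Y where i: "i < N" and T: "0 \<le> T"
    and Y: "\<And>t. T \<le> t \<Longrightarrow> x i < Y t \<and> Y t \<le> x (Suc i) \<and>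
       (Y has_real_derivative - gas_speed \<gamma> (A (Suc i)) (p (Y t, t))) (at t within {T..})"
    by (rule trapped_curve[OF le]) blast
  have A_pos': "0 < A (Suc i)" using i by (intro A_pos) simp
  have speed_pos: "0 < gas_speed \<gamma> (A (Suc i)) (p (Y t, t))" if "T \<le> t" for t
    using that T by (intro gas_speed_pos[OF \<gamma> A_pos'] pressure_pos[where \<tau> = \<tau>, OF K \<tau>_pos]) simp
  have contY: "continuous_on {T..} Y"
    by (rule DERIV_continuous_on[where D = "\<lambda>t. - gas_speed \<gamma> (A (Suc i)) (p (Y t, t))"]) (use Y in auto)
  have at_t: "(Y has_real_derivative - gas_speed \<gamma> (A (Suc i)) (p (Y t, t))) (at t)" if "T < t" for t
    using Y[of t] that at_within_interior[of t "{T..}"] by simp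
  have decr: "Y t' < Y t" if "T \<le> t" "t < t'" for t t'
  proof (rule DERIV_neg_imp_decreasing_open[OF that(2)])
    show "\<exists>D. (Y has_real_derivative D) (at s) \<and> D < 0" if "t < s" for s
      using at_t[of s] speed_pos[of s] that \<open>T \<le> t\<close> by (intro exI[of _ "- gas_speed \<gamma> (A (Suc i)) (p (Y s, s))"]) auto
    show "continuous_on {t..t'} Y" by (rule continuous_on_subset[OF contY]) (use that in auto)
  qed
  \<comment> \<open>The curve may start on the right interface, where only the left limit of the
    speed is required at time \<open>T\<close>. Afterwards it lies strictly inside the cell, so both
    one-sided limits belong to the same strip.\<close>
  have inside: "Y t < x (Suc i)" if "T < t" for t
    using decr[OF order_refl that] Y[OF order_refl] by simp
  have "backward_characteristic \<gamma> K c\<^sub>v \<tau> S T Y"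
    unfolding backward_characteristic_def
  proof (intro conjI allI impI contY)
    fix t assume t: "T \<le> t"
    then have "Lim (at_left (Y t)) (\<lambda>y. speed (y, t)) = gas_speed \<gamma> (A (Suc i)) (p (Y t, t))"
      using Y[OF t] T by (intro Lim_speed(2)[OF _ cell[OF i] A_pos']) auto
    then show "(Y has_real_derivative - Lim (at_left (Y t)) (\<lambda>y. speed (y, t))) (at_right t)"
      using Y[OF t] t by (auto elim!: DERIV_subset)
  next
    fix t assume t: "T < t"
    then have "Lim (at_right (Y t)) (\<lambda>y. speed (y, t)) = gas_speed \<gamma> (A (Suc i)) (p (Y t, t))"
      using Y[of t] inside[OF t] T by (intro Lim_speed(1)[OF _ cell[OF i] A_pos']) auto
    then show "(Y has_real_derivative - Lim (at_right (Y t)) (\<lambda>y. speed (y, t))) (at_left t)"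
      using has_field_derivative_at_within[OF at_t[OF t]] by simp
  qed
  moreover have "(Y \<longlongrightarrow> (INF t\<in>{T..}. Y t)) at_top"
  proof (rule decreasing_tendsto)
    have bdd: "bdd_below (Y ` {T..})" by (rule bdd_belowI2[where m = "x i"]) (use Y in \<open>auto intro: less_imp_le\<close>)
    show "\<forall>\<^sub>F t in at_top. (INF t\<in>{T..}. Y t) \<le> Y t"
      using eventually_ge_at_top[of T] by eventually_elim (auto intro!: cINF_lower bdd)
    fix z assume "(INF t\<in>{T..}. Y t) < z"
    then obtain t1 where t1: "T \<le> t1" "Y t1 < z" using bdd by (subst (asm) cINF_less_iff) auto
    show "\<forall>\<^sub>F t in at_top. Y t < z"
      using eventually_gt_at_top[of t1] by eventually_elim (use decr[OF t1(1)] t1(2) in force)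
  qed
  ultimately show ?thesis unfolding has_asymptotic_vacuum_def using T by blast
qed

end

theorem lemma5p3:
  fixes \<gamma> K c\<^sub>v :: real
    and \<tau> u :: "real \<times> real \<Rightarrow> real"
    and S :: "real \<Rightarrow> real"
  defines "m \<equiv> m_var \<gamma> K c\<^sub>v S"
    and "u\<^sub>0 \<equiv> (\<lambda>x. u (x, 0))"
    and "\<tau>\<^sub>0 \<equiv> (\<lambda>x. \<tau> (x, 0))"
    and "z\<^sub>0 \<equiv> (\<lambda>x. z_var \<gamma> \<tau> (x, 0))"
  assumes "\<gamma> > 1" and "K > 0" and "c\<^sub>v > 0"
    and "global_shock_free \<gamma> K c\<^sub>v \<tau> u S"
    and "mono m"
    and "constant_outside_compact u\<^sub>0"
    and "constant_outside_compact \<tau>\<^sub>0"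
    and "constant_outside_compact S"
    and "nowhere_compressive_initially \<gamma> K c\<^sub>v \<tau> u S"
  shows "has_asymptotic_vacuum \<gamma> K c\<^sub>v \<tau> S \<longleftrightarrow>
           Lim at_top u\<^sub>0 - Lim at_bot u\<^sub>0
             \<ge> Lim at_bot m * Lim at_bot z\<^sub>0 + Lim at_top m * Lim at_top z\<^sub>0"
proof -
  interpret rarefying_flow \<gamma> K c\<^sub>v \<tau> u S
    using assms by unfold_locales (auto simp: m_def u\<^sub>0_def \<tau>\<^sub>0_def)
  show ?thesis
    unfolding m_def u\<^sub>0_def z\<^sub>0_def
    using vacuum_imp_large_velocity_difference large_velocity_difference_imp_vacuum by blast
qed

end
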